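(* Let $d=3$, $w(k)=(2\pi^2)^{-1}|k|^{-2}$ and $T=0$. Then there is a first-order phase transition between the ferromagnetic and paramagnetic phases at the density $$\rho_c=\frac{125}{24\pi^5}\left(\frac{1}{1+2^{1/3}}\right)^3 .$$ More precisely: (i) for all $0<\rho<\rho_c$, the minimisers of $E^{\rm HF}(\rho)$ are all of the form $\gamma_{\rm ferro}(k)=\mathbf 1\big(k^2\le c_{\rm TF}\rho^{2/3}\big)\,|\nu\rangle\langle\nu|$ with $\nu$ any normalised vector in $\mathbb{C}^2$ (ferromagnetic phase); (ii) for all $\rho>\rho_c$, the minimiser of $E^{\rm HF}(\rho)$ is unique and given by $\gamma_{\rm para}(k)=\mathbf 1\big(k^2\le c_{\rm TF}(\rho/2)^{2/3}\big)\,\mathbb{I}_2$ (paramagnetic phase); (iii) for $\rho=\rho_c$, the minimisers are of either form. The first derivative of the ground state energy $\rho\mapsto E^{\rm HF}(\rho)$ has a jump at $\rho=\rho_c$.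
   Context: Here, with $d=3$, $$E^{\rm HF}(\rho)=\min\Big\{\frac{1}{2(2\pi)^3}\int_{\mathbb{R}^3}|k|^2\,\mathrm{tr}_{\mathbb{C}^2}\gamma(k)\,dk-\frac{1}{2(2\pi)^3}\iint_{\mathbb{R}^3\times\mathbb{R}^3}w(k-k')\,\mathrm{tr}_{\mathbb{C}^2}[\gamma(k)\gamma(k')]\,dk\,dk'\Big\},$$ the minimum being over measurable functions $\gamma$ on $\mathbb{R}^3$ with values in $2\times2$ hermitian matrices, with $0\le\gamma(k)\le\mathbb{I}_2$ and $(2\pi)^{-3}\int\mathrm{tr}_{\mathbb{C}^2}\gamma=\rho$ (functions are identified when equal almost everywhere). The constant is $c_{\rm TF}=4\pi^2\,(3/|\mathbb{S}^2|)^{2/3}$ with $|\mathbb{S}^2|=4\pi$. $|\nu\rangle\langle\nu|$ is the orthogonal projection onto $\mathbb{C}\nu$. *)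

theory Defs
  imports "HOL-Analysis.Analysis"
begin

type_synonym spin_matrix = "complex ^ 2 ^ 2"
type_synonym state = "real ^ 3 \<Rightarrow> spin_matrix"

definition hermitian :: "spin_matrix \<Rightarrow> bool" where
  "hermitian A \<longleftrightarrow> (\<forall>i j. A $ i $ j = cnj (A $ j $ i))"

definition pos_semidef :: "spin_matrix \<Rightarrow> bool" where
  "pos_semidef A \<longleftrightarrow> hermitian A \<and> (\<forall>v. 0 \<le> Re (\<Sum>i\<in>UNIV. cnj (v $ i) * (A *v v) $ i))"

definition loewner_le :: "spin_matrix \<Rightarrow> spin_matrix \<Rightarrow> bool" where
  "loewner_le A B \<longleftrightarrow> pos_semidef (B - A)"

definition ket_bra :: "complex ^ 2 \<Rightarrow> spin_matrix" where
  "ket_bra \<nu> = (\<chi> i j. \<nu> $ i * cnj (\<nu> $ j))"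

definition coulomb_w :: "real ^ 3 \<Rightarrow> real" where
  "coulomb_w k = 1 / (2 * pi\<^sup>2 * (norm k)\<^sup>2)"

text \<open>Functions are identified when equal almost everywhere, so the pointwise constraints are
  imposed almost everywhere.\<close>

definition admissible :: "real \<Rightarrow> state \<Rightarrow> bool" where
  "admissible \<rho> \<gamma> \<longleftrightarrow>
     \<gamma> \<in> borel_measurable lebesgue \<and>
     (AE k in lebesgue. hermitian (\<gamma> k) \<and> loewner_le 0 (\<gamma> k) \<and> loewner_le (\<gamma> k) (mat 1)) \<and>
     integrable lebesgue (\<lambda>k. Re (trace (\<gamma> k))) \<and>
     1 / (2 * pi) ^ 3 * (\<integral>k. Re (trace (\<gamma> k)) \<partial>lebesgue) = \<rho>"

text \<open>For admissible states both traces below are real and nonnegative almost everywhere, so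
  passing to \<^term>\<open>Re\<close> and \<^term>\<open>ennreal\<close> loses nothing. The kinetic energy of an admissible
  state may be infinite, in which case the total energy is \<^term>\<open>\<infinity> :: ereal\<close>; the exchange
  integral is always finite, because \<^term>\<open>coulomb_w\<close> is locally integrable, and bounded
  outside any ball around the origin.\<close>

definition kinetic_energy :: "state \<Rightarrow> ennreal" where
  "kinetic_energy \<gamma> = ennreal (1 / (2 * (2 * pi) ^ 3)) *
     (\<integral>\<^sup>+ k. ennreal ((norm k)\<^sup>2 * Re (trace (\<gamma> k))) \<partial>lebesgue)"

definition exchange_energy :: "state \<Rightarrow> ennreal" where
  "exchange_energy \<gamma> = ennreal (1 / (2 * (2 * pi) ^ 3)) *
     (\<integral>\<^sup>+ (k, k'). ennreal (coulomb_w (k - k') * Re (trace (\<gamma> k ** \<gamma> k')))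
        \<partial>(lebesgue :: ((real ^ 3) \<times> (real ^ 3)) measure))"

definition HF_energy :: "state \<Rightarrow> ereal" where
  "HF_energy \<gamma> = enn2ereal (kinetic_energy \<gamma>) - enn2ereal (exchange_energy \<gamma>)"

definition E_HF :: "real \<Rightarrow> ereal" where
  "E_HF \<rho> = (INF \<gamma> \<in> {\<gamma>. admissible \<rho> \<gamma>}. HF_energy \<gamma>)"

definition is_minimiser :: "real \<Rightarrow> state \<Rightarrow> bool" where
  "is_minimiser \<rho> \<gamma> \<longleftrightarrow> admissible \<rho> \<gamma> \<and> HF_energy \<gamma> = E_HF \<rho>"

definition c_TF :: real where
  "c_TF = 4 * pi\<^sup>2 * (3 / (4 * pi)) powr (2 / 3)"

definition gamma_ferro :: "real \<Rightarrow> complex ^ 2 \<Rightarrow> state" where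
  "gamma_ferro \<rho> \<nu> k = (if (norm k)\<^sup>2 \<le> c_TF * \<rho> powr (2 / 3) then ket_bra \<nu> else 0)"

definition gamma_para :: "real \<Rightarrow> state" where
  "gamma_para \<rho> k = (if (norm k)\<^sup>2 \<le> c_TF * (\<rho> / 2) powr (2 / 3) then mat 1 else 0)"

definition ferromagnetic :: "real \<Rightarrow> state \<Rightarrow> bool" where
  "ferromagnetic \<rho> \<gamma> \<longleftrightarrow> (\<exists>\<nu>. norm \<nu> = 1 \<and> (AE k in lebesgue. \<gamma> k = gamma_ferro \<rho> \<nu> k))"

definition paramagnetic :: "real \<Rightarrow> state \<Rightarrow> bool" where
  "paramagnetic \<rho> \<gamma> \<longleftrightarrow> (AE k in lebesgue. \<gamma> k = gamma_para \<rho> k)"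

definition rho_c :: real where
  "rho_c = 125 / (24 * pi ^ 5) * (1 / (1 + 2 powr (1 / 3))) ^ 3"

definition derivative_jumps_at :: "(real \<Rightarrow> real) \<Rightarrow> real \<Rightarrow> bool" where
  "derivative_jumps_at f x \<longleftrightarrow>
     isCont f x \<and> (\<forall>\<^sub>F y in at x. f differentiable at y) \<and>
     (\<exists>l r. (deriv f \<longlongrightarrow> l) (at_left x) \<and> (deriv f \<longlongrightarrow> r) (at_right x) \<and> l \<noteq> r)"

end

theory Submission
  imports Defs "HOL-Probability.Probability" "HOL-Complex_Analysis.Great_Picard"
begin

text \<open>Writing a spin matrix as occupation \<open>a\<close> plus spin vector \<open>b\<close>, its eigenvalues are \<open>a + |b|\<close> and
  \<open>a - |b|\<close>, and \<open>tr \<gamma>(k)\<gamma>(k') = 2(a a' + b \<bullet> b')\<close> is at most the sum of the two products of eigenvalues.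
  This reduces the energy to two scalar problems with a constraint \<open>0 \<le> g \<le> 1\<close>. In each of them the kinetic
  energy is minimised, strictly, by the ball of the right mass (bathtub principle), and the exchange energy is
  maximised by the same ball (a rearrangement inequality, proved by polarization). With \<open>4\<pi>\<^sup>2R\<^sup>4\<close> for
  the exchange integral of a ball, what remains is to minimise \<open>e(m1) + e(m2)\<close> over \<open>m1 + m2 = \<rho>\<close>: the
  curve of pairs (kinetic, exchange) lies strictly below its chord, so only \<open>m2 = 0\<close> and \<open>m1 = m2\<close> can be optimal,
  and the chord's slope gives the critical density. Equality in \<open>b \<bullet> b' \<le> |b||b'|\<close> forces a constant spin
  direction in the ferromagnetic case.\<close>

subsection \<open>Isometries and Lebesgue measure\<close>

text \<open>The two scalar bounds play different roles. Equality is controlled by the kinetic energy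
  alone, so the rearrangement inequality is proved only in its weak form, through limits that would
  lose its equality cases anyway. It also suffices to compare with some radially decreasing function
  of the same mass: the bathtub principle, applied to one argument of the interaction at a time,
  then leads to the ball.

  The constants come from scaling. If a fraction x of the mass sits in one spin component and F is
  the Fermi radius of the total mass, the kinetic part is F^5 (x^(5/3) + (1-x)^(5/3)) / (20 pi^2)
  and the exchange part is F^4 (x^(4/3) + (1-x)^(4/3)) / (8 pi^3). In the plane of the two brackets
  the chord from x = 1/2 to x = 1 has slope c / (1 + c) with c = 2^(1/3). The two phases have equal
  energy when F / (20 pi^2) equals this slope divided by 8 pi^3, that is F = 5 c / (2 pi (1 + c));
  cubing and using c^3 = 2 gives \<open>rho_c\<close>.\<close>

lemma distr_lborel_orthogonal:
  fixes f :: "real ^ 'n::{finite,wellorder} \<Rightarrow> real ^ 'n::{finite,wellorder}"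
  assumes f: "orthogonal_transformation f"
  shows "distr lborel borel f = lborel"
proof (rule lborel_eqI[symmetric])
  have cf: "continuous_on UNIV f"
    using f by (simp add: linear_continuous_on orthogonal_transformation_def linear_conv_bounded_linear)
  then have [measurable]: "f \<in> borel_measurable borel"
    by (rule borel_measurable_continuous_onI)
  have b: "bij f" using f by (rule orthogonal_transformation_bij)
  have i: "orthogonal_transformation (inv f)" using f by (rule orthogonal_transformation_inv)
  fix l u :: "real ^ 'n::{finite,wellorder}"
  assume lu: "\<And>b. b \<in> Basis \<Longrightarrow> l \<bullet> b \<le> u \<bullet> b"
  have v: "f -` box l u = inv f ` box l u" using b by (rule bij_vimage_eq_inv_image)
  have lm: "inv f ` box l u \<in> lmeasurable"
    using measurable_orthogonal_image[OF i, of "box l u"] by simp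
  have "emeasure (distr lborel borel f) (box l u) = emeasure lborel (f -` box l u)"
    by (simp add: emeasure_distr)
  also have "\<dots> = emeasure lebesgue (inv f ` box l u)"
    using measurable_sets[of f borel borel "box l u"] by (simp add: v)
  also have "\<dots> = ennreal (measure lebesgue (inv f ` box l u))"
    using lm by (rule emeasure_eq_measure2)
  also have "\<dots> = ennreal (measure lebesgue (box l u))"
    using i by (subst measure_orthogonal_image) auto
  also have "\<dots> = (\<Prod>b\<in>Basis. (u - l) \<bullet> b)"
    using lu by (simp add: measure_lborel_box_eq)
  finally show "emeasure (distr lborel borel f) (box l u) = (\<Prod>b\<in>Basis. (u - l) \<bullet> b)" .
qed simp

lemma borel_measurable_orthogonal:
  fixes f :: "real ^ 'n::{finite,wellorder} \<Rightarrow> real ^ 'n::{finite,wellorder}"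
  assumes "orthogonal_transformation f"
  shows "f \<in> borel_measurable borel"
  using assms by (intro borel_measurable_continuous_onI)
    (simp add: linear_continuous_on orthogonal_transformation_def linear_conv_bounded_linear)

lemma nn_integral_lborel_orthogonal:
  fixes f :: "real ^ 'n::{finite,wellorder} \<Rightarrow> real ^ 'n::{finite,wellorder}"
  assumes f: "orthogonal_transformation f" and g: "g \<in> borel_measurable borel"
  shows "(\<integral>\<^sup>+x. g (f x) \<partial>lborel) = (\<integral>\<^sup>+x. g x \<partial>lborel)"
  using nn_integral_distr[of f lborel borel g] borel_measurable_orthogonal[OF f] g
  by (simp add: distr_lborel_orthogonal[OF f])

text \<open>For a unit vector \<open>n\<close> this is the reflection in the affine hyperplane of
  all y with \<open>y \<bullet> n = s\<close>.\<close>

definition hrefl :: "'a::real_inner \<Rightarrow> real \<Rightarrow> 'a \<Rightarrow> 'a" where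
  "hrefl n s y = y - (2 * (y \<bullet> n - s)) *\<^sub>R n"

lemma continuous_on_hrefl [continuous_intros]:
  "continuous_on A f \<Longrightarrow> continuous_on A (\<lambda>x. hrefl n s (f x))"
  unfolding hrefl_def by (intro continuous_intros)

lemma borel_measurable_hrefl [measurable]:
  "hrefl n s \<in> borel_measurable (borel :: 'a::euclidean_space measure)"
  by (intro borel_measurable_continuous_onI continuous_intros)

lemma nn_integral_lborel_hrefl:
  fixes n :: "real ^ 'n::{finite,wellorder}"
  assumes n: "norm n = 1" and g: "g \<in> borel_measurable borel"
  shows "(\<integral>\<^sup>+x. g (hrefl n s x) \<partial>lborel) = (\<integral>\<^sup>+x. g x \<partial>lborel)"
proof -
  have nn: "n \<bullet> n = 1" using n by (simp add: dot_square_norm)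
  \<comment> \<open>The affine reflection is the linear one (\<open>s = 0\<close>) followed by the
    translation by \<open>2 * s\<close> times \<open>n\<close>.\<close>
  have o: "orthogonal_transformation (hrefl n 0)"
    unfolding orthogonal_transformation_def
    by (auto intro!: linearI simp: hrefl_def algebra_simps inner_add_left inner_add_right
       inner_diff_left inner_diff_right nn inner_commute)
  have g': "(\<lambda>x. g ((2 * s) *\<^sub>R n + x)) \<in> borel_measurable borel"
    using g by measurable
  have "(\<integral>\<^sup>+x. g (hrefl n s x) \<partial>lborel) = (\<integral>\<^sup>+x. g ((2 * s) *\<^sub>R n + hrefl n 0 x) \<partial>lborel)"
    by (simp add: hrefl_def algebra_simps)
  also have "\<dots> = (\<integral>\<^sup>+x. g ((2 * s) *\<^sub>R n + x) \<partial>lborel)"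
    using nn_integral_lborel_orthogonal[OF o g'] .
  also have "\<dots> = (\<integral>\<^sup>+x. g x \<partial>distr lborel borel ((+) ((2 * s) *\<^sub>R n)))"
    using g by (simp add: nn_integral_distr)
  finally show ?thesis by (simp add: lborel_distr_plus)
qed

lemma hrefl_hrefl [simp]: "norm n = 1 \<Longrightarrow> hrefl n s (hrefl n s y) = y"
  by (simp add: hrefl_def inner_diff_left dot_square_norm algebra_simps)

lemma inner_hrefl: "norm n = 1 \<Longrightarrow> hrefl n s y \<bullet> n - s = - (y \<bullet> n - s)"
  by (simp add: hrefl_def inner_diff_left dot_square_norm algebra_simps)

text \<open>The product of the signed distances to the mirror decides which of y and its image is
  closer to x: y itself if both points lie on the same side, the image otherwise. Every comparison
  of kernels under polarization rests on this identity.\<close>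

lemma norm_diff_hrefl:
  "norm n = 1 \<Longrightarrow> (norm (x - hrefl n s y))\<^sup>2 = (norm (x - y))\<^sup>2 + 4 * (x \<bullet> n - s) * (y \<bullet> n - s)"
proof -
  assume n: "norm n = 1"
  then have nn: "n \<bullet> n = 1" by (simp add: dot_square_norm)
  have x: "x - hrefl n s y = (x - y) + (2 * (y \<bullet> n - s)) *\<^sub>R n" by (simp add: hrefl_def)
  have "(norm (x - hrefl n s y))\<^sup>2
      = (norm (x - y))\<^sup>2 + (2 * (y \<bullet> n - s))\<^sup>2 + 2 * ((x - y) \<bullet> ((2 * (y \<bullet> n - s)) *\<^sub>R n))"
    unfolding x power2_norm_eq_inner inner_add_left inner_add_right
    by (simp add: nn inner_commute power2_eq_square algebra_simps)
  then show ?thesis by (simp add: inner_diff_left algebra_simps power2_eq_square)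
qed

lemma norm_hrefl_diff:
  "norm n = 1 \<Longrightarrow> norm (hrefl n s x - y) = norm (x - hrefl n s y)"
proof -
  assume n: "norm n = 1"
  have "(norm (hrefl n s x - y))\<^sup>2 = (norm (y - hrefl n s x))\<^sup>2" "norm (y - x) = norm (x - y)"
    by (simp_all add: norm_minus_commute)
  moreover have "4 * (y \<bullet> n - s) * (x \<bullet> n - s) = 4 * (x \<bullet> n - s) * (y \<bullet> n - s)"
    by (simp only: ac_simps)
  ultimately have "(norm (hrefl n s x - y))\<^sup>2 = (norm (x - hrefl n s y))\<^sup>2"
    using norm_diff_hrefl[OF n, of x s y] norm_diff_hrefl[OF n, of y s x] by metis
  then show ?thesis by (simp add: power2_eq_iff_nonneg)
qed

lemma norm_hrefl_hrefl:
  "norm n = 1 \<Longrightarrow> norm (hrefl n s x - hrefl n s y) = norm (x - y)"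
  by (simp add: norm_hrefl_diff)

text \<open>The previous identity with x at the origin. For \<open>s > 0\<close> the origin lies on
  the side \<open>y \<bullet> n < s\<close>, and reflection moves points of that side
  outwards.\<close>

lemma norm_hrefl:
  "norm n = 1 \<Longrightarrow> (norm (hrefl n s y))\<^sup>2 = (norm y)\<^sup>2 - 4 * s * (y \<bullet> n - s)"
  using norm_diff_hrefl[of n 0 s y] by (simp add: algebra_simps)

text \<open>The mirror is the perpendicular bisector of u and v. Its offset from the origin is
  positive because u is strictly nearer to the origin than v.\<close>

lemma exists_hrefl:
  fixes u v :: "'a::real_inner"
  assumes "norm u < norm v"
  obtains n s where "norm n = 1" "0 < s" "hrefl n s u = v" "u \<bullet> n < s"
proof -
  define n where "n = (v - u) /\<^sub>R norm (v - u)"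
  define s where "s = ((norm v)\<^sup>2 - (norm u)\<^sup>2) / (2 * norm (v - u))"
  have d: "norm (v - u) > 0" using assms by auto
  have u: "u \<bullet> n - s = - norm (v - u) / 2"
  proof -
    have "u \<bullet> n - s = (2 * (u \<bullet> (v - u)) - ((norm v)\<^sup>2 - (norm u)\<^sup>2)) / (2 * norm (v - u))"
      using d unfolding n_def s_def by (simp add: field_simps inner_diff_right)
    also have "2 * (u \<bullet> (v - u)) - ((norm v)\<^sup>2 - (norm u)\<^sup>2) = - (norm (v - u))\<^sup>2"
      by (simp add: power2_norm_eq_inner inner_diff_left inner_diff_right inner_commute)
    finally show ?thesis using d by (simp add: power2_eq_square)
  qed
  show ?thesis
  proof
    show "norm n = 1" using d by (simp add: n_def)
    show "0 < s" using d assms by (auto simp: s_def power_strict_mono intro!: divide_pos_pos)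
    show "hrefl n s u = v" using d by (simp add: hrefl_def u) (simp add: n_def)
    show "u \<bullet> n < s" using u d by linarith
  qed
qed

lemma nn_integral_lborel_reflect_shift:
  fixes g :: "'a::euclidean_space \<Rightarrow> ennreal"
  assumes [measurable]: "g \<in> borel_measurable borel"
  shows "(\<integral>\<^sup>+y. g (x - y) \<partial>lborel) = (\<integral>\<^sup>+y. g y \<partial>lborel)"
proof -
  have "(lborel :: 'a measure) = distr lborel borel (\<lambda>y. x + (- 1) *\<^sub>R y)"
    using lborel_affine[of "-1" "x"] by (simp add: density_1)
  then have "(\<integral>\<^sup>+y. g y \<partial>lborel) = (\<integral>\<^sup>+y. g y \<partial>distr lborel borel (\<lambda>y. x + (- 1) *\<^sub>R y))"
    by simp
  also have "\<dots> = (\<integral>\<^sup>+y. g (x - y) \<partial>lborel)" by (subst nn_integral_distr) auto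
  finally show ?thesis ..
qed

lemma nn_integral_lborel_scale:
  fixes g :: "'a::euclidean_space \<Rightarrow> ennreal"
  assumes [measurable]: "g \<in> borel_measurable borel" and c: "c > 0"
  shows "(\<integral>\<^sup>+y. g y \<partial>lborel) = ennreal (c ^ DIM('a)) * (\<integral>\<^sup>+y. g (c *\<^sub>R y) \<partial>lborel)"
  using c
  by (subst lborel_affine[of c 0]) (simp_all add: nn_integral_density nn_integral_distr nn_integral_cmult)

subsection \<open>The exchange integral of a ball\<close>

text \<open>The Coulomb kernel without its factor 1 / (2 pi^2). Its value at 0 is infinite, whereas
  \<open>coulomb_w 0 = 0\<close>; this keeps it monotone in the norm without exception, and the two
  versions differ only on the null diagonal.\<close>

definition kern :: "'a::real_normed_vector \<Rightarrow> ennreal" where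
  "kern z = inverse (ennreal ((norm z)\<^sup>2))"

lemma borel_measurable_kern [measurable]: "kern \<in> borel_measurable borel"
  unfolding kern_def by measurable

lemma kern_anti_mono:
  assumes "norm z \<le> norm z'"
  shows "kern z' \<le> kern z"
proof (cases "z = 0")
  case False
  with assms have "norm z' > 0" "norm z > 0" by (auto intro: less_le_trans)
  with assms show ?thesis
    by (simp add: kern_def inverse_ennreal ennreal_leI le_imp_inverse_le power_mono)
qed (simp add: kern_def)

lemma kern_scaleR: "c > 0 \<Longrightarrow> kern (c *\<^sub>R z) = ennreal (1 / c\<^sup>2) * kern z"
  by (cases "z = 0")
    (auto simp: kern_def power_mult_distrib inverse_ennreal ennreal_mult_top field_simps simp flip: ennreal_mult)

lemma kern_eq: "z \<noteq> 0 \<Longrightarrow> kern z = ennreal (1 / (norm z)\<^sup>2)"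
  by (simp add: kern_def inverse_ennreal field_simps)

section \<open>Gaussian integrals and the potential of a ball at its boundary\<close>

lemma nn_integral_gaussian: "(\<integral>\<^sup>+x. ennreal (exp (- x\<^sup>2)) \<partial>lborel) = ennreal (sqrt pi)"
proof -
  have "has_bochner_integral lborel (\<lambda>x::real. exp (- x\<^sup>2)) (2 *\<^sub>R (sqrt pi / 2))"
    by (rule has_bochner_integral_even_function[OF gaussian_moment_0]) simp
  then have "has_bochner_integral lborel (\<lambda>x::real. exp (- x\<^sup>2)) (sqrt pi)" by simp
  then show ?thesis
    by (simp add: has_bochner_integral_iff nn_integral_eq_integral)
qed

lemma nn_integral_pos_part_gaussian:
  "(\<integral>\<^sup>+x. ennreal (max 0 x * exp (- x\<^sup>2)) \<partial>lborel) = ennreal (1 / 2)"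
proof -
  have "(\<integral>\<^sup>+x. ennreal (max 0 x * exp (- x\<^sup>2)) \<partial>lborel)
      = (\<integral>\<^sup>+x. ennreal (x * exp (- x\<^sup>2)) * indicator {0..} x \<partial>lborel)"
    by (intro nn_integral_cong) (auto simp: indicator_def max_def)
  also have "\<dots> = ennreal (0 - (- exp (- 0\<^sup>2) / 2))"
  proof (rule nn_integral_FTC_atLeast)
    show "((\<lambda>x::real. - exp (- x\<^sup>2) / 2) \<longlongrightarrow> 0) at_top" by real_asymp
  qed (auto intro!: derivative_eq_intros)
  finally show ?thesis by simp
qed

lemma nn_integral_cube_gaussian:
  fixes a :: real
  assumes a: "a > 0"
  shows "(\<integral>\<^sup>+t. ennreal (t ^ 3 * exp (- (t * a)\<^sup>2)) * indicator {0..} t \<partial>lborel) = ennreal (1 / (2 * a ^ 4))"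
proof -
  have "(\<integral>\<^sup>+t. ennreal (t ^ 3 * exp (- (t * a)\<^sup>2)) * indicator {0..} t \<partial>lborel)
     = ennreal (0 - (- (1 + (0 * a)\<^sup>2) * exp (- (0 * a)\<^sup>2) / (2 * a ^ 4)))"
  proof (rule nn_integral_FTC_atLeast)
    show "((\<lambda>t. - (1 + (t * a)\<^sup>2) * exp (- (t * a)\<^sup>2) / (2 * a ^ 4)) \<longlongrightarrow> 0) at_top"
      using a by real_asymp
    show "((\<lambda>t. - (1 + (t * a)\<^sup>2) * exp (- (t * a)\<^sup>2) / (2 * a ^ 4))
        has_real_derivative t ^ 3 * exp (- (t * a)\<^sup>2)) (at t)" for t
      using a by (auto intro!: derivative_eq_intros simp: field_simps power2_eq_square power4_eq_xxxx power3_eq_cube)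
  qed auto
  then show ?thesis by simp
qed

lemma nn_integral_inverse_square:
  fixes a :: real
  assumes a: "a > 0"
  shows "(\<integral>\<^sup>+t. ennreal (1 / t\<^sup>2) * indicator {a..} t \<partial>lborel) = ennreal (1 / a)"
proof -
  have "(\<integral>\<^sup>+t. ennreal (1 / t\<^sup>2) * indicator {a..} t \<partial>lborel) = ennreal (0 - (- 1 / a))"
  proof (rule nn_integral_FTC_atLeast)
    have "((\<lambda>t::real. - 1 / t) \<longlongrightarrow> 0) at_top" by real_asymp
    then show "((/) (- 1 :: real) \<longlongrightarrow> 0) at_top" .
    show "((\<lambda>t. - 1 / t) has_real_derivative 1 / t\<^sup>2) (at t)" if "a \<le> t" for t
      using a that by (auto intro!: derivative_eq_intros simp: power2_eq_square)
  qed auto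
  then show ?thesis by simp
qed

text \<open>A rotation takes \<open>e\<close> to a coordinate axis; the integral then factors over
  the coordinates into 1/2 and two copies of sqrt pi.\<close>

lemma nn_integral_pos_part_gaussian_3:
  fixes e :: "real ^ 3"
  assumes e: "norm e = 1"
  shows "(\<integral>\<^sup>+z. ennreal (max 0 (z \<bullet> e) * exp (- (norm z)\<^sup>2)) \<partial>lborel) = ennreal (pi / 2)"
proof -
  define a where "a = (axis 1 1 :: real ^ 3)"
  have a: "a \<in> Basis" by (simp add: a_def)
  have "norm e = norm a" using e a by simp
  then obtain f where f: "orthogonal_transformation f" "f e = a"
    by (rule orthogonal_transformation_exists)
  have fe: "f z \<bullet> a = z \<bullet> e" "norm (f z) = norm z" for z
    using f by (auto simp: orthogonal_transformation_def orthogonal_transformation_norm)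
  have "(\<integral>\<^sup>+z. ennreal (max 0 (z \<bullet> e) * exp (- (norm z)\<^sup>2)) \<partial>lborel)
      = (\<integral>\<^sup>+z. ennreal (max 0 (f z \<bullet> a) * exp (- (norm (f z))\<^sup>2)) \<partial>lborel)"
    by (simp add: fe)
  also have "\<dots> = (\<integral>\<^sup>+z. ennreal (max 0 (z \<bullet> a) * exp (- (norm z)\<^sup>2)) \<partial>lborel)"
    by (rule nn_integral_lborel_orthogonal[OF f(1)]) measurable
  also have "\<dots> = (\<integral>\<^sup>+z. (\<Prod>b\<in>Basis. ennreal ((if b = a then max 0 (z \<bullet> b) else 1) * exp (- (z \<bullet> b)\<^sup>2))) \<partial>lborel)"
  proof (rule nn_integral_cong)
    fix z :: "real ^ 3"
    have "(\<Prod>b\<in>Basis. (if b = a then max 0 (z \<bullet> b) else 1) * exp (- (z \<bullet> b)\<^sup>2))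
        = max 0 (z \<bullet> a) * exp (- (norm z)\<^sup>2)"
      using a by (simp add: prod.distrib prod.delta exp_sum[symmetric] sum_negf euclidean_inner[of z z]
          power2_norm_eq_inner flip: power2_eq_square)
    then show "ennreal (max 0 (z \<bullet> a) * exp (- (norm z)\<^sup>2))
      = (\<Prod>b\<in>Basis. ennreal ((if b = a then max 0 (z \<bullet> b) else 1) * exp (- (z \<bullet> b)\<^sup>2)))"
      by (subst prod_ennreal) auto
  qed
  also have "\<dots> = (\<Prod>b\<in>Basis. (\<integral>\<^sup>+u. ennreal ((if b = a then max 0 u else 1) * exp (- u\<^sup>2)) \<partial>lborel))"
    by (rule nn_integral_lborel_prod) auto
  also have "\<dots> = (\<Prod>b\<in>(Basis :: (real^3) set). if b = a then ennreal (1 / 2) else ennreal (sqrt pi))"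
    by (intro prod.cong refl) (simp add: nn_integral_gaussian nn_integral_pos_part_gaussian)
  also have "\<dots> = ennreal (1 / 2) * ennreal (sqrt pi) ^ 2"
    using a by (subst prod.remove[of _ a]) (auto simp: card_Diff_singleton)
  also have "\<dots> = ennreal (pi / 2)"
    by (subst ennreal_power, simp, subst ennreal_mult[symmetric]) auto
  finally show ?thesis .
qed

lemma sets_borel_cball [measurable]: "cball (c :: 'a::metric_space) r \<in> sets borel"
  by simp

lemma AE_lborel_neq: "AE x in lborel. x \<noteq> (a :: 'a::euclidean_space)"
  by (rule AE_I[of _ _ "{a}"]) auto

text \<open>Writing the positive part as an integral over dilations of the lens turns a Gaussian integral into the lens integral.\<close>

lemma nn_integral_kern_lens_unit:
  fixes e :: "real ^ 3"
  assumes e: "norm e = 1"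
  shows "(\<integral>\<^sup>+z. indicator {z. (norm z)\<^sup>2 \<le> 2 * (z \<bullet> e)} z * kern z \<partial>lborel) = ennreal (2 * pi)"
proof -
  define L where "L = {z. (norm z)\<^sup>2 \<le> 2 * (z \<bullet> e)}"
  have L [measurable]: "L \<in> sets borel"
    unfolding L_def by measurable
  \<comment> \<open>A point z lies in the dilated lens t L exactly when |z|^2 is at most 2 t (z .
    e). If z . e > 0 this is a half-line of t, on which the weight 1/t^2 integrates to 2 (z . e) /
    |z|^2. Integrating \<open>?h\<close> over t therefore returns the Gaussian integrand.\<close>
  let ?h = "\<lambda>t z. ennreal ((norm z)\<^sup>2 * exp (- (norm z)\<^sup>2) / 2)
      * (ennreal (1 / t\<^sup>2) * indicator {0<..} t * indicator L ((1 / t) *\<^sub>R z))"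
  have "ennreal (pi / 2) = (\<integral>\<^sup>+z. ennreal (max 0 (z \<bullet> e) * exp (- (norm z)\<^sup>2)) \<partial>lborel)"
    using nn_integral_pos_part_gaussian_3[OF e] by simp
  also have "\<dots> = (\<integral>\<^sup>+z. \<integral>\<^sup>+t. ?h t z \<partial>lborel \<partial>lborel)"
  proof (rule nn_integral_cong_AE, use AE_lborel_neq[of 0] in eventually_elim)
    fix z :: "real ^ 3" assume z: "z \<noteq> 0"
    have mem: "(1 / t) *\<^sub>R z \<in> L \<longleftrightarrow> (norm z)\<^sup>2 \<le> t * (2 * (z \<bullet> e))" if "t > 0" for t
      using that by (simp add: L_def power_divide field_simps power2_eq_square)
    have "(\<integral>\<^sup>+t. ennreal (1 / t\<^sup>2) * indicator {0<..} t * indicator L ((1 / t) *\<^sub>R z) \<partial>lborel)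
       = ennreal (2 * max 0 (z \<bullet> e) / (norm z)\<^sup>2)"
    proof (cases "z \<bullet> e > 0")
      case True
      let ?a = "(norm z)\<^sup>2 / (2 * (z \<bullet> e))"
      have a: "?a > 0" using True z by simp
      have "(\<integral>\<^sup>+t. ennreal (1 / t\<^sup>2) * indicator {0<..} t * indicator L ((1 / t) *\<^sub>R z) \<partial>lborel)
        = (\<integral>\<^sup>+t. ennreal (1 / t\<^sup>2) * indicator {?a..} t \<partial>lborel)"
      proof (rule nn_integral_cong)
        fix t :: real
        have "t > 0 \<and> (1 / t) *\<^sub>R z \<in> L \<longleftrightarrow> ?a \<le> t"
        proof
          assume "t > 0 \<and> (1 / t) *\<^sub>R z \<in> L"
          then show "?a \<le> t" using True mem[of t] by (simp add: pos_divide_le_eq)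
        next
          assume t: "?a \<le> t"
          then have "t > 0" using a by linarith
          then show "t > 0 \<and> (1 / t) *\<^sub>R z \<in> L" using True mem[of t] t by (simp add: pos_divide_le_eq)
        qed
        then show "ennreal (1 / t\<^sup>2) * indicator {0<..} t * indicator L ((1 / t) *\<^sub>R z)
            = ennreal (1 / t\<^sup>2) * indicator {?a..} t"
          by (auto simp: indicator_def)
      qed
      also have "\<dots> = ennreal (1 / ?a)" by (rule nn_integral_inverse_square[OF a])
      finally show ?thesis using True by simp
    next
      case False
      have "\<not> (t > 0 \<and> (1 / t) *\<^sub>R z \<in> L)" for t
      proof
        assume t: "t > 0 \<and> (1 / t) *\<^sub>R z \<in> L"
        have "(norm z)\<^sup>2 > 0" using z by simp
        moreover have "t * (2 * (z \<bullet> e)) \<le> 0" using t False by (simp add: mult_le_0_iff)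
        ultimately show False using t mem[of t] by linarith
      qed
      then have "ennreal (1 / t\<^sup>2) * indicator {0<..} t * indicator L ((1 / t) *\<^sub>R z) = 0" for t :: real
        by (auto simp: indicator_def)
      then show ?thesis using False by (simp only:) (simp add: max_def)
    qed
    then have "(\<integral>\<^sup>+t. ?h t z \<partial>lborel) = ennreal ((norm z)\<^sup>2 * exp (- (norm z)\<^sup>2) / 2) * ennreal (2 * max 0 (z \<bullet> e) / (norm z)\<^sup>2)"
      by (subst nn_integral_cmult) auto
    also have "\<dots> = ennreal (max 0 (z \<bullet> e) * exp (- (norm z)\<^sup>2))"
      using z by (subst ennreal_mult[symmetric]) (auto simp: field_simps)
    finally show "ennreal (max 0 (z \<bullet> e) * exp (- (norm z)\<^sup>2)) = (\<integral>\<^sup>+t. ?h t z \<partial>lborel)" ..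
  qed
  also have "\<dots> = (\<integral>\<^sup>+t. \<integral>\<^sup>+z. ?h t z \<partial>lborel \<partial>lborel)"
    by (rule lborel_pair.Fubini') measurable
  \<comment> \<open>For fixed t > 0 substitute t z for z: the Jacobian t^3 appears and the lens no
    longer depends on t. The remaining t-integral is 1 / (2 |z|^4), which against |z|^2 / 2 leaves a
    quarter of the kernel, so the lens integral is four times pi / 2.\<close>
  also have "\<dots> = (\<integral>\<^sup>+t. \<integral>\<^sup>+z. ennreal ((norm z)\<^sup>2 / 2) * indicator L z
        * (ennreal (t ^ 3 * exp (- (t * norm z)\<^sup>2)) * indicator {0..} t) \<partial>lborel \<partial>lborel)"
  proof (rule nn_integral_cong_AE, use AE_lborel_neq[of 0] in eventually_elim)
    fix t :: real assume t0: "t \<noteq> 0"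
    show "(\<integral>\<^sup>+z. ?h t z \<partial>lborel) = (\<integral>\<^sup>+z. ennreal ((norm z)\<^sup>2 / 2) * indicator L z
        * (ennreal (t ^ 3 * exp (- (t * norm z)\<^sup>2)) * indicator {0..} t) \<partial>lborel)"
    proof (cases "t > 0")
      case True
      have "(\<integral>\<^sup>+z. ?h t z \<partial>lborel) = ennreal (t ^ 3) * (\<integral>\<^sup>+z. ?h t (t *\<^sub>R z) \<partial>lborel)"
        using True by (subst nn_integral_lborel_scale[of _ t]) simp_all
      also have "\<dots> = (\<integral>\<^sup>+z. ennreal (t ^ 3) * ?h t (t *\<^sub>R z) \<partial>lborel)"
        by (subst nn_integral_cmult) auto
      also have "\<dots> = (\<integral>\<^sup>+z. ennreal ((norm z)\<^sup>2 / 2) * indicator L z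
        * (ennreal (t ^ 3 * exp (- (t * norm z)\<^sup>2)) * indicator {0..} t) \<partial>lborel)"
        using True by (intro nn_integral_cong)
          (auto simp: indicator_def power_mult_distrib field_simps simp flip: ennreal_mult)
      finally show ?thesis .
    qed (use t0 in auto)
  qed
  also have "\<dots> = (\<integral>\<^sup>+z. \<integral>\<^sup>+t. ennreal ((norm z)\<^sup>2 / 2) * indicator L z
        * (ennreal (t ^ 3 * exp (- (t * norm z)\<^sup>2)) * indicator {0..} t) \<partial>lborel \<partial>lborel)"
    by (rule lborel_pair.Fubini') measurable
  also have "\<dots> = (\<integral>\<^sup>+z. ennreal (1 / 4) * (indicator L z * kern z) \<partial>lborel)"
  proof (rule nn_integral_cong_AE, use AE_lborel_neq[of 0] in eventually_elim)
    fix z :: "real ^ 3" assume z: "z \<noteq> 0"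
    show "(\<integral>\<^sup>+t. ennreal ((norm z)\<^sup>2 / 2) * indicator L z
        * (ennreal (t ^ 3 * exp (- (t * norm z)\<^sup>2)) * indicator {0..} t) \<partial>lborel)
        = ennreal (1 / 4) * (indicator L z * kern z)"
    proof -
      have "(\<integral>\<^sup>+t. ennreal ((norm z)\<^sup>2 / 2) * indicator L z
          * (ennreal (t ^ 3 * exp (- (t * norm z)\<^sup>2)) * indicator {0..} t) \<partial>lborel)
        = ennreal ((norm z)\<^sup>2 / 2) * indicator L z * ennreal (1 / (2 * norm z ^ 4))"
        using nn_integral_cube_gaussian[of "norm z"] z by (subst nn_integral_cmult, simp, simp only: zero_less_norm_iff)
      also have "\<dots> = indicator L z * (ennreal ((norm z)\<^sup>2 / 2) * ennreal (1 / (2 * norm z ^ 4)))"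
        by (simp only: ac_simps)
      also have "ennreal ((norm z)\<^sup>2 / 2) * ennreal (1 / (2 * norm z ^ 4)) = ennreal (1 / 4) * kern z"
        using z by (simp add: kern_eq field_simps power4_eq_xxxx power2_eq_square flip: ennreal_mult)
      finally show ?thesis by (simp only: ac_simps)
    qed
  qed
  also have "\<dots> = ennreal (1 / 4) * (\<integral>\<^sup>+z. indicator L z * kern z \<partial>lborel)"
    by (rule nn_integral_cmult) measurable
  finally have "ennreal 4 * ennreal (pi / 2) = ennreal 4 * (ennreal (1 / 4) * (\<integral>\<^sup>+z. indicator L z * kern z \<partial>lborel))"
    by (simp only:)
  moreover have "ennreal 4 * ennreal (pi / 2) = ennreal (2 * pi)" "ennreal 4 * ennreal (1 / 4) = 1"
    by (subst ennreal_mult[symmetric]; simp)+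
  ultimately show ?thesis
    unfolding L_def by (simp only: mult.assoc[symmetric] mult_1_left)
qed

text \<open>The set is the ball around x through the origin, that is |x| times the unit lens. Volume
  scales with degree 3 and the kernel with degree -2, hence the single factor |x|.\<close>

lemma nn_integral_kern_lens:
  fixes x :: "real ^ 3"
  shows "(\<integral>\<^sup>+z. indicator {z. (norm z)\<^sup>2 \<le> 2 * (z \<bullet> x)} z * kern z \<partial>lborel) = ennreal (2 * pi * norm x)"
proof (cases "x = 0")
  case True
  have "(\<integral>\<^sup>+z. indicator {z. (norm z)\<^sup>2 \<le> 2 * (z \<bullet> x)} z * kern z \<partial>lborel) = (\<integral>\<^sup>+z. 0 \<partial>(lborel :: (real^3) measure))"
    by (rule nn_integral_cong_AE, use AE_lborel_neq[of 0] in eventually_elim) (simp add: True)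
  then show ?thesis using True by simp
next
  case False
  define e where "e = x /\<^sub>R norm x"
  have e: "norm e = 1" "x = norm x *\<^sub>R e" using False by (auto simp: e_def)
  define r where "r = norm x"
  have r: "r > 0" using False by (simp add: r_def)
  let ?L = "{z. (norm z)\<^sup>2 \<le> 2 * (z \<bullet> e)}"
  have "(\<integral>\<^sup>+z. indicator {z. (norm z)\<^sup>2 \<le> 2 * (z \<bullet> x)} z * kern z \<partial>lborel)
    = ennreal (r ^ 3) * (\<integral>\<^sup>+z. indicator {z. (norm z)\<^sup>2 \<le> 2 * (z \<bullet> x)} (r *\<^sub>R z) * kern (r *\<^sub>R z) \<partial>lborel)"
    using r by (subst nn_integral_lborel_scale[of _ r]) simp_all
  also have "\<dots> = ennreal (r ^ 3) * (\<integral>\<^sup>+z. ennreal (1 / r\<^sup>2) * (indicator ?L z * kern z) \<partial>lborel)"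
  proof -
    have "indicator {z. (norm z)\<^sup>2 \<le> 2 * (z \<bullet> x)} (r *\<^sub>R z) * kern (r *\<^sub>R z)
        = ennreal (1 / r\<^sup>2) * (indicator ?L z * kern z)" for z
    proof -
    have "(norm (r *\<^sub>R z))\<^sup>2 \<le> 2 * ((r *\<^sub>R z) \<bullet> x) \<longleftrightarrow> r\<^sup>2 * (norm z)\<^sup>2 \<le> r\<^sup>2 * (2 * (z \<bullet> e))"
      using e(2)[folded r_def] r by (simp add: power_mult_distrib power2_eq_square algebra_simps)
    also have "\<dots> \<longleftrightarrow> (norm z)\<^sup>2 \<le> 2 * (z \<bullet> e)"
      using r by (intro mult_le_cancel_left_pos) simp
    finally show ?thesis
      using r by (simp add: kern_scaleR indicator_def)
    qed
    then show ?thesis by (simp only:)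
  qed
  also have "\<dots> = ennreal (r ^ 3) * (ennreal (1 / r\<^sup>2) * ennreal (2 * pi))"
    by (subst nn_integral_cmult) (auto simp: nn_integral_kern_lens_unit[OF e(1)])
  also have "\<dots> = ennreal (2 * pi * norm x)"
    using r by (simp add: r_def[symmetric] power2_eq_square power3_eq_cube flip: ennreal_mult)
  finally show ?thesis .
qed

lemma nn_integral_kern_ball:
  fixes x :: "real ^ 3"
  shows "(\<integral>\<^sup>+y. indicator (cball 0 (norm x)) y * kern (x - y) \<partial>lborel) = ennreal (2 * pi * norm x)"
proof -
  have "(\<integral>\<^sup>+y. indicator (cball 0 (norm x)) y * kern (x - y) \<partial>lborel)
     = (\<integral>\<^sup>+z. indicator (cball 0 (norm x)) (x - z) * kern (x - (x - z)) \<partial>lborel)"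
    by (rule nn_integral_lborel_reflect_shift[symmetric]) measurable
  also have "\<dots> = (\<integral>\<^sup>+z. indicator {z. (norm z)\<^sup>2 \<le> 2 * (z \<bullet> x)} z * kern z \<partial>lborel)"
  proof (rule nn_integral_cong)
    fix z
    have "norm (x - z) \<le> norm x \<longleftrightarrow> (norm (x - z))\<^sup>2 \<le> (norm x)\<^sup>2" by simp
    also have "\<dots> \<longleftrightarrow> (norm z)\<^sup>2 \<le> 2 * (z \<bullet> x)"
      by (simp only: power2_norm_eq_inner) (simp add: inner_diff_left inner_diff_right inner_commute)
    finally show "indicator (cball 0 (norm x)) (x - z) * kern (x - (x - z))
       = indicator {z. (norm z)\<^sup>2 \<le> 2 * (z \<bullet> x)} z * kern z"
      by (simp add: indicator_def)
  qed
  finally show ?thesis by (simp add: nn_integral_kern_lens)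
qed

section \<open>Radial moments and the self-interaction of a ball\<close>

lemma emeasure_cball_3: "r \<ge> 0 \<Longrightarrow> emeasure lborel (cball (c :: real ^ 3) r) = ennreal (4 * pi / 3 * r ^ 3)"
  by (simp add: emeasure_cball unit_ball_vol_3)

text \<open>Write the power of the norm as the integral of its derivative over t between 0 and |x|
  and exchange the integrals; what remains is the volume of a shell. The case \<open>p = 0\<close>
  serves the exchange energy, \<open>p = 1\<close> the kinetic energy.\<close>

lemma nn_integral_norm_power_ball:
  assumes R: "R \<ge> 0"
  shows "(\<integral>\<^sup>+x. indicator (cball (0 :: real ^ 3) R) x * ennreal (norm x ^ Suc p) \<partial>lborel)
     = ennreal (4 * pi * R ^ (p + 4) / (real p + 4))"
proof -
  let ?h = "\<lambda>x (t::real). indicator (cball (0 :: real ^ 3) R) x * (ennreal (Suc p * t ^ p) * indicator {0..norm x} t)"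
  have "(\<integral>\<^sup>+x. indicator (cball (0 :: real ^ 3) R) x * ennreal (norm x ^ Suc p) \<partial>lborel)
      = (\<integral>\<^sup>+x. \<integral>\<^sup>+t. ?h x t \<partial>lborel \<partial>lborel)"
  proof (rule nn_integral_cong)
    fix x :: "real ^ 3"
    have "(\<integral>\<^sup>+t. ennreal (Suc p * t ^ p) * indicator {0..norm x} t \<partial>lborel)
        = ennreal (norm x ^ Suc p - 0 ^ Suc p)"
      by (rule nn_integral_FTC_Icc) (auto intro!: derivative_eq_intros simp del: power_Suc)
    then show "indicator (cball 0 R) x * ennreal (norm x ^ Suc p) = (\<integral>\<^sup>+t. ?h x t \<partial>lborel)"
      by (subst nn_integral_cmult) auto
  qed
  also have "\<dots> = (\<integral>\<^sup>+t. \<integral>\<^sup>+x. ?h x t \<partial>lborel \<partial>lborel)"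
  proof (rule lborel_pair.Fubini'[symmetric])
    have [measurable]: "Measurable.pred (borel \<Otimes>\<^sub>M borel) (\<lambda>p :: (real ^ 3) \<times> real. snd p \<in> {0..norm (fst p)})"
      by simp
    show "(\<lambda>(x, t). ?h x t) \<in> borel_measurable (lborel \<Otimes>\<^sub>M lborel)" by measurable
  qed
  also have "\<dots> = (\<integral>\<^sup>+t. ennreal (real (Suc p) * t ^ p * (4 * pi / 3 * (R ^ 3 - t ^ 3))) * indicator {0..R} t \<partial>lborel)"
  proof (rule nn_integral_cong)
    fix t :: real
    show "(\<integral>\<^sup>+x. ?h x t \<partial>lborel) = ennreal (real (Suc p) * t ^ p * (4 * pi / 3 * (R ^ 3 - t ^ 3))) * indicator {0..R} t"
    proof (cases "0 \<le> t \<and> t \<le> R")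
      case True
      have "(\<integral>\<^sup>+x. ?h x t \<partial>lborel) = (\<integral>\<^sup>+x. ennreal (Suc p * t ^ p) * indicator (cball (0::real^3) R - ball 0 t) x \<partial>lborel)"
        using True by (intro nn_integral_cong) (auto simp: indicator_def)
      also have "\<dots> = ennreal (Suc p * t ^ p) * (emeasure lborel (cball (0::real^3) R) - emeasure lborel (ball (0::real^3) t))"
        using True emeasure_lborel_ball_finite[of "0::real^3" t]
        by (subst nn_integral_cmult_indicator) (auto intro!: arg_cong2[of _ _ _ _ "(*)"] emeasure_Diff simp: subset_eq)
      also have "\<dots> = ennreal (Suc p * t ^ p) * ennreal (4 * pi / 3 * R ^ 3 - 4 * pi / 3 * t ^ 3)"
        using True by (simp add: emeasure_cball emeasure_ball unit_ball_vol_3 ennreal_minus)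
      also have "\<dots> = ennreal (real (Suc p) * t ^ p * (4 * pi / 3 * (R ^ 3 - t ^ 3)))"
        using True by (subst ennreal_mult[symmetric]) (auto simp: right_diff_distrib power_mono simp del: of_nat_Suc)
      finally show ?thesis using True by simp
    next
      case False
      then have 0: "?h x t = 0" for x by (auto simp: indicator_def)
      show ?thesis unfolding 0 using False by simp
    qed
  qed
  also have "\<dots> = ennreal (4 * pi / 3 * (R ^ 3 * R ^ Suc p - (real p + 1) / (real p + 4) * R ^ (p + 4))
        - 4 * pi / 3 * (R ^ 3 * 0 ^ Suc p - (real p + 1) / (real p + 4) * 0 ^ (p + 4)))"
  proof (rule nn_integral_FTC_Icc[where F = "\<lambda>t. 4 * pi / 3 * (R ^ 3 * t ^ Suc p - (real p + 1) / (real p + 4) * t ^ (p + 4))"])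
    fix t :: real assume t: "t \<in> {0..R}"
    have "((\<lambda>t. 4 * pi / 3 * (R ^ 3 * t ^ Suc p - (real p + 1) / (real p + 4) * t ^ (p + 4))) has_real_derivative
       4 * pi / 3 * (R ^ 3 * (real (Suc p) * t ^ p) - (real p + 1) / (real p + 4) * ((real p + 4) * t ^ (p + 3)))) (at t)"
      by (auto intro!: derivative_eq_intros simp: add.commute simp del: power_Suc)
    also have "4 * pi / 3 * (R ^ 3 * (real (Suc p) * t ^ p) - (real p + 1) / (real p + 4) * ((real p + 4) * t ^ (p + 3)))
       = real (Suc p) * t ^ p * (4 * pi / 3 * (R ^ 3 - t ^ 3))"
      by (simp add: field_simps power_add)
    finally show "((\<lambda>t. 4 * pi / 3 * (R ^ 3 * t ^ Suc p - (real p + 1) / (real p + 4) * t ^ (p + 4))) has_real_derivative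
       real (Suc p) * t ^ p * (4 * pi / 3 * (R ^ 3 - t ^ 3))) (at t)" .
    show "0 \<le> real (Suc p) * t ^ p * (4 * pi / 3 * (R ^ 3 - t ^ 3))"
      using t by (simp add: power_mono)
  qed (use R in auto)
  also have "4 * pi / 3 * (R ^ 3 * R ^ Suc p - (real p + 1) / (real p + 4) * R ^ (p + 4))
        - 4 * pi / 3 * (R ^ 3 * 0 ^ Suc p - (real p + 1) / (real p + 4) * 0 ^ (p + 4)) = 4 * pi * R ^ (p + 4) / (real p + 4)"
    by (simp add: field_simps power_add eval_nat_numeral)
  finally show ?thesis .
qed

lemma AE_lborel_norm_neq: "AE y in lborel. norm (y :: 'a::euclidean_space) \<noteq> r"
proof (rule AE_I[of _ _ "sphere 0 r"])
  show "emeasure lborel (sphere (0 :: 'a) r) = 0"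
    using negligible_sphere[of "0 :: 'a" r]
    by (simp add: negligible_iff_null_sets null_sets_def)
qed auto

definition interact :: "('a::euclidean_space \<Rightarrow> ennreal) \<Rightarrow> ('a \<Rightarrow> ennreal) \<Rightarrow> ennreal" where
  "interact f g = (\<integral>\<^sup>+x. \<integral>\<^sup>+y. f x * g y * kern (x - y) \<partial>lborel \<partial>lborel)"

text \<open>Split the pairs by which point has the larger norm. If it is x, then y runs through the
  ball whose boundary contains x, so only boundary potentials occur: 2 pi |x|, which integrates to 2
  pi^2 R^4. The other half is the same by symmetry.\<close>

lemma interact_ball:
  assumes R: "R \<ge> 0"
  shows "interact (indicator (cball (0 :: real ^ 3) R)) (indicator (cball 0 R)) = ennreal (4 * pi\<^sup>2 * R ^ 4)"
proof -
  let ?B = "cball (0 :: real ^ 3) R"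
  define A where "A = (\<integral>\<^sup>+x. \<integral>\<^sup>+y. indicator ?B x * (indicator (cball 0 (norm x)) y * kern (x - y)) \<partial>lborel \<partial>lborel)"
  have m1 [measurable]: "Measurable.pred (borel \<Otimes>\<^sub>M borel) (\<lambda>p. snd p \<in> cball (0 :: real ^ 3) (norm (fst p)))"
    by (simp add: mem_cball)
  have A: "A = ennreal (2 * pi\<^sup>2 * R ^ 4)"
  proof -
    have "A = (\<integral>\<^sup>+x. ennreal (2 * pi) * (indicator ?B x * ennreal (norm x ^ Suc 0)) \<partial>lborel)"
      unfolding A_def
      by (intro nn_integral_cong, subst nn_integral_cmult, measurable)
        (simp only: nn_integral_kern_ball, simp add: ennreal_mult ac_simps)
    also have "\<dots> = ennreal (2 * pi) * ennreal (4 * pi * R ^ 4 / 4)"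
      by (subst nn_integral_cmult, measurable, subst nn_integral_norm_power_ball) (use R in auto)
    also have "\<dots> = ennreal (2 * pi\<^sup>2 * R ^ 4)"
      using R by (subst ennreal_mult[symmetric]) (auto simp: power2_eq_square)
    finally show ?thesis .
  qed
  have "interact (indicator ?B) (indicator ?B)
     = (\<integral>\<^sup>+x. (\<integral>\<^sup>+y. indicator ?B x * (indicator (cball 0 (norm x)) y * kern (x - y)) \<partial>lborel)
           + (\<integral>\<^sup>+y. indicator ?B y * (indicator (cball 0 (norm y)) x * kern (y - x)) \<partial>lborel) \<partial>lborel)"
    unfolding interact_def
  proof (rule nn_integral_cong)
    fix x :: "real ^ 3"
    have "(\<integral>\<^sup>+y. indicator ?B x * indicator ?B y * kern (x - y) \<partial>lborel)
       = (\<integral>\<^sup>+y. indicator ?B x * (indicator (cball 0 (norm x)) y * kern (x - y))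
           + indicator ?B y * (indicator (cball 0 (norm y)) x * kern (y - x)) \<partial>lborel)"
      by (rule nn_integral_cong_AE, use AE_lborel_norm_neq[of "norm x"] in eventually_elim)
        (auto simp: indicator_def kern_def norm_minus_commute)
    also have "\<dots> = (\<integral>\<^sup>+y. indicator ?B x * (indicator (cball 0 (norm x)) y * kern (x - y)) \<partial>lborel)
           + (\<integral>\<^sup>+y. indicator ?B y * (indicator (cball 0 (norm y)) x * kern (y - x)) \<partial>lborel)"
      by (rule nn_integral_add) (simp_all add: mem_cball indicator_def)
    finally show "(\<integral>\<^sup>+y. indicator ?B x * indicator ?B y * kern (x - y) \<partial>lborel) = \<dots>" .
  qed
  also have "\<dots> = A + (\<integral>\<^sup>+x. \<integral>\<^sup>+y. indicator ?B y * (indicator (cball 0 (norm y)) x * kern (y - x)) \<partial>lborel \<partial>lborel)"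
    unfolding A_def
    by (rule nn_integral_add) (simp_all add: mem_cball indicator_def)
  also have "(\<integral>\<^sup>+x. \<integral>\<^sup>+y. indicator ?B y * (indicator (cball 0 (norm y)) x * kern (y - x)) \<partial>lborel \<partial>lborel) = A"
    unfolding A_def
    by (rule lborel_pair.Fubini') (simp add: mem_cball indicator_def)
  also have "A + A = ennreal (4 * pi\<^sup>2 * R ^ 4)"
    using R by (simp add: A flip: ennreal_plus)
  finally show ?thesis .
qed

subsection \<open>Polarization\<close>

text \<open>With a = b + c and u = v + d the two sides differ by the product c d. The additive form
  avoids truncated subtraction.\<close>

lemma rearrange2_ennreal:
  fixes a b u v :: ennreal
  assumes "b \<le> a" "v \<le> u"
  shows "a * v + b * u \<le> a * u + b * v"
proof -
  obtain c d where "a = b + c" "u = v + d" using assms by (auto simp: le_iff_add)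
  then have "a * u + b * v = (a * v + b * u) + c * d"
    by (simp add: algebra_simps)
  then show ?thesis by simp
qed

text \<open>The two brackets add up to (p + p')(q + q') before and after sorting. Sorting both pairs
  in the same order moves part of this total from the smaller weight b to the larger weight
  a.\<close>

lemma rearrange_max_min_ennreal:
  fixes a b p p' q q' :: ennreal
  assumes ab: "b \<le> a"
  shows "a * (p * q + p' * q') + b * (p * q' + p' * q)
    \<le> a * (max p p' * max q q' + min p p' * min q q') + b * (max p p' * min q q' + min p p' * max q q')"
proof -
  have r: "p * q + p' * q' \<le> p * q' + p' * q" if "p' \<le> p" "q \<le> q'" for p p' q q' :: ennreal
    using rearrange2_ennreal[OF that] by (simp add: ac_simps)
  consider "p' \<le> p" "q' \<le> q" | "p \<le> p'" "q \<le> q'" | "p' \<le> p" "q \<le> q'" | "p \<le> p'" "q' \<le> q"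
    by (meson linear)
  then show ?thesis
  proof cases
    case 3
    show ?thesis using rearrange2_ennreal[OF ab r[OF 3]] 3 by (simp add: max_def min_def ac_simps)
  next
    case 4
    show ?thesis using rearrange2_ennreal[OF ab r[OF 4(2) 4(1)]] 4 by (simp add: max_def min_def ac_simps)
  qed (auto simp: max_def min_def ac_simps)
qed

text \<open>Two-point rearrangement: of the values at two mirror points the larger one goes to the
  side \<open>x \<bullet> n \<le> s\<close>, which contains the origin when
  \<open>s > 0\<close>.\<close>

definition polarize :: "'a::real_inner \<Rightarrow> real \<Rightarrow> ('a \<Rightarrow> real) \<Rightarrow> 'a \<Rightarrow> real" where
  "polarize n s f x = (if x \<bullet> n \<le> s then max (f x) (f (hrefl n s x)) else min (f x) (f (hrefl n s x)))"

lemma hrefl_fixed: "x \<bullet> n = s \<Longrightarrow> hrefl n s x = x"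
  by (simp add: hrefl_def)

lemma polarize_hrefl:
  assumes n: "norm n = 1"
  shows "polarize n s f (hrefl n s x) = (if x \<bullet> n \<ge> s then max (f x) (f (hrefl n s x)) else min (f x) (f (hrefl n s x)))"
  using inner_hrefl[OF n, of s x] n by (auto simp: polarize_def max.commute min.commute)

lemma polarize_add:
  assumes n: "norm n = 1"
  shows "polarize n s f x + polarize n s f (hrefl n s x) = f x + f (hrefl n s x)"
proof -
  consider "x \<bullet> n < s" | "x \<bullet> n = s" | "x \<bullet> n > s" by linarith
  then show ?thesis
  proof cases
    case 2
    then show ?thesis by (simp add: hrefl_fixed polarize_def)
  qed (auto simp: polarize_hrefl[OF n], auto simp: polarize_def max_def min_def)
qed

text \<open>Each variable may be reflected or not without changing the integral. Adding the four
  versions groups the integrand by orbits, on which the kernel takes only two values: one for pairs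
  reflected together, one for pairs reflected separately.\<close>

lemma interact_symmetrise:
  fixes n :: "real ^ 'n::{finite,wellorder}"
  assumes n: "norm n = 1" and [measurable]: "F \<in> borel_measurable borel"
  shows "4 * interact F F = (\<integral>\<^sup>+x. \<integral>\<^sup>+y.
     kern (x - y) * (F x * F y + F (hrefl n s x) * F (hrefl n s y))
     + kern (x - hrefl n s y) * (F x * F (hrefl n s y) + F (hrefl n s x) * F y) \<partial>lborel \<partial>lborel)"
proof -
  let ?h = "hrefl n s"
  let ?I = "\<lambda>G. \<integral>\<^sup>+x. \<integral>\<^sup>+y. G x y \<partial>lborel \<partial>(lborel :: (real ^ 'n::{finite,wellorder}) measure)"
  define k where "k x y = F x * F y * kern (x - y)" for x y
  have km [measurable]: "(\<lambda>p. k (fst p) (snd p)) \<in> borel_measurable (borel \<Otimes>\<^sub>M borel)"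
    unfolding k_def by measurable
  have km' [measurable]: "k x \<in> borel_measurable borel" for x unfolding k_def by measurable
  have 1: "?I k = interact F F" by (simp add: interact_def k_def)
  have 2: "?I (\<lambda>x y. k x (?h y)) = interact F F"
    unfolding 1[symmetric]
    by (intro nn_integral_cong nn_integral_lborel_hrefl[OF n] km')
  have 3: "?I (\<lambda>x y. k (?h x) y) = interact F F"
    unfolding 1[symmetric]
    by (rule nn_integral_lborel_hrefl[OF n, of "\<lambda>x. \<integral>\<^sup>+y. k x y \<partial>lborel"]) (unfold k_def, measurable)
  have 4: "?I (\<lambda>x y. k (?h x) (?h y)) = interact F F"
    unfolding 2[symmetric]
    by (rule nn_integral_lborel_hrefl[OF n, of "\<lambda>x. \<integral>\<^sup>+y. k x (?h y) \<partial>lborel"]) (unfold k_def, measurable)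
  have "4 * interact F F = (?I k + ?I (\<lambda>x y. k x (?h y))) + (?I (\<lambda>x y. k (?h x) y) + ?I (\<lambda>x y. k (?h x) (?h y)))"
    unfolding 1 2 3 4 by (simp add: mult_2[symmetric] mult.assoc[symmetric] flip: distrib_right)
  also have "\<dots> = ?I (\<lambda>x y. (k x y + k x (?h y)) + (k (?h x) y + k (?h x) (?h y)))"
  proof -
    have [measurable]: "(\<lambda>y. k x (?h y)) \<in> borel_measurable borel" for x
      unfolding k_def by measurable
    have [measurable]: "(\<lambda>x. \<integral>\<^sup>+y. k x y \<partial>lborel) \<in> borel_measurable borel"
      "(\<lambda>x. \<integral>\<^sup>+y. k (?h x) y \<partial>lborel) \<in> borel_measurable borel"
      "(\<lambda>x. \<integral>\<^sup>+y. k x (?h y) \<partial>lborel) \<in> borel_measurable borel"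
      "(\<lambda>x. \<integral>\<^sup>+y. k (?h x) (?h y) \<partial>lborel) \<in> borel_measurable borel"
      unfolding k_def by measurable
    show ?thesis by (simp add: nn_integral_add)
  qed
  also have "\<dots> = ?I (\<lambda>x y. kern (x - y) * (F x * F y + F (?h x) * F (?h y))
     + kern (x - ?h y) * (F x * F (?h y) + F (?h x) * F y))"
  proof -
    have "kern (?h x - ?h y) = kern (x - y)" "kern (?h x - y) = kern (x - ?h y)" for x y
      using n by (simp_all add: kern_def norm_hrefl_hrefl norm_hrefl_diff)
    then show ?thesis unfolding k_def by (simp add: algebra_simps)
  qed
  finally show ?thesis .
qed

lemma borel_measurable_polarize [measurable]:
  fixes f :: "'a::euclidean_space \<Rightarrow> real"
  assumes [measurable]: "f \<in> borel_measurable borel"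
  shows "polarize n s f \<in> borel_measurable borel"
  unfolding polarize_def by measurable

lemma ennreal_max: "ennreal (max a b) = max (ennreal a) (ennreal b)"
  by (metis ennreal_leI max_absorb1 max_absorb2 nle_le)

lemma ennreal_min: "ennreal (min a b) = min (ennreal a) (ennreal b)"
  by (metis ennreal_leI min_absorb1 min_absorb2 nle_le)

text \<open>After symmetrisation the inequality is pointwise on each orbit. If x and y lie on the
  same side of the mirror, the straight pairing has the larger kernel and polarization sorts both
  pairs of values alike; on opposite sides the crossed pairing takes this role.\<close>

lemma interact_polarize:
  fixes n :: "real ^ 'n::{finite,wellorder}"
  assumes n: "norm n = 1" and f [measurable]: "f \<in> borel_measurable borel"
  shows "interact (\<lambda>x. ennreal (f x)) (\<lambda>x. ennreal (f x))
    \<le> interact (\<lambda>x. ennreal (polarize n s f x)) (\<lambda>x. ennreal (polarize n s f x))"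
proof -
  let ?h = "hrefl n s"
  let ?F = "\<lambda>x. ennreal (f x)" and ?G = "\<lambda>x. ennreal (polarize n s f x)"
  have "4 * interact ?F ?F \<le> 4 * interact ?G ?G"
  proof -
    have m: "?F \<in> borel_measurable borel" "?G \<in> borel_measurable borel" by measurable
    show ?thesis
      unfolding interact_symmetrise[OF n m(1), of s] interact_symmetrise[OF n m(2), of s]
  proof (intro nn_integral_mono)
    fix x y
    let ?a = "kern (x - y)" and ?b = "kern (x - ?h y)"
    have d: "(norm (x - ?h y))\<^sup>2 = (norm (x - y))\<^sup>2 + 4 * ((x \<bullet> n - s) * (y \<bullet> n - s))"
      using norm_diff_hrefl[OF n, of x s y] by simp
    have ab: "?b \<le> ?a" if "(x \<bullet> n - s) * (y \<bullet> n - s) \<ge> 0"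
      by (rule kern_anti_mono, rule power2_le_imp_le) (use d that in auto)
    have ba: "?a \<le> ?b" if "(x \<bullet> n - s) * (y \<bullet> n - s) \<le> 0"
      by (rule kern_anti_mono, rule power2_le_imp_le) (use d that in auto)
    have p: "?G x = (if x \<bullet> n \<le> s then max (?F x) (?F (?h x)) else min (?F x) (?F (?h x)))"
       "?G (?h x) = (if x \<bullet> n \<ge> s then max (?F x) (?F (?h x)) else min (?F x) (?F (?h x)))" for x
      by (simp_all only: polarize_hrefl[OF n]) (simp_all add: polarize_def ennreal_max ennreal_min)
    \<comment> \<open>On the mirror itself both rows of \<open>p\<close> select the maximum; there
      maximum and minimum coincide, so these points may be counted with the near side.\<close>
    have fix': "?F (?h x) = ?F x" if "x \<bullet> n = s" for x using that by (simp add: hrefl_fixed)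
    consider "x \<bullet> n \<le> s" "y \<bullet> n \<le> s" | "x \<bullet> n > s" "y \<bullet> n > s"
      | "x \<bullet> n \<le> s" "y \<bullet> n > s" | "x \<bullet> n > s" "y \<bullet> n \<le> s" by linarith
    then show "?a * (?F x * ?F y + ?F (?h x) * ?F (?h y)) + ?b * (?F x * ?F (?h y) + ?F (?h x) * ?F y)
      \<le> ?a * (?G x * ?G y + ?G (?h x) * ?G (?h y)) + ?b * (?G x * ?G (?h y) + ?G (?h x) * ?G y)"
    proof cases
      case 1
      have e: "?G x = max (?F x) (?F (?h x))" "?G (?h x) = min (?F x) (?F (?h x))"
         "?G y = max (?F y) (?F (?h y))" "?G (?h y) = min (?F y) (?F (?h y))"
        using 1 fix'[of x] fix'[of y] p[of x] p[of y] by auto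
      have "?b \<le> ?a" using 1 by (intro ab mult_nonpos_nonpos) auto
      from rearrange_max_min_ennreal[OF this] show ?thesis unfolding e .
    next
      case 2
      have e: "?G x = min (?F x) (?F (?h x))" "?G (?h x) = max (?F x) (?F (?h x))"
         "?G y = min (?F y) (?F (?h y))" "?G (?h y) = max (?F y) (?F (?h y))"
        using 2 p[of x] p[of y] by auto
      have "?b \<le> ?a" using 2 by (intro ab) auto
      from rearrange_max_min_ennreal[OF this, of "?F x" "?F y" "?F (?h x)" "?F (?h y)"]
      show ?thesis unfolding e by (simp add: ac_simps)
    next
      case 3
      have e: "?G x = max (?F x) (?F (?h x))" "?G (?h x) = min (?F x) (?F (?h x))"
         "?G y = min (?F y) (?F (?h y))" "?G (?h y) = max (?F y) (?F (?h y))"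
        using 3 fix'[of x] p[of x] p[of y] by auto
      have "?a \<le> ?b" using 3 by (intro ba mult_nonpos_nonneg) auto
      from rearrange_max_min_ennreal[OF this, of "?F x" "?F (?h y)" "?F (?h x)" "?F y"]
      show ?thesis unfolding e by (simp add: ac_simps)
    next
      case 4
      have e: "?G x = min (?F x) (?F (?h x))" "?G (?h x) = max (?F x) (?F (?h x))"
         "?G y = max (?F y) (?F (?h y))" "?G (?h y) = min (?F y) (?F (?h y))"
        using 4 fix'[of y] p[of x] p[of y] by auto
      have "?a \<le> ?b" using 4 by (intro ba mult_nonneg_nonpos) auto
      from rearrange_max_min_ennreal[OF this, of "?F x" "?F (?h y)" "?F (?h x)" "?F y"]
      show ?thesis unfolding e by (simp add: ac_simps)
    qed
  qed
  qed
  then show ?thesis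
    by (simp add: ennreal_mult_le_mult_iff)
qed

text \<open>Reflect x onto x'. On a pair y, \<open>hrefl n s y\<close> the two kernels merely change
  places, and at x the larger kernel meets the larger value of F, because the point nearer to x is
  also the one nearer to the origin.\<close>

lemma potential_radial_decreasing:
  fixes F :: "real ^ 'n::{finite,wellorder} \<Rightarrow> ennreal"
  assumes F [measurable]: "F \<in> borel_measurable borel"
    and dec: "\<And>u v. norm u < norm v \<Longrightarrow> F v \<le> F u"
    and xy: "norm x < norm x'"
  shows "(\<integral>\<^sup>+y. F y * kern (x' - y) \<partial>lborel) \<le> (\<integral>\<^sup>+y. F y * kern (x - y) \<partial>lborel)"
proof -
  obtain n s where n: "norm n = 1" and s: "0 < s" and h: "hrefl n s x = x'" and xs: "x \<bullet> n < s"
    using exists_hrefl[OF xy] .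
  let ?h = "hrefl n s"
  have k: "kern (x' - y) = kern (x - ?h y)" "kern (x' - ?h y) = kern (x - y)" for y
    unfolding h[symmetric] using n by (simp_all add: kern_def norm_hrefl_hrefl norm_hrefl_diff)
  have dbl: "2 * (\<integral>\<^sup>+y. F y * kern (z - y) \<partial>lborel)
      = (\<integral>\<^sup>+y. F y * kern (z - y) + F (?h y) * kern (z - ?h y) \<partial>lborel)" for z
  proof -
    have "(\<integral>\<^sup>+y. F (?h y) * kern (z - ?h y) \<partial>lborel) = (\<integral>\<^sup>+y. F y * kern (z - y) \<partial>lborel)"
      by (rule nn_integral_lborel_hrefl[OF n, of "\<lambda>y. F y * kern (z - y)"]) measurable
    then show ?thesis by (subst nn_integral_add) (auto simp: mult_2)
  qed
  have "2 * (\<integral>\<^sup>+y. F y * kern (x' - y) \<partial>lborel) \<le> 2 * (\<integral>\<^sup>+y. F y * kern (x - y) \<partial>lborel)"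
    unfolding dbl
  proof (rule nn_integral_mono)
    fix y
    have sq: "(norm (?h y))\<^sup>2 = (norm y)\<^sup>2 - 4 * (s * (y \<bullet> n - s))"
      using norm_hrefl[OF n, of s y] by simp
    have d: "(norm (x - ?h y))\<^sup>2 = (norm (x - y))\<^sup>2 + 4 * ((x \<bullet> n - s) * (y \<bullet> n - s))"
      using norm_diff_hrefl[OF n, of x s y] by simp
    consider "y \<bullet> n = s" | "y \<bullet> n < s" | "y \<bullet> n > s" by linarith
    then show "F y * kern (x' - y) + F (?h y) * kern (x' - ?h y) \<le> F y * kern (x - y) + F (?h y) * kern (x - ?h y)"
    proof cases
      case 1
      then show ?thesis using k(1)[of y] by (simp add: hrefl_fixed)
    next
      case 2
      have "s * (y \<bullet> n - s) < 0" using s 2 by (simp add: mult_pos_neg)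
      then have "(norm y)\<^sup>2 < (norm (?h y))\<^sup>2" unfolding sq by linarith
      then have "norm y < norm (?h y)" by (rule power2_less_imp_less) simp
      moreover have "(x \<bullet> n - s) * (y \<bullet> n - s) \<ge> 0" using xs 2 by (intro mult_nonpos_nonpos) auto
      then have "(norm (x - y))\<^sup>2 \<le> (norm (x - ?h y))\<^sup>2" unfolding d by linarith
      then have "norm (x - y) \<le> norm (x - ?h y)" by (rule power2_le_imp_le) simp
      ultimately have "kern (x - y) * F (?h y) + kern (x - ?h y) * F y \<le> kern (x - y) * F y + kern (x - ?h y) * F (?h y)"
        by (intro rearrange2_ennreal kern_anti_mono dec)
      then show ?thesis unfolding k(1)[of y] k(2)[of y] by (simp only: ac_simps)
    next
      case 3
      have "s * (y \<bullet> n - s) > 0" using s 3 by simp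
      then have "(norm (?h y))\<^sup>2 < (norm y)\<^sup>2" unfolding sq by linarith
      then have "norm (?h y) < norm y" by (rule power2_less_imp_less) simp
      moreover have "(x \<bullet> n - s) * (y \<bullet> n - s) \<le> 0" using xs 3 by (intro mult_nonpos_nonneg) auto
      then have "(norm (x - ?h y))\<^sup>2 \<le> (norm (x - y))\<^sup>2" unfolding d by linarith
      then have "norm (x - ?h y) \<le> norm (x - y)" by (rule power2_le_imp_le) simp
      ultimately have "kern (x - ?h y) * F y + kern (x - y) * F (?h y) \<le> kern (x - ?h y) * F (?h y) + kern (x - y) * F y"
        by (intro rearrange2_ennreal kern_anti_mono dec)
      then show ?thesis unfolding k(1)[of y] k(2)[of y] by (simp only: ac_simps)
    qed
  qed
  then show ?thesis by (simp add: ennreal_mult_le_mult_iff)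
qed

lemma bathtub_ennreal:
  fixes \<phi> g :: "'a::euclidean_space \<Rightarrow> ennreal"
  assumes [measurable]: "\<phi> \<in> borel_measurable borel" "g \<in> borel_measurable borel"
    and dec: "\<And>x y. norm x \<le> R \<Longrightarrow> R < norm y \<Longrightarrow> \<phi> y \<le> \<phi> x"
    and g1: "\<And>x. g x \<le> 1"
    and mass: "(\<integral>\<^sup>+x. g x \<partial>lborel) = emeasure lborel (cball (0 :: 'a) R)"
  shows "(\<integral>\<^sup>+x. g x * \<phi> x \<partial>lborel) \<le> (\<integral>\<^sup>+x. indicator (cball 0 R) x * \<phi> x \<partial>lborel)"
proof -
  let ?B = "cball (0 :: 'a) R"
  \<comment> \<open>The level separating the values of \<phi> inside the ball from those
    outside.\<close>
  define c where "c = (SUP y\<in>- ?B. \<phi> y)"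
  have c1: "\<phi> y \<le> c" if "y \<notin> ?B" for y unfolding c_def using that by (intro SUP_upper) auto
  have c2: "c \<le> \<phi> x" if "x \<in> ?B" for x unfolding c_def using that by (intro SUP_least dec) auto
  have s1: "g x + (1 - g x) = 1" for x using g1[of x] by (simp add: add_diff_inverse_ennreal)
  have "(\<integral>\<^sup>+x. g x * indicator ?B x \<partial>lborel) + (\<integral>\<^sup>+x. g x * indicator (- ?B) x \<partial>lborel)
      = (\<integral>\<^sup>+x. g x * indicator ?B x + g x * indicator (- ?B) x \<partial>lborel)"
    by (rule nn_integral_add[symmetric]) measurable
  also have "\<dots> = (\<integral>\<^sup>+x. g x \<partial>lborel)" by (intro nn_integral_cong) (auto simp: indicator_def)
  also have "\<dots> = (\<integral>\<^sup>+x. indicator ?B x \<partial>lborel)" by (simp add: mass)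
  also have "\<dots> = (\<integral>\<^sup>+x. g x * indicator ?B x + (1 - g x) * indicator ?B x \<partial>lborel)"
    by (intro nn_integral_cong) (auto simp: s1 simp flip: distrib_right)
  also have "\<dots> = (\<integral>\<^sup>+x. g x * indicator ?B x \<partial>lborel) + (\<integral>\<^sup>+x. (1 - g x) * indicator ?B x \<partial>lborel)"
    by (rule nn_integral_add) measurable
  finally have eq: "(\<integral>\<^sup>+x. g x * indicator ?B x \<partial>lborel) + (\<integral>\<^sup>+x. g x * indicator (- ?B) x \<partial>lborel)
     = (\<integral>\<^sup>+x. g x * indicator ?B x \<partial>lborel) + (\<integral>\<^sup>+x. (1 - g x) * indicator ?B x \<partial>lborel)" .
  have "(\<integral>\<^sup>+x. g x * indicator ?B x \<partial>lborel) \<le> (\<integral>\<^sup>+x. indicator ?B x \<partial>lborel)"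
    by (intro nn_integral_mono) (auto simp: indicator_def g1)
  also have "\<dots> < top" using emeasure_lborel_cball_finite[of "0::'a" R] by simp
  finally have "(\<integral>\<^sup>+x. g x * indicator ?B x \<partial>lborel) < top" .
  \<comment> \<open>Cancelling the finite mass that g keeps in the ball: what g places outside is
    exactly what it leaves unfilled inside. Both amounts are then valued at the price c.\<close>
  with eq have out: "(\<integral>\<^sup>+x. g x * indicator (- ?B) x \<partial>lborel) = (\<integral>\<^sup>+x. (1 - g x) * indicator ?B x \<partial>lborel)"
    by (auto simp: ennreal_add_left_cancel)
  have "(\<integral>\<^sup>+x. g x * \<phi> x \<partial>lborel)
      \<le> (\<integral>\<^sup>+x. g x * \<phi> x * indicator ?B x + c * (g x * indicator (- ?B) x) \<partial>lborel)"
  proof (rule nn_integral_mono)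
    fix x
    show "g x * \<phi> x \<le> g x * \<phi> x * indicator ?B x + c * (g x * indicator (- ?B) x)"
      using mult_left_mono[OF c1, of x "g x"] by (auto simp: indicator_def mult.commute)
  qed
  also have "\<dots> = (\<integral>\<^sup>+x. g x * \<phi> x * indicator ?B x \<partial>lborel) + c * (\<integral>\<^sup>+x. (1 - g x) * indicator ?B x \<partial>lborel)"
    by (simp add: nn_integral_add nn_integral_cmult out)
  also have "\<dots> = (\<integral>\<^sup>+x. g x * \<phi> x * indicator ?B x + c * ((1 - g x) * indicator ?B x) \<partial>lborel)"
    by (simp add: nn_integral_add nn_integral_cmult)
  also have "\<dots> \<le> (\<integral>\<^sup>+x. indicator ?B x * \<phi> x \<partial>lborel)"
  proof (intro nn_integral_mono)
    fix x
    have "g x * \<phi> x + c * (1 - g x) \<le> \<phi> x" if "x \<in> ?B"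
    proof -
      have "g x * \<phi> x + c * (1 - g x) \<le> g x * \<phi> x + \<phi> x * (1 - g x)"
        using c2[OF that] by (intro add_left_mono mult_right_mono) auto
      also have "\<dots> = (g x + (1 - g x)) * \<phi> x" by (simp only: distrib_right mult.commute[of "\<phi> x"])
      finally show ?thesis by (simp add: s1)
    qed
    then show "g x * \<phi> x * indicator ?B x + c * ((1 - g x) * indicator ?B x) \<le> indicator ?B x * \<phi> x"
      by (auto simp: indicator_def)
  qed
  finally show ?thesis .
qed

lemma interact_commute:
  assumes [measurable]: "f \<in> borel_measurable borel" "g \<in> borel_measurable borel"
  shows "interact f g = interact g f"
proof -
  have "interact f g = (\<integral>\<^sup>+y. \<integral>\<^sup>+x. f x * g y * kern (x - y) \<partial>lborel \<partial>lborel)"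
    unfolding interact_def by (rule lborel_pair.Fubini') measurable
  also have "\<dots> = interact g f"
    unfolding interact_def by (simp add: kern_def norm_minus_commute ac_simps)
  finally show ?thesis .
qed

lemma interact_eq:
  assumes [measurable]: "f \<in> borel_measurable borel" "g \<in> borel_measurable borel"
  shows "interact f g = (\<integral>\<^sup>+x. f x * (\<integral>\<^sup>+y. g y * kern (x - y) \<partial>lborel) \<partial>lborel)"
  unfolding interact_def mult.assoc by (intro nn_integral_cong nn_integral_cmult) measurable

text \<open>One argument is exchanged at a time: the potential of g is radially decreasing, so the
  bathtub principle replaces the other g by the ball; then the potential of the ball allows the same
  for the remaining g.\<close>

lemma interact_radial_le_ball:
  fixes g :: "real ^ 'n::{finite,wellorder} \<Rightarrow> ennreal"
  assumes g [measurable]: "g \<in> borel_measurable borel"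
    and dec: "\<And>u v. norm u < norm v \<Longrightarrow> g v \<le> g u"
    and g1: "\<And>x. g x \<le> 1"
    and mass: "(\<integral>\<^sup>+x. g x \<partial>lborel) = emeasure lborel (cball (0 :: real ^ 'n::{finite,wellorder}) R)"
  shows "interact g g \<le> interact (indicator (cball (0 :: real ^ 'n::{finite,wellorder}) R)) (indicator (cball 0 R))"
proof -
  let ?b = "indicator (cball 0 R) :: real ^ 'n::{finite,wellorder} \<Rightarrow> ennreal"
  have b: "?b v \<le> ?b u" if "norm u < norm v" for u v using that by (auto simp: indicator_def)
  have m [measurable]: "?b \<in> borel_measurable borel" by measurable
  have "interact g g \<le> interact ?b g"
    unfolding interact_eq[OF g g] interact_eq[OF m g]
    by (rule bathtub_ennreal[OF _ g _ g1 mass]) (measurable, auto intro!: potential_radial_decreasing dec)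
  also have "\<dots> = interact g ?b" by (rule interact_commute) measurable
  also have "\<dots> \<le> interact ?b ?b"
    unfolding interact_eq[OF g m] interact_eq[OF m m]
    by (rule bathtub_ennreal[OF _ g _ g1 mass]) (measurable, auto intro!: potential_radial_decreasing b)
  finally show ?thesis .
qed

section \<open>Passage to the limit in the exchange integral\<close>

lemma interact_pair:
  assumes [measurable]: "f \<in> borel_measurable borel" "g \<in> borel_measurable borel"
  shows "interact f g = (\<integral>\<^sup>+p. f (fst p) * g (snd p) * kern (fst p - snd p) \<partial>(lborel \<Otimes>\<^sub>M lborel))"
  unfolding interact_def by (subst lborel.nn_integral_fst[symmetric]) auto

lemma AE_pair_neq: "AE p in lborel \<Otimes>\<^sub>M (lborel :: 'a::euclidean_space measure). fst p \<noteq> snd p"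
proof (rule lborel_pair.AE_pair_measure)
  show "AE x in lborel. AE y in lborel. fst (x, y :: 'a) \<noteq> snd (x, y)"
  proof (rule AE_I2)
    fix x :: 'a
    show "AE y in lborel. fst (x, y) \<noteq> snd (x, y)"
      using AE_lborel_neq[of x] by eventually_elim auto
  qed
qed measurable

lemma AE_pair_both:
  assumes "AE x in lborel. P (x :: 'a::euclidean_space)"
  shows "AE p in lborel \<Otimes>\<^sub>M lborel. P (fst p) \<and> P (snd p)"
proof -
  obtain N where N: "N \<in> null_sets lborel" "{x \<in> space lborel. \<not> P x} \<subseteq> N"
    using assms by (auto simp: eventually_ae_filter)
  have N': "x \<notin> N \<Longrightarrow> P x" for x using N(2) by auto
  have "AE x in lborel. x \<notin> N" using N(1) by (rule AE_not_in)
  moreover have [measurable]: "N \<in> sets borel" using N(1) by auto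
  ultimately have "AE p in lborel \<Otimes>\<^sub>M lborel. fst p \<notin> N \<and> snd p \<notin> N"
    by (intro lborel_pair.AE_pair_measure) (measurable, auto)
  then show ?thesis by eventually_elim (auto intro: N')
qed

text \<open>Fatou on the product space. The diagonal has to be discarded, since products are not
  continuous where the kernel is infinite.\<close>

lemma interact_le_liminf:
  fixes f :: "'a::euclidean_space \<Rightarrow> real" and h :: "nat \<Rightarrow> 'a \<Rightarrow> real"
  assumes [measurable]: "f \<in> borel_measurable borel" "\<And>n. h n \<in> borel_measurable borel"
    and lim: "AE x in lborel. (\<lambda>n. h n x) \<longlonglongrightarrow> f x"
  shows "interact (\<lambda>x. ennreal (f x)) (\<lambda>x. ennreal (f x))
     \<le> liminf (\<lambda>n. interact (\<lambda>x. ennreal (h n x)) (\<lambda>x. ennreal (h n x)))"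
proof -
  let ?k = "\<lambda>f p. ennreal (f (fst p)) * ennreal (f (snd p)) * kern (fst p - snd p)"
  have "interact (\<lambda>x. ennreal (f x)) (\<lambda>x. ennreal (f x)) = (\<integral>\<^sup>+p. ?k f p \<partial>(lborel \<Otimes>\<^sub>M lborel))"
    by (rule interact_pair) measurable
  also have "\<dots> = (\<integral>\<^sup>+p. liminf (\<lambda>n. ?k (h n) p) \<partial>(lborel \<Otimes>\<^sub>M lborel))"
  proof (rule nn_integral_cong_AE, use AE_pair_both[OF lim] AE_pair_neq in eventually_elim)
    case (elim p)
    then have "kern (fst p - snd p) < top" by (simp add: kern_eq)
    with elim have "(\<lambda>n. ?k (h n) p) \<longlonglongrightarrow> ?k f p"
      by (intro tendsto_mult_ennreal tendsto_ennrealI tendsto_const) (auto simp: ennreal_mult_eq_top_iff)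
    then show ?case by (simp add: lim_imp_Liminf)
  qed
  also have "\<dots> \<le> liminf (\<lambda>n. \<integral>\<^sup>+p. ?k (h n) p \<partial>(lborel \<Otimes>\<^sub>M lborel))"
    by (rule nn_integral_liminf) measurable
  also have "\<dots> = liminf (\<lambda>n. interact (\<lambda>x. ennreal (h n x)) (\<lambda>x. ennreal (h n x)))"
    by (subst interact_pair) auto
  finally show ?thesis .
qed

text \<open>The dominating function is the integrand of the ball of radius R, integrable by
  \<open>interact_ball\<close>.\<close>

lemma interact_tendsto:
  fixes f :: "real ^ 3 \<Rightarrow> real" and h :: "nat \<Rightarrow> real ^ 3 \<Rightarrow> real"
  assumes [measurable]: "f \<in> borel_measurable borel" "\<And>n. h n \<in> borel_measurable borel"
    and lim: "AE x in lborel. (\<lambda>n. h n x) \<longlonglongrightarrow> f x"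
    and le: "\<And>n x. ennreal (h n x) \<le> indicator (cball 0 R) x" and R: "R \<ge> 0"
  shows "(\<lambda>n. interact (\<lambda>x. ennreal (h n x)) (\<lambda>x. ennreal (h n x)))
     \<longlonglongrightarrow> interact (\<lambda>x. ennreal (f x)) (\<lambda>x. ennreal (f x))"
proof -
  let ?k = "\<lambda>f p. ennreal (f (fst p)) * ennreal (f (snd p)) * kern (fst p - snd p)"
  let ?b = "indicator (cball 0 R) :: real ^ 3 \<Rightarrow> ennreal"
  have "(\<lambda>n. \<integral>\<^sup>+p. ?k (h n) p \<partial>(lborel \<Otimes>\<^sub>M lborel)) \<longlonglongrightarrow> (\<integral>\<^sup>+p. ?k f p \<partial>(lborel \<Otimes>\<^sub>M lborel))"
  proof (rule nn_integral_dominated_convergence)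
    show "(\<integral>\<^sup>+p. ?b (fst p) * ?b (snd p) * kern (fst p - snd p) \<partial>(lborel \<Otimes>\<^sub>M lborel)) < \<infinity>"
      using interact_ball[OF R] by (subst interact_pair[symmetric]) auto
    show "AE p in lborel \<Otimes>\<^sub>M lborel. (\<lambda>n. ?k (h n) p) \<longlonglongrightarrow> ?k f p"
      using AE_pair_both[OF lim] AE_pair_neq
    proof eventually_elim
      case (elim p)
      then have "kern (fst p - snd p) < top" by (simp add: kern_eq)
      with elim show ?case
        by (intro tendsto_mult_ennreal tendsto_ennrealI tendsto_const) (auto simp: ennreal_mult_eq_top_iff)
    qed
    show "AE p in lborel \<Otimes>\<^sub>M lborel. ?k (h n) p \<le> ?b (fst p) * ?b (snd p) * kern (fst p - snd p)" for n
      by (intro always_eventually allI mult_mono le) auto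
  qed measurable
  then show ?thesis by (subst (1 2) interact_pair) auto
qed

subsection \<open>The rearrangement inequality\<close>

lemma powr_third_power: "a \<ge> 0 \<Longrightarrow> n > 0 \<Longrightarrow> (a powr (1 / 3)) ^ n = a powr (real n / 3)" for a :: real
  by (cases "a = 0") (simp_all add: powr_power)

text \<open>If x and y lie on opposite sides of the mirror, polarization may compare f at x with f
  at the image of y; that image is no farther from x than y, so the same modulus applies. This keeps
  the class used below equicontinuous.\<close>

lemma polarize_modulus:
  assumes n: "norm n = 1"
    and f: "\<And>x y. norm (x - y) \<le> d \<Longrightarrow> \<bar>f x - f y\<bar> \<le> e"
    and xy: "norm (x - y) \<le> d"
  shows "\<bar>polarize n s f x - polarize n s f y\<bar> \<le> e"
proof -
  let ?h = "hrefl n s"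
  have 1: "\<bar>f x - f y\<bar> \<le> e" "\<bar>f (?h x) - f (?h y)\<bar> \<le> e"
    using f xy n by (auto simp: norm_hrefl_hrefl)
  have 2: "\<bar>f x - f (?h y)\<bar> \<le> e \<and> \<bar>f (?h x) - f y\<bar> \<le> e" if "(x \<bullet> n - s) * (y \<bullet> n - s) \<le> 0"
  proof -
    have "(norm (x - ?h y))\<^sup>2 \<le> (norm (x - y))\<^sup>2"
      using norm_diff_hrefl[OF n, of x s y] that unfolding mult.assoc by linarith
    then have "norm (x - ?h y) \<le> norm (x - y)" by (rule power2_le_imp_le) simp
    then show ?thesis using f xy n by (auto simp: norm_hrefl_diff)
  qed
  consider "x \<bullet> n \<le> s" "y \<bullet> n \<le> s" | "x \<bullet> n > s" "y \<bullet> n > s"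
    | "x \<bullet> n \<le> s" "y \<bullet> n > s" | "x \<bullet> n > s" "y \<bullet> n \<le> s" by linarith
  then show ?thesis
  proof cases
    case 1
    then show ?thesis using \<open>\<bar>f x - f y\<bar> \<le> e\<close> \<open>\<bar>f (?h x) - f (?h y)\<bar> \<le> e\<close>
      by (auto simp: polarize_def max_def)
  next
    case 2
    then show ?thesis using \<open>\<bar>f x - f y\<bar> \<le> e\<close> \<open>\<bar>f (?h x) - f (?h y)\<bar> \<le> e\<close>
      by (auto simp: polarize_def min_def)
  next
    case 3
    then have "(x \<bullet> n - s) * (y \<bullet> n - s) \<le> 0" by (intro mult_nonpos_nonneg) auto
    from 2[OF this] 1 3 show ?thesis by (auto simp: polarize_def max_def min_def)
  next
    case 4
    then have "(x \<bullet> n - s) * (y \<bullet> n - s) \<le> 0" by (intro mult_nonneg_nonpos) auto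
    from 2[OF this] 1 4 show ?thesis by (auto simp: polarize_def max_def min_def)
  qed
qed

lemma nn_integral_polarize:
  fixes n :: "real ^ 'n::{finite,wellorder}"
  assumes n: "norm n = 1" and [measurable]: "f \<in> borel_measurable borel" and f0: "\<And>x. 0 \<le> f x"
  shows "(\<integral>\<^sup>+x. ennreal (polarize n s f x) \<partial>lborel) = (\<integral>\<^sup>+x. ennreal (f x) \<partial>lborel)"
proof -
  have dbl: "2 * (\<integral>\<^sup>+x. ennreal (g x) \<partial>lborel) = (\<integral>\<^sup>+x. ennreal (g x + g (hrefl n s x)) \<partial>lborel)"
    if [measurable]: "g \<in> borel_measurable borel" and g0: "\<And>x. 0 \<le> g x" for g
  proof -
    have "(\<integral>\<^sup>+x. ennreal (g x + g (hrefl n s x)) \<partial>lborel)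
        = (\<integral>\<^sup>+x. ennreal (g x) \<partial>lborel) + (\<integral>\<^sup>+x. ennreal (g (hrefl n s x)) \<partial>lborel)"
      using g0 by (simp add: nn_integral_add)
    also have "(\<integral>\<^sup>+x. ennreal (g (hrefl n s x)) \<partial>lborel) = (\<integral>\<^sup>+x. ennreal (g x) \<partial>lborel)"
      by (rule nn_integral_lborel_hrefl[OF n, of "\<lambda>x. ennreal (g x)"]) measurable
    finally show ?thesis by (simp add: mult_2)
  qed
  have p0: "0 \<le> polarize n s f x" for x using f0 by (auto simp: polarize_def le_max_iff_disj)
  have "2 * (\<integral>\<^sup>+x. ennreal (polarize n s f x) \<partial>lborel) = 2 * (\<integral>\<^sup>+x. ennreal (f x) \<partial>lborel)"
    using dbl[of "polarize n s f"] dbl[of f] p0 f0 by (simp add: polarize_add[OF n])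
  then show ?thesis by (simp add: ennreal_mult_cancel_left)
qed

lemma uniformly_continuous_compact_support:
  fixes h :: "'a::euclidean_space \<Rightarrow> real"
  assumes c: "continuous_on UNIV h" and supp: "\<And>x. R < norm x \<Longrightarrow> h x = 0" and e: "e > 0"
  obtains d where "d > 0" "\<And>x y. norm (x - y) \<le> d \<Longrightarrow> \<bar>h x - h y\<bar> \<le> e"
proof -
  \<comment> \<open>Radius R + 1: two points at distance at most 1 either both lie in this ball or
    both lie outside the support.\<close>
  have "uniformly_continuous_on (cball 0 (R + 1)) h"
    using c by (intro compact_uniformly_continuous continuous_on_subset[OF c]) auto
  then obtain d where d: "d > 0"
    "\<And>x y. x \<in> cball 0 (R + 1) \<Longrightarrow> y \<in> cball 0 (R + 1) \<Longrightarrow> dist y x < d \<Longrightarrow> dist (h y) (h x) < e"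
    unfolding uniformly_continuous_on_def using e by metis
  show ?thesis
  proof
    show "min (d / 2) 1 > 0" using d by simp
    fix x y :: 'a assume xy: "norm (x - y) \<le> min (d / 2) 1"
    have t: "norm x \<le> norm y + norm (x - y)" "norm y \<le> norm x + norm (x - y)"
      using norm_triangle_ineq[of y "x - y"] norm_triangle_ineq[of x "y - x"] by (auto simp: norm_minus_commute)
    show "\<bar>h x - h y\<bar> \<le> e"
    proof (cases "norm x \<le> R + 1 \<and> norm y \<le> R + 1")
      case True
      then have "dist (h x) (h y) < e"
        using xy d(1) by (intro d(2)) (auto simp: dist_norm)
      then show ?thesis by (simp add: dist_real_def)
    next
      case False
      then have "R < norm x" "R < norm y" using t xy by auto
      then show ?thesis using supp e by simp
    qed
  qed
qed

text \<open>Minimise the second moment over a compact class closed under polarization; at a minimiser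
  no reflection can move mass inwards, so the minimiser is radially decreasing.\<close>

lemma exists_radial_rearrangement:
  fixes h0 :: "real ^ 3 \<Rightarrow> real"
  assumes c: "continuous_on UNIV h0" and h0: "\<And>x. 0 \<le> h0 x" "\<And>x. h0 x \<le> 1"
    and supp: "\<And>x. R < norm x \<Longrightarrow> h0 x = 0" and R: "R \<ge> 0"
  obtains g :: "real ^ 3 \<Rightarrow> real" where "g \<in> borel_measurable borel" "\<And>x. 0 \<le> g x" "\<And>x. g x \<le> 1"
    "\<And>u v. norm u < norm v \<Longrightarrow> g v \<le> g u"
    "(\<integral>\<^sup>+x. ennreal (g x) \<partial>lborel) = (\<integral>\<^sup>+x. ennreal (h0 x) \<partial>lborel)"
    "interact (\<lambda>x. ennreal (h0 x)) (\<lambda>x. ennreal (h0 x)) \<le> interact (\<lambda>x. ennreal (g x)) (\<lambda>x. ennreal (g x))"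
proof -
  let ?X = "\<lambda>h :: real ^ 3 \<Rightarrow> real. interact (\<lambda>x. ennreal (h x)) (\<lambda>x. ennreal (h x))"
  let ?M = "\<lambda>h :: real ^ 3 \<Rightarrow> real. \<integral>\<^sup>+x. ennreal (h x) \<partial>lborel"
  let ?b = "indicator (cball 0 R) :: real ^ 3 \<Rightarrow> ennreal"
  define J where "J h = (\<integral>\<^sup>+x. ennreal ((norm x)\<^sup>2 * h x) \<partial>lborel)" for h :: "real ^ 3 \<Rightarrow> real"
  \<comment> \<open>The third clause says that every modulus of continuity of \<open>h0\<close> is
    one of h. This gives compactness and survives both polarization and pointwise limits; the common
    support makes mass, interaction and second moment continuous along such limits.\<close>
  define K where "K = {h :: real ^ 3 \<Rightarrow> real. (\<forall>x. 0 \<le> h x \<and> h x \<le> 1) \<and> (\<forall>x. R < norm x \<longrightarrow> h x = 0)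
    \<and> (\<forall>d e. (\<forall>x y. norm (x - y) \<le> d \<longrightarrow> \<bar>h0 x - h0 y\<bar> \<le> e) \<longrightarrow> (\<forall>x y. norm (x - y) \<le> d \<longrightarrow> \<bar>h x - h y\<bar> \<le> e))
    \<and> ?M h = ?M h0 \<and> ?X h0 \<le> ?X h}"
  have Kmod: "\<exists>d>0. \<forall>h\<in>K. \<forall>x y. norm (x - y) \<le> d \<longrightarrow> \<bar>h x - h y\<bar> \<le> e" if e: "e > 0" for e
  proof -
    obtain d where d: "d > 0" "\<And>x y. norm (x - y) \<le> d \<Longrightarrow> \<bar>h0 x - h0 y\<bar> \<le> e"
      using uniformly_continuous_compact_support[OF c supp e] by blast
    then have "\<forall>h\<in>K. \<forall>x y. norm (x - y) \<le> d \<longrightarrow> \<bar>h x - h y\<bar> \<le> e"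
      unfolding K_def by blast
    with d(1) show ?thesis by blast
  qed
  have Kcont: "continuous_on UNIV h" if h: "h \<in> K" for h
    unfolding continuous_on_iff
  proof (intro ballI allI impI)
    fix x :: "real ^ 3" and e :: real assume e: "0 < e"
    obtain d where d: "d > 0" "\<forall>h\<in>K. \<forall>x y. norm (x - y) \<le> d \<longrightarrow> \<bar>h x - h y\<bar> \<le> e / 2"
      using Kmod[OF half_gt_zero[OF e]] by blast
    show "\<exists>d>0. \<forall>x'\<in>UNIV. dist x' x < d \<longrightarrow> dist (h x') (h x) < e"
    proof (intro exI[of _ d] conjI ballI impI d(1))
      fix x' assume "dist x' x < d"
      then have "\<bar>h x' - h x\<bar> \<le> e / 2" using d(2) h by (auto simp: dist_norm)
      then show "dist (h x') (h x) < e" using e by (simp add: dist_real_def)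
    qed
  qed
  have Kmeas: "h \<in> borel_measurable borel" if "h \<in> K" for h
    using Kcont[OF that] by (rule borel_measurable_continuous_onI)
  have Kb: "ennreal (h x) \<le> ?b x" if "h \<in> K" for h x
    using that unfolding K_def by (auto simp: indicator_def not_le)
  have K01: "0 \<le> h x" "h x \<le> 1" "R < norm x \<Longrightarrow> h x = 0" if "h \<in> K" for h x
    using that unfolding K_def by auto
  have finB: "(\<integral>\<^sup>+x. ?b x \<partial>lborel) < \<infinity>"
    using emeasure_lborel_cball_finite[of "0 :: real ^ 3" R] by simp
  have Jle: "ennreal ((norm x)\<^sup>2 * h x) \<le> ennreal (R\<^sup>2) * ?b x" if h: "h \<in> K" for h x
  proof (cases "norm x \<le> R")
    case True
    have "(norm x)\<^sup>2 * h x \<le> R\<^sup>2 * 1"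
      using True K01[OF h] by (intro mult_mono power_mono) auto
    then show ?thesis using True by (auto intro: ennreal_leI)
  qed (use K01[OF h, of x] in auto)
  have finJ: "(\<integral>\<^sup>+x. ennreal (R\<^sup>2) * ?b x \<partial>lborel) < \<infinity>"
    using finB by (subst nn_integral_cmult) (auto simp: ennreal_mult_less_top)
  \<comment> \<open>Positivity of s puts the origin on the favoured side. A point of that side
    beyond radius R has its mirror image at least as far out, so no mass leaves the ball.\<close>
  have Kpol: "polarize n s h \<in> K" if h: "h \<in> K" and n: "norm n = 1" and s: "s > 0" for h n s
  proof -
    have [measurable]: "h \<in> borel_measurable borel" using Kmeas[OF h] .
    have 1: "0 \<le> polarize n s h x \<and> polarize n s h x \<le> 1" for x
      using K01[OF h] by (auto simp: polarize_def le_max_iff_disj min_le_iff_disj)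
    have 2: "polarize n s h x = 0" if x: "R < norm x" for x
    proof (cases "x \<bullet> n \<le> s")
      case True
      have "(norm x)\<^sup>2 \<le> (norm (hrefl n s x))\<^sup>2"
        using norm_hrefl[OF n, of s x] True s by (simp add: mult_nonneg_nonpos)
      then have "norm x \<le> norm (hrefl n s x)" by (rule power2_le_imp_le) simp
      then show ?thesis using x K01(3)[OF h] True by (simp add: polarize_def)
    next
      case False
      then show ?thesis using x K01(1)[OF h, of "hrefl n s x"] K01(3)[OF h x] by (simp add: polarize_def)
    qed
    have 3: "\<forall>x y. norm (x - y) \<le> d \<longrightarrow> \<bar>polarize n s h x - polarize n s h y\<bar> \<le> e"
      if "\<forall>x y. norm (x - y) \<le> d \<longrightarrow> \<bar>h0 x - h0 y\<bar> \<le> e" for d e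
    proof -
      have "\<forall>x y. norm (x - y) \<le> d \<longrightarrow> \<bar>h x - h y\<bar> \<le> e" using h that unfolding K_def by blast
      then show ?thesis using polarize_modulus[OF n, of d h e] by blast
    qed
    have 4: "?M (polarize n s h) = ?M h0"
      using nn_integral_polarize[OF n Kmeas[OF h] K01(1)[OF h]] h unfolding K_def by auto
    have "?X h0 \<le> ?X h" using h unfolding K_def by blast
    also have "\<dots> \<le> ?X (polarize n s h)" by (rule interact_polarize[OF n Kmeas[OF h]])
    finally show ?thesis unfolding K_def using 1 2 3 4 by blast
  qed
  have "h0 \<in> K" unfolding K_def using h0 supp by auto
  then have "J ` K \<noteq> {}" by auto
  from ennreal_Inf_countable_INF[OF this] obtain j :: "nat \<Rightarrow> ennreal"
    where j: "decseq j" "range j \<subseteq> J ` K" "Inf (J ` K) = (INF i. j i)" by auto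
  have "\<forall>i. \<exists>h. h \<in> K \<and> j i = J h" using j(2) by blast
  then obtain h where h: "\<And>i. h i \<in> K" "\<And>i. j i = J (h i)" by metis
  have jlim: "(\<lambda>i. J (h i)) \<longlonglongrightarrow> Inf (J ` K)"
    unfolding j(3) h(2)[symmetric] using LIMSEQ_INF[OF j(1)] .
  obtain g' k where k: "strict_mono (k :: nat \<Rightarrow> nat)"
    and g': "\<And>e. 0 < e \<Longrightarrow> \<exists>N. \<forall>n x. n \<ge> N \<and> x \<in> cball 0 R \<longrightarrow> norm (h (k n) x - g' x) < e"
  proof (rule Arzela_Ascoli[of "cball (0 :: real ^ 3) R" h 1])
    show "norm (h n x) \<le> 1" for n x using K01[OF h(1)] by (auto simp: abs_le_iff intro: order_trans[of _ 0])
    show "\<exists>d>0. \<forall>n y. y \<in> cball 0 R \<and> norm (x - y) < d \<longrightarrow> norm (h n x - h n y) < e"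
      if e: "0 < e" for x e
    proof -
      obtain d where d: "d > 0" "\<forall>h\<in>K. \<forall>x y. norm (x - y) \<le> d \<longrightarrow> \<bar>h x - h y\<bar> \<le> e / 2"
        using Kmod[OF half_gt_zero[OF e]] by blast
      have "norm (h n x - h n y) < e" if "norm (x - y) < d" for n y
      proof -
        have "\<bar>h n x - h n y\<bar> \<le> e / 2" using d(2) h(1)[of n] that by auto
        then show ?thesis using e by simp
      qed
      with d(1) show ?thesis by blast
    qed
  qed auto
  \<comment> \<open>Uniform convergence is available on the ball only; outside it every member of
    the class vanishes.\<close>
  define g where "g x = (if norm x \<le> R then g' x else 0)" for x
  have lim: "(\<lambda>n. h (k n) x) \<longlonglongrightarrow> g x" for x
  proof (cases "norm x \<le> R")
    case True
    have "\<exists>no. \<forall>n\<ge>no. norm (h (k n) x - g x) < r" if "r > 0" for r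
      using g'[OF that] True by (auto simp: g_def)
    then show ?thesis by (simp add: LIMSEQ_iff)
  next
    case False
    then have "h (k n) x = 0" for n using K01(3)[OF h(1)] by auto
    then show ?thesis using False by (simp add: g_def)
  qed
  have hm [measurable]: "h n \<in> borel_measurable borel" for n using Kmeas[OF h(1)] .
  have gm [measurable]: "g \<in> borel_measurable borel"
    by (rule borel_measurable_LIMSEQ_real[OF lim]) measurable
  have gK: "g \<in> K"
  proof -
    have 1: "0 \<le> g x" "g x \<le> 1" for x
      using K01[OF h(1)] by (auto intro!: LIMSEQ_le_const[OF lim] LIMSEQ_le_const2[OF lim])
    have 2: "\<bar>g x - g y\<bar> \<le> e"
      if "\<forall>x y. norm (x - y) \<le> d \<longrightarrow> \<bar>h0 x - h0 y\<bar> \<le> e" "norm (x - y) \<le> d" for d e x y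
    proof (rule LIMSEQ_le_const2)
      show "(\<lambda>n. \<bar>h (k n) x - h (k n) y\<bar>) \<longlonglongrightarrow> \<bar>g x - g y\<bar>" by (intro tendsto_intros lim)
      have "\<bar>h (k n) x - h (k n) y\<bar> \<le> e" for n
        using h(1)[of "k n"] that unfolding K_def by blast
      then show "\<exists>N. \<forall>n\<ge>N. \<bar>h (k n) x - h (k n) y\<bar> \<le> e" by blast
    qed
    have "(\<lambda>n. ?M (h (k n))) \<longlonglongrightarrow> ?M g"
      by (rule nn_integral_dominated_convergence[OF _ _ _ _ finB])
        (auto intro!: Kb h(1) tendsto_ennrealI lim)
    moreover have "?M (h (k n)) = ?M h0" for n using h(1)[of "k n"] unfolding K_def by blast
    ultimately have 3: "?M g = ?M h0" by (simp add: LIMSEQ_const_iff)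
    have "(\<lambda>n. ?X (h (k n))) \<longlonglongrightarrow> ?X g"
      by (rule interact_tendsto[OF _ _ _ _ R]) (auto intro!: Kb h(1) lim)
    moreover have "?X h0 \<le> ?X (h (k n))" for n using h(1)[of "k n"] unfolding K_def by blast
    ultimately have 4: "?X h0 \<le> ?X g" by (intro tendsto_lowerbound) auto
    show ?thesis unfolding K_def using 1 2 3 4 by (auto simp: g_def)
  qed
  have "(\<lambda>n. J (h (k n))) \<longlonglongrightarrow> J g"
    unfolding J_def
    by (rule nn_integral_dominated_convergence[OF _ _ _ _ finJ])
      (auto intro!: Jle h(1) tendsto_ennrealI tendsto_mult lim)
  moreover have "(\<lambda>n. J (h (k n))) \<longlonglongrightarrow> Inf (J ` K)"
    using LIMSEQ_subseq_LIMSEQ[OF jlim k] by (simp add: o_def)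
  ultimately have Jg: "J g = Inf (J ` K)" by (rule LIMSEQ_unique)
  have dec: "g v \<le> g u" if uv: "norm u < norm v" for u v
  proof (rule ccontr)
    assume "\<not> g v \<le> g u"
    obtain n s where n: "norm n = 1" and s: "0 < s" and huv: "hrefl n s u = v" and us: "u \<bullet> n < s"
      using exists_hrefl[OF uv] .
    let ?h = "hrefl n s" and ?p = "polarize n s g"
    have pK: "?p \<in> K" using Kpol[OF gK n s] .
    have [measurable]: "?p \<in> borel_measurable borel" by measurable
    have sq: "(norm (?h x))\<^sup>2 = (norm x)\<^sup>2 - 4 * (s * (x \<bullet> n - s))" for x
      using norm_hrefl[OF n, of s x] by simp
    \<comment> \<open>What polarization saves in second moment on the pair of x and its image, since
      the value gained at the near point is lost at the far one. Minimality of \<open>J g\<close>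
      and its finiteness force D to vanish almost everywhere.\<close>
    define D where "D x = ((norm (?h x))\<^sup>2 - (norm x)\<^sup>2) * (?p x - g x)" for x
    have [measurable]: "D \<in> borel_measurable borel" unfolding D_def by measurable
    have D0: "0 \<le> D x" for x
    proof (cases "x \<bullet> n \<le> s")
      case True
      then have "s * (x \<bullet> n - s) \<le> 0" using s by (simp add: mult_nonneg_nonpos)
      then show ?thesis unfolding D_def sq using True by (intro mult_nonneg_nonneg) (auto simp: polarize_def)
    next
      case False
      then have "s * (x \<bullet> n - s) \<ge> 0" using s by simp
      then show ?thesis unfolding D_def sq using False by (intro mult_nonpos_nonpos) (auto simp: polarize_def)
    qed
    have dbl: "2 * J f = (\<integral>\<^sup>+x. ennreal ((norm x)\<^sup>2 * f x + (norm (?h x))\<^sup>2 * f (?h x)) \<partial>lborel)"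
      if f: "f \<in> K" for f
    proof -
      have [measurable]: "f \<in> borel_measurable borel" using Kmeas[OF f] .
      have "(\<integral>\<^sup>+x. ennreal ((norm (?h x))\<^sup>2 * f (?h x)) \<partial>lborel) = J f"
        unfolding J_def by (rule nn_integral_lborel_hrefl[OF n, of "\<lambda>x. ennreal ((norm x)\<^sup>2 * f x)"]) measurable
      then show ?thesis
        using K01(1)[OF f] by (simp add: nn_integral_add mult_2 J_def)
    qed
    have "2 * J g = (\<integral>\<^sup>+x. ennreal ((norm x)\<^sup>2 * ?p x + (norm (?h x))\<^sup>2 * ?p (?h x)) + ennreal (D x) \<partial>lborel)"
      unfolding dbl[OF gK]
    proof (rule nn_integral_cong)
      fix x
      have e: "?p (?h x) = g x + g (?h x) - ?p x" using polarize_add[OF n, of s g x] by linarith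
      have "(norm x)\<^sup>2 * g x + (norm (?h x))\<^sup>2 * g (?h x)
          = ((norm x)\<^sup>2 * ?p x + (norm (?h x))\<^sup>2 * ?p (?h x)) + D x"
        unfolding D_def e by (simp add: algebra_simps)
      then show "ennreal ((norm x)\<^sup>2 * g x + (norm (?h x))\<^sup>2 * g (?h x))
          = ennreal ((norm x)\<^sup>2 * ?p x + (norm (?h x))\<^sup>2 * ?p (?h x)) + ennreal (D x)"
        using K01(1)[OF pK] D0 by (simp add: ennreal_plus)
    qed
    also have "\<dots> = 2 * J ?p + (\<integral>\<^sup>+x. ennreal (D x) \<partial>lborel)"
      unfolding dbl[OF pK] by (rule nn_integral_add) measurable
    also have "\<dots> \<ge> 2 * J g + (\<integral>\<^sup>+x. ennreal (D x) \<partial>lborel)"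
      unfolding Jg using pK by (intro add_right_mono mult_left_mono INF_lower) auto
    finally have le: "2 * J g + (\<integral>\<^sup>+x. ennreal (D x) \<partial>lborel) \<le> 2 * J g + 0" by simp
    have "J g \<le> (\<integral>\<^sup>+x. ennreal (R\<^sup>2) * ?b x \<partial>lborel)"
      unfolding J_def by (intro nn_integral_mono Jle gK)
    then have "2 * J g < top" using finJ by (auto simp: ennreal_mult_less_top)
    with le have "(\<integral>\<^sup>+x. ennreal (D x) \<partial>lborel) = 0" by (auto simp: ennreal_add_left_cancel_le)
    then have AE0: "AE x in lborel. D x = 0"
      using D0 by (auto simp: nn_integral_0_iff_AE antisym)
    \<comment> \<open>The wrongly ordered pairs, seen from the near side. D is positive there, so U
      is null; but continuity of g makes U open, and it contains u.\<close>
    define U where "U = {x. x \<bullet> n < s \<and> g x < g (?h x)}"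
    have cg: "continuous_on UNIV g" using Kcont[OF gK] .
    have "open U" unfolding U_def
      by (intro open_Collect_conj open_Collect_less continuous_intros cg continuous_on_compose2[OF cg]) auto
    moreover have "u \<in> U" unfolding U_def using us huv \<open>\<not> g v \<le> g u\<close> by auto
    ultimately have "\<not> negligible U" by (intro open_not_negligible) auto
    moreover have "U \<in> null_sets lborel"
    proof -
      have "D x > 0" if "x \<in> U" for x
      proof -
        have "s * (x \<bullet> n - s) < 0" using that s by (simp add: U_def mult_pos_neg)
        then show ?thesis using that unfolding D_def sq by (intro mult_pos_pos) (auto simp: polarize_def U_def)
      qed
      then have "AE x in lborel. x \<notin> U" using AE0 by (auto elim!: eventually_mono) (metis less_irrefl)
      then show ?thesis using \<open>open U\<close> by (subst AE_iff_null_sets) auto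
    qed
    ultimately show False by (simp add: negligible_iff_null_sets null_sets_completionI)
  qed
  show ?thesis
  proof (rule that[of g])
    show "?M g = ?M h0" "?X h0 \<le> ?X g" using gK unfolding K_def by blast+
  qed (use gm K01[OF gK] dec in auto)
qed


text \<open>The bound is expressed through the mass M, not the radius of the ball, so that its
  continuity and monotonicity in M can carry it to approximations whose masses differ.\<close>

lemma interact_le_ball_continuous:
  fixes h0 :: "real ^ 3 \<Rightarrow> real"
  assumes "continuous_on UNIV h0" "\<And>x. 0 \<le> h0 x" "\<And>x. h0 x \<le> 1"
    and "\<And>x. R < norm x \<Longrightarrow> h0 x = 0" "R \<ge> 0"
    and M: "(\<integral>\<^sup>+x. ennreal (h0 x) \<partial>lborel) = ennreal M" "M \<ge> 0"
  shows "interact (\<lambda>x. ennreal (h0 x)) (\<lambda>x. ennreal (h0 x)) \<le> ennreal (4 * pi\<^sup>2 * (3 * M / (4 * pi)) powr (4 / 3))"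
proof -
  obtain g :: "real ^ 3 \<Rightarrow> real" where g [measurable]: "g \<in> borel_measurable borel" and g01: "\<And>x. 0 \<le> g x" "\<And>x. g x \<le> 1"
    and dec: "\<And>u v. norm u < norm v \<Longrightarrow> g v \<le> g u"
    and mass: "(\<integral>\<^sup>+x. ennreal (g x) \<partial>lborel) = (\<integral>\<^sup>+x. ennreal (h0 x) \<partial>lborel)"
    and le: "interact (\<lambda>x. ennreal (h0 x)) (\<lambda>x. ennreal (h0 x)) \<le> interact (\<lambda>x. ennreal (g x)) (\<lambda>x. ennreal (g x))"
    using exists_radial_rearrangement[OF assms(1-5)] by blast
  define r where "r = (3 * M / (4 * pi)) powr (1 / 3)"
  have r: "r \<ge> 0" "r ^ 3 = 3 * M / (4 * pi)" "r ^ 4 = (3 * M / (4 * pi)) powr (4 / 3)"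
    using M(2) by (simp_all add: r_def powr_third_power)
  have "(\<integral>\<^sup>+x. ennreal (g x) \<partial>lborel) = emeasure lborel (cball (0 :: real ^ 3) r)"
    using M by (simp add: mass emeasure_cball_3[OF r(1)] r(2))
  then have "interact (\<lambda>x. ennreal (g x)) (\<lambda>x. ennreal (g x))
      \<le> interact (indicator (cball (0 :: real ^ 3) r)) (indicator (cball 0 r))"
    using g01 dec by (intro interact_radial_le_ball) (auto intro!: ennreal_leI simp: ennreal_le_1)
  with le show ?thesis by (simp add: interact_ball[OF r(1)] r(3))
qed

text \<open>Continuous approximants of f do not keep its mass, but their masses converge, and the
  bound is continuous in the mass; Fatou handles the interaction.\<close>

lemma interact_le_ball_bounded_support:
  fixes f :: "real ^ 3 \<Rightarrow> real"
  assumes f [measurable]: "f \<in> borel_measurable borel" and f01: "\<And>x. 0 \<le> f x" "\<And>x. f x \<le> 1"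
    and supp: "\<And>x. R < norm x \<Longrightarrow> f x = 0" and R: "R \<ge> 0"
    and M: "(\<integral>\<^sup>+x. ennreal (f x) \<partial>lborel) = ennreal M" "M \<ge> 0"
  shows "interact (\<lambda>x. ennreal (f x)) (\<lambda>x. ennreal (f x)) \<le> ennreal (4 * pi\<^sup>2 * (3 * M / (4 * pi)) powr (4 / 3))"
proof -
  have "f \<in> borel_measurable lebesgue" using f by (intro measurable_completion) simp
  then have "f measurable_on UNIV" by (simp add: measurable_on_iff_borel_measurable)
  then obtain N g where N: "negligible N" and gc: "\<And>n. continuous_on UNIV (g n)"
    and gl: "\<And>x. x \<notin> N \<Longrightarrow> (\<lambda>n. g n x) \<longlonglongrightarrow> f x"
    unfolding measurable_on_def by auto
  \<comment> \<open>Clamping to [0, 1] and a cutoff equal to 1 on the ball of radius R and 0 beyond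
    R + 1; both fix the limit f.\<close>
  define h where "h n x = max 0 (min 1 (g n x)) * max 0 (min 1 (R + 1 - norm x))" for n :: nat and x
  have hc: "continuous_on UNIV (h n)" for n
    unfolding h_def by (intro continuous_intros gc)
  have hm [measurable]: "h n \<in> borel_measurable borel" for n
    using hc by (rule borel_measurable_continuous_onI)
  have h01: "0 \<le> h n x" "h n x \<le> 1" for n x
    unfolding h_def by (auto intro!: mult_le_one)
  have hs: "h n x = 0" if "R + 1 < norm x" for n x
    using that by (simp add: h_def)
  have lim: "(\<lambda>n. h n x) \<longlonglongrightarrow> f x" if "x \<notin> N" for x
  proof -
    have "(\<lambda>n. h n x) \<longlonglongrightarrow> max 0 (min 1 (f x)) * max 0 (min 1 (R + 1 - norm x))"
      unfolding h_def by (intro tendsto_intros gl that)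
    also have "max 0 (min 1 (f x)) * max 0 (min 1 (R + 1 - norm x)) = f x"
      using f01[of x] supp[of x] by (cases "norm x \<le> R") auto
    finally show ?thesis .
  qed
  have "AE x in lebesgue. x \<notin> N" using N by (simp add: negligible_iff_null_sets AE_not_in)
  then have "AE x in lborel. x \<notin> N" by (simp add: AE_completion_iff)
  then have lim': "AE x in lborel. (\<lambda>n. h n x) \<longlonglongrightarrow> f x"
    by eventually_elim (rule lim)
  let ?b = "indicator (cball 0 (R + 1)) :: real ^ 3 \<Rightarrow> ennreal"
  have hb: "ennreal (h n x) \<le> ?b x" for n x
    using h01[of n x] hs[of x n] by (auto simp: indicator_def not_le ennreal_le_1)
  have finB: "(\<integral>\<^sup>+x. ?b x \<partial>lborel) < \<infinity>"
    using emeasure_lborel_cball_finite[of "0 :: real ^ 3" "R + 1"] by simp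
  define m where "m n = enn2real (\<integral>\<^sup>+x. ennreal (h n x) \<partial>lborel)" for n
  have fin: "(\<integral>\<^sup>+x. ennreal (h n x) \<partial>lborel) < \<infinity>" for n
    using finB by (rule le_less_trans[OF nn_integral_mono[OF hb]])
  have m: "(\<integral>\<^sup>+x. ennreal (h n x) \<partial>lborel) = ennreal (m n)" "m n \<ge> 0" for n
    using fin[of n] by (simp_all add: m_def)
  have "(\<lambda>n. \<integral>\<^sup>+x. ennreal (h n x) \<partial>lborel) \<longlonglongrightarrow> (\<integral>\<^sup>+x. ennreal (f x) \<partial>lborel)"
  proof (rule nn_integral_dominated_convergence[OF _ _ _ _ finB])
    show "AE x in lborel. (\<lambda>n. ennreal (h n x)) \<longlonglongrightarrow> ennreal (f x)"
      using lim' by eventually_elim (rule tendsto_ennrealI)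
  qed (auto intro: hb)
  then have mlim: "m \<longlonglongrightarrow> M" unfolding M m using M(2) m(2) by (simp add: tendsto_ennreal_iff)
  let ?c = "\<lambda>M. 4 * pi\<^sup>2 * (3 * M / (4 * pi)) powr (4 / 3)"
  have "interact (\<lambda>x. ennreal (f x)) (\<lambda>x. ennreal (f x))
     \<le> liminf (\<lambda>n. interact (\<lambda>x. ennreal (h n x)) (\<lambda>x. ennreal (h n x)))"
    by (rule interact_le_liminf[OF f hm lim'])
  also have "\<dots> \<le> liminf (\<lambda>n. ennreal (?c (m n)))"
  proof (intro Liminf_mono always_eventually allI)
    fix n
    show "interact (\<lambda>x. ennreal (h n x)) (\<lambda>x. ennreal (h n x)) \<le> ennreal (?c (m n))"
      using R by (intro interact_le_ball_continuous[of "h n" "R + 1"] hc h01 hs m) auto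
  qed
  also have "\<dots> = ennreal (?c M)"
  proof (rule lim_imp_Liminf)
    have "(\<lambda>n. (3 * m n / (4 * pi)) powr (4 / 3)) \<longlonglongrightarrow> (3 * M / (4 * pi)) powr (4 / 3)"
      using m(2) by (intro tendsto_powr2 tendsto_intros mlim) auto
    then show "(\<lambda>n. ennreal (?c (m n))) \<longlonglongrightarrow> ennreal (?c M)"
      by (intro tendsto_ennrealI tendsto_mult tendsto_const)
  qed simp
  finally show ?thesis .
qed

text \<open>Truncation to the balls of radius n only lowers the mass, and the bound increases with
  the mass.\<close>

theorem interact_le_ball:
  fixes f :: "real ^ 3 \<Rightarrow> real"
  assumes f [measurable]: "f \<in> borel_measurable borel" and f01: "\<And>x. 0 \<le> f x" "\<And>x. f x \<le> 1"
    and M: "(\<integral>\<^sup>+x. ennreal (f x) \<partial>lborel) = ennreal M" "M \<ge> 0"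
  shows "interact (\<lambda>x. ennreal (f x)) (\<lambda>x. ennreal (f x)) \<le> ennreal (4 * pi\<^sup>2 * (3 * M / (4 * pi)) powr (4 / 3))"
proof -
  define h where "h n x = (if norm x \<le> real n then f x else 0)" for n x
  have hm [measurable]: "h n \<in> borel_measurable borel" for n unfolding h_def by measurable
  have lim: "(\<lambda>n. h n x) \<longlonglongrightarrow> f x" for x
  proof (rule tendsto_eventually)
    have "\<forall>\<^sub>F n in sequentially. norm x \<le> real n"
      using filterlim_real_sequentially by (simp add: filterlim_at_top)
    then show "\<forall>\<^sub>F n in sequentially. h n x = f x" by eventually_elim (simp add: h_def)
  qed
  have "interact (\<lambda>x. ennreal (f x)) (\<lambda>x. ennreal (f x))
     \<le> liminf (\<lambda>n. interact (\<lambda>x. ennreal (h n x)) (\<lambda>x. ennreal (h n x)))"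
    by (rule interact_le_liminf[OF f hm]) (simp add: lim)
  also have "\<dots> \<le> liminf (\<lambda>n. ennreal (4 * pi\<^sup>2 * (3 * M / (4 * pi)) powr (4 / 3)))"
  proof (intro Liminf_mono always_eventually allI)
    fix n
    have le: "(\<integral>\<^sup>+x. ennreal (h n x) \<partial>lborel) \<le> ennreal M"
      unfolding M(1)[symmetric] using f01 by (intro nn_integral_mono) (auto simp: h_def)
    then obtain m where m: "(\<integral>\<^sup>+x. ennreal (h n x) \<partial>lborel) = ennreal m" "0 \<le> m" "m \<le> M"
      using M(2) by (cases "\<integral>\<^sup>+x. ennreal (h n x) \<partial>lborel") (auto simp: top_unique)
    have "interact (\<lambda>x. ennreal (h n x)) (\<lambda>x. ennreal (h n x)) \<le> ennreal (4 * pi\<^sup>2 * (3 * m / (4 * pi)) powr (4 / 3))"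
      using f01 by (intro interact_le_ball_bounded_support[of _ "real n"] m) (auto simp: h_def)
    also have "\<dots> \<le> ennreal (4 * pi\<^sup>2 * (3 * M / (4 * pi)) powr (4 / 3))"
      using m by (intro ennreal_leI mult_left_mono powr_mono2) (auto intro!: divide_right_mono)
    finally show "interact (\<lambda>x. ennreal (h n x)) (\<lambda>x. ennreal (h n x)) \<le> \<dots>" .
  qed
  also have "\<dots> = ennreal (4 * pi\<^sup>2 * (3 * M / (4 * pi)) powr (4 / 3))"
    by (simp add: Liminf_const)
  finally show ?thesis .
qed

subsection \<open>Spin matrices\<close>

lemma quadratic_form_2:
  fixes A :: spin_matrix
  shows "(\<Sum>i\<in>UNIV. cnj (v $ i) * (A *v v) $ i) =
    cnj (v $ 1) * (A $ 1 $ 1 * v $ 1 + A $ 1 $ 2 * v $ 2) + cnj (v $ 2) * (A $ 2 $ 1 * v $ 1 + A $ 2 $ 2 * v $ 2)"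
  by (simp add: matrix_vector_mult_def sum_2)

lemma hermitian_entries:
  assumes "hermitian A"
  shows "A $ 1 $ 1 = of_real (Re (A $ 1 $ 1))" "A $ 2 $ 2 = of_real (Re (A $ 2 $ 2))" "A $ 2 $ 1 = cnj (A $ 1 $ 2)"
  using assms unfolding hermitian_def by (metis Reals_cnj_iff of_real_Re)+

lemma quadratic_form_hermitian:
  assumes "hermitian A"
  shows "Re (\<Sum>i\<in>UNIV. cnj (v $ i) * (A *v v) $ i) =
    Re (A $ 1 $ 1) * (cmod (v $ 1))\<^sup>2 + Re (A $ 2 $ 2) * (cmod (v $ 2))\<^sup>2 + 2 * Re (cnj (v $ 1) * A $ 1 $ 2 * v $ 2)"
  unfolding quadratic_form_2
  by (subst hermitian_entries(1)[OF assms], subst hermitian_entries(2)[OF assms], subst hermitian_entries(3)[OF assms])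
    (simp only: cmod_power2, simp add: algebra_simps power2_eq_square)

lemma Re_mult_cnj: "Re (z * cnj z) = (cmod z)\<^sup>2"
  by (simp only: complex_norm_square[symmetric] Re_complex_of_real)

text \<open>Nonnegative diagonal and determinant. Necessity uses test vectors proportional to (-t z,
  s); sufficiency is the inequality between arithmetic and geometric mean, with |z| at most sqrt p
  sqrt q.\<close>

lemma pos_semidef_iff:
  "pos_semidef A \<longleftrightarrow> hermitian A \<and> 0 \<le> Re (A $ 1 $ 1) \<and> 0 \<le> Re (A $ 2 $ 2)
     \<and> (cmod (A $ 1 $ 2))\<^sup>2 \<le> Re (A $ 1 $ 1) * Re (A $ 2 $ 2)"
proof (cases "hermitian A")
  case True
  define p q z where "p = Re (A $ 1 $ 1)" and "q = Re (A $ 2 $ 2)" and "z = A $ 1 $ 2"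
  have Q: "pos_semidef A \<longleftrightarrow> (\<forall>v :: complex ^ 2. 0 \<le> p * (cmod (v $ 1))\<^sup>2 + q * (cmod (v $ 2))\<^sup>2 + 2 * Re (cnj (v $ 1) * z * v $ 2))"
    using True unfolding pos_semidef_def p_def q_def z_def by (simp only: quadratic_form_hermitian simp_thms)
  have "pos_semidef A \<longleftrightarrow> 0 \<le> p \<and> 0 \<le> q \<and> (cmod z)\<^sup>2 \<le> p * q"
  proof
    assume "pos_semidef A"
    then have P: "0 \<le> p * (cmod x)\<^sup>2 + q * (cmod y)\<^sup>2 + 2 * Re (cnj x * z * y)" for x y
      using Q[THEN iffD1, rule_format, of "\<chi> i. if i = 1 then x else y"] by simp
    have p: "0 \<le> p" using P[of 1 0] by simp
    have q: "0 \<le> q" using P[of 0 1] by simp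
    have zz: "Re (cnj z * z) = (cmod z)\<^sup>2" by (simp only: mult.commute[of "cnj z"] Re_mult_cnj)
    have ro: "Re (of_real r * w) = r * Re w" for r w by simp
    \<comment> \<open>The first component carries the phase of z, so the mixed term becomes real and
      negative for positive t and s. Below, t = 1 and s = p give the determinant condition when p >
      0.\<close>
    have t: "0 \<le> p * (t\<^sup>2 * (cmod z)\<^sup>2) + q * s\<^sup>2 - 2 * t * s * (cmod z)\<^sup>2" for t s :: real
    proof -
      have "cnj (- of_real t * z) * z * of_real s = of_real (- t * s) * (cnj z * z)" by (simp add: ac_simps)
      then have "Re (cnj (- of_real t * z) * z * of_real s) = - t * s * (cmod z)\<^sup>2"
        by (simp only: ro zz)
      with P[of "- of_real t * z" "of_real s"]
      have "0 \<le> p * (cmod (- of_real t * z))\<^sup>2 + q * (cmod (of_real s))\<^sup>2 + 2 * (- t * s * (cmod z)\<^sup>2)"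
        by (simp only:)
      moreover have "(cmod (- of_real t * z))\<^sup>2 = t\<^sup>2 * (cmod z)\<^sup>2" "(cmod (of_real s))\<^sup>2 = s\<^sup>2"
        by (simp_all add: norm_mult power_mult_distrib)
      ultimately show ?thesis by (simp only:)
    qed
    have "(cmod z)\<^sup>2 \<le> p * q"
    proof (cases "p = 0")
      case True
      have "(cmod z)\<^sup>2 = 0"
      proof (rule ccontr)
        assume "(cmod z)\<^sup>2 \<noteq> 0"
        then have z0: "(cmod z)\<^sup>2 > 0" by simp
        \<comment> \<open>With p = 0 the form is affine in t; this t gives it the value -1.\<close>
        show False using t[of "(q + 1) / (2 * (cmod z)\<^sup>2)" 1] True z0 by (simp add: field_simps)
      qed
      then show ?thesis using True by simp
    next
      case False
      with p have "p > 0" by simp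
      have "0 \<le> p * (1\<^sup>2 * (cmod z)\<^sup>2) + q * p\<^sup>2 - 2 * 1 * p * (cmod z)\<^sup>2" by (rule t)
      also have "\<dots> = p * (p * q - (cmod z)\<^sup>2)" by (simp add: algebra_simps power2_eq_square)
      finally show ?thesis using \<open>p > 0\<close> by (simp add: zero_le_mult_iff)
    qed
    with p q show "0 \<le> p \<and> 0 \<le> q \<and> (cmod z)\<^sup>2 \<le> p * q" by simp
  next
    assume a: "0 \<le> p \<and> 0 \<le> q \<and> (cmod z)\<^sup>2 \<le> p * q"
    have "cmod z \<le> sqrt p * sqrt q" using a by (intro power2_le_imp_le[of "cmod z" "sqrt p * sqrt q"]) (auto simp: power_mult_distrib)
    then have n1: "2 * Re (cnj x * z * y) \<ge> - (2 * (sqrt p * cmod x) * (sqrt q * cmod y))" for x y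
    proof -
      have "\<bar>Re (cnj x * z * y)\<bar> \<le> cmod x * cmod z * cmod y"
        using abs_Re_le_cmod[of "cnj x * z * y"] by (simp add: norm_mult)
      also have "\<dots> \<le> cmod x * (sqrt p * sqrt q) * cmod y"
        using \<open>cmod z \<le> sqrt p * sqrt q\<close> by (intro mult_right_mono mult_left_mono) auto
      finally show ?thesis by (simp add: algebra_simps)
    qed
    have n2: "2 * (sqrt p * s) * (sqrt q * t) \<le> p * s\<^sup>2 + q * t\<^sup>2" for s t
      using sum_squares_bound[of "sqrt p * s" "sqrt q * t"] a by (simp add: power_mult_distrib)
    show "pos_semidef A" unfolding Q
    proof
      fix v :: "complex ^ 2"
      show "0 \<le> p * (cmod (v $ 1))\<^sup>2 + q * (cmod (v $ 2))\<^sup>2 + 2 * Re (cnj (v $ 1) * z * v $ 2)"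
        using n1[of "v $ 1" "v $ 2"] n2[of "cmod (v $ 1)" "cmod (v $ 2)"] by linarith
    qed
  qed
  then show ?thesis using True by (simp add: p_def q_def z_def)
qed (simp add: pos_semidef_def)

section \<open>Bloch coordinates of a spin matrix\<close>

definition occupation :: "spin_matrix \<Rightarrow> real" where
  "occupation A = (Re (A $ 1 $ 1) + Re (A $ 2 $ 2)) / 2"

text \<open>The Bloch vector, that is the coefficients of the traceless part in the Pauli matrices
  up to the sign of one of them. The type \<open>real \<times> complex\<close> serves as Euclidean
  3-space, so that traces of products become inner products.\<close>

definition spin :: "spin_matrix \<Rightarrow> real \<times> complex" where
  "spin A = ((Re (A $ 1 $ 1) - Re (A $ 2 $ 2)) / 2, A $ 1 $ 2)"

lemma Re_trace: "Re (trace A) = 2 * occupation A" for A :: spin_matrix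
  by (simp add: trace_def sum_2 occupation_def)

lemma norm_Pair_square: "(norm (a, b))\<^sup>2 = (norm a)\<^sup>2 + (norm b)\<^sup>2"
  by (simp add: norm_Pair)

lemma norm_spin: "(norm (spin A))\<^sup>2 = (occupation A)\<^sup>2 - (Re (A $ 1 $ 1) * Re (A $ 2 $ 2) - (cmod (A $ 1 $ 2))\<^sup>2)"
  unfolding spin_def norm_Pair_square by (simp add: occupation_def field_simps power2_eq_square)

lemma Re_trace_mult:
  assumes "hermitian A" "hermitian B"
  shows "Re (trace (A ** B)) = 2 * (occupation A * occupation B + spin A \<bullet> spin B)"
proof -
  have "Re (trace (A ** B)) = Re (A $ 1 $ 1 * B $ 1 $ 1 + A $ 1 $ 2 * B $ 2 $ 1 + (A $ 2 $ 1 * B $ 1 $ 2 + A $ 2 $ 2 * B $ 2 $ 2))"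
    by (simp add: trace_def sum_2 matrix_matrix_mult_def)
  also have "\<dots> = Re (A $ 1 $ 1) * Re (B $ 1 $ 1) + Re (A $ 2 $ 2) * Re (B $ 2 $ 2) + 2 * Re (A $ 1 $ 2 * cnj (B $ 1 $ 2))"
    by (subst hermitian_entries(1)[OF assms(1)], subst hermitian_entries(2)[OF assms(1)], subst hermitian_entries(3)[OF assms(1)],
      subst hermitian_entries(3)[OF assms(2)]) simp
  also have "\<dots> = 2 * (occupation A * occupation B + spin A \<bullet> spin B)"
    by (simp add: occupation_def spin_def inner_complex_def field_simps)
  finally show ?thesis .
qed

text \<open>Since |b|^2 = a^2 - det A, the determinant condition for A compares |b| with a, and the
  one for 1 - A compares |b| with 1 - a.\<close>

lemma loewner_bounds_iff:
  assumes A: "hermitian A"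
  shows "loewner_le 0 A \<and> loewner_le A (mat 1) \<longleftrightarrow> norm (spin A) \<le> occupation A \<and> norm (spin A) \<le> 1 - occupation A"
proof -
  define p q z where "p = Re (A $ 1 $ 1)" and "q = Re (A $ 2 $ 2)" and "z = A $ 1 $ 2"
  have h: "hermitian (mat 1 - A)"
    unfolding hermitian_def
  proof (intro allI)
    fix i j
    have "A $ i $ j = cnj (A $ j $ i)" using A unfolding hermitian_def by blast
    moreover have "(mat 1 :: spin_matrix) $ i $ j = cnj (mat 1 $ j $ i)" by (simp add: mat_def)
    ultimately have "(mat 1 - A) $ i $ j = cnj (mat 1 $ j $ i) - cnj (A $ j $ i)"
      by (simp only: vector_minus_component)
    then show "(mat 1 - A) $ i $ j = cnj ((mat 1 - A) $ j $ i)" by (simp only: vector_minus_component complex_cnj_diff)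
  qed
  have 0: "norm (spin A) \<le> c \<longleftrightarrow> 0 \<le> c \<and> (norm (spin A))\<^sup>2 \<le> c\<^sup>2" for c
    by (metis abs_le_square_iff abs_norm_cancel abs_of_nonneg norm_ge_zero order_trans)
  have ns: "(norm (spin A))\<^sup>2 = ((p + q) / 2)\<^sup>2 - (p * q - (cmod z)\<^sup>2)"
    by (simp add: norm_spin occupation_def p_def q_def z_def)
  \<comment> \<open>A nonnegative product means equal signs, and the sign of the sum then decides
    both.\<close>
  have 1: "0 \<le> p \<and> 0 \<le> q \<and> (cmod z)\<^sup>2 \<le> p * q \<longleftrightarrow> 0 \<le> (p + q) / 2 \<and> (cmod z)\<^sup>2 \<le> p * q" for p q
  proof
    assume a: "0 \<le> (p + q) / 2 \<and> (cmod z)\<^sup>2 \<le> p * q"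
    then have "0 \<le> p * q" by (meson order_trans zero_le_power2)
    with a show "0 \<le> p \<and> 0 \<le> q \<and> (cmod z)\<^sup>2 \<le> p * q" by (auto simp: zero_le_mult_iff)
  qed auto
  have "loewner_le 0 A \<longleftrightarrow> 0 \<le> p \<and> 0 \<le> q \<and> (cmod z)\<^sup>2 \<le> p * q"
    using A by (simp add: loewner_le_def pos_semidef_iff p_def q_def z_def)
  also have "\<dots> \<longleftrightarrow> norm (spin A) \<le> occupation A"
    unfolding 1 0 ns by (simp add: occupation_def p_def q_def)
  finally have L: "loewner_le 0 A \<longleftrightarrow> norm (spin A) \<le> occupation A" .
  have "loewner_le A (mat 1) \<longleftrightarrow> 0 \<le> 1 - p \<and> 0 \<le> 1 - q \<and> (cmod z)\<^sup>2 \<le> (1 - p) * (1 - q)"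
    using h by (simp add: loewner_le_def pos_semidef_iff p_def q_def z_def mat_def)
  also have "\<dots> \<longleftrightarrow> norm (spin A) \<le> 1 - occupation A"
  proof -
    have occ: "occupation A = (p + q) / 2" by (simp add: occupation_def p_def q_def)
    have h: "(1 - p + (1 - q)) / 2 = 1 - (p + q) / 2" by (simp add: field_simps)
    have "(1 - (p + q) / 2)\<^sup>2 - (((p + q) / 2)\<^sup>2 - (p * q - (cmod z)\<^sup>2)) = (1 - p) * (1 - q) - (cmod z)\<^sup>2"
      by (simp add: field_simps power2_eq_square)
    then have "(cmod z)\<^sup>2 \<le> (1 - p) * (1 - q) \<longleftrightarrow> ((p + q) / 2)\<^sup>2 - (p * q - (cmod z)\<^sup>2) \<le> (1 - (p + q) / 2)\<^sup>2"
      by (intro iffI; linarith)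
    then show ?thesis unfolding 1 0 ns occ h by simp
  qed
  finally show ?thesis using L by simp
qed

lemma spin_matrix_eqI:
  assumes "hermitian A" "hermitian B" "occupation A = occupation B" "spin A = spin B"
  shows "A = B"
proof -
  have d: "Re (A $ 1 $ 1) = Re (B $ 1 $ 1)" "Re (A $ 2 $ 2) = Re (B $ 2 $ 2)" "A $ 1 $ 2 = B $ 1 $ 2"
    using assms(3,4) by (auto simp: occupation_def spin_def)
  have "A $ 1 $ 1 = B $ 1 $ 1" "A $ 2 $ 2 = B $ 2 $ 2" "A $ 2 $ 1 = B $ 2 $ 1"
    using d hermitian_entries[OF assms(1)] hermitian_entries[OF assms(2)] by metis+
  then have "A $ i $ j = B $ i $ j" for i j
    using exhaust_2[of i] exhaust_2[of j] d(3) by auto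
  then show ?thesis by (simp add: vec_eq_iff)
qed

lemma hermitian_simps [simp]: "hermitian 0" "hermitian (mat 1)" "hermitian (ket_bra \<nu>)"
  by (auto simp: hermitian_def mat_def ket_bra_def)

lemma occupation_simps [simp]:
  "occupation 0 = 0" "occupation (mat 1) = 1" "norm \<nu> = 1 \<Longrightarrow> occupation (ket_bra \<nu>) = 1 / 2"
proof -
  assume "norm \<nu> = 1"
  then have "(cmod (\<nu> $ 1))\<^sup>2 + (cmod (\<nu> $ 2))\<^sup>2 = 1" by (simp add: norm_vec_def L2_set_def sum_2)
  then show "occupation (ket_bra \<nu>) = 1 / 2"
    unfolding occupation_def ket_bra_def vec_lambda_beta Re_mult_cnj by simp
qed (simp_all add: occupation_def mat_def)

lemma spin_simps [simp]: "spin 0 = 0" "spin (mat 1) = 0"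
  by (simp_all add: spin_def mat_def zero_prod_def)

lemma norm_spin_ket_bra:
  assumes "norm \<nu> = 1" shows "norm (spin (ket_bra \<nu>)) = 1 / 2"
proof -
  have "(norm (spin (ket_bra \<nu>)))\<^sup>2 = (1 / 2)\<^sup>2"
    unfolding norm_spin occupation_simps(3)[OF assms]
    unfolding ket_bra_def vec_lambda_beta Re_mult_cnj by (simp add: norm_mult power_mult_distrib)
  then show ?thesis by (simp only: power2_eq_iff_nonneg norm_ge_zero)
qed

text \<open>Every point of the Bloch sphere is a pure state. The vector is (r, cnj z / r) with r^2 =
  1/2 + d; at the south pole d = -1/2 this r vanishes, so the second basis vector is used
  instead.\<close>

lemma ket_bra_of_spin:
  assumes "norm b = 1 / 2"
  obtains \<nu> where "norm \<nu> = 1" "spin (ket_bra \<nu>) = b"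
proof -
  obtain d z where b: "b = (d, z)" by (cases b)
  have n: "d\<^sup>2 + (cmod z)\<^sup>2 = 1 / 4"
  proof -
    have "(norm b)\<^sup>2 = 1 / 4" unfolding assms by (simp add: power2_eq_square)
    then show ?thesis unfolding b norm_Pair_square by simp
  qed
  show ?thesis
  proof (cases "d = - 1 / 2")
    case True
    then have "z = 0" using n by (simp add: power2_eq_square)
    let ?\<nu> = "(\<chi> i. if i = 1 then 0 else 1) :: complex ^ 2"
    show ?thesis
    proof (rule that)
      show "norm ?\<nu> = 1" by (simp add: norm_vec_def L2_set_def sum_2)
      show "spin (ket_bra ?\<nu>) = b" using True \<open>z = 0\<close> by (simp add: spin_def ket_bra_def b)
    qed
  next
    case False
    have "d\<^sup>2 \<le> 1 / 4" using n zero_le_power2[of "cmod z"] by linarith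
    then have "d\<^sup>2 \<le> (1 / 2)\<^sup>2" by (simp add: power_divide)
    then have "\<bar>d\<bar> \<le> 1 / 2" by (metis abs_le_square_iff abs_of_pos half_gt_zero zero_less_one)
    with False have p: "1 / 2 + d > 0" by linarith
    define r where "r = sqrt (1 / 2 + d)"
    have r: "r > 0" "r\<^sup>2 = 1 / 2 + d" using p by (auto simp: r_def)
    have z: "(cmod z)\<^sup>2 = r\<^sup>2 * (1 / 2 - d)" unfolding r(2) using n by (simp add: field_simps power2_eq_square)
    let ?\<nu> = "(\<chi> i. if i = 1 then of_real r else cnj z / of_real r) :: complex ^ 2"
    have c2: "(cmod (cnj z / of_real r))\<^sup>2 = 1 / 2 - d"
      using z r(1) by (simp add: norm_divide power_divide)
    show ?thesis
    proof (rule that)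
      show "norm ?\<nu> = 1" using c2 r by (simp add: norm_vec_def L2_set_def sum_2)
      have "Re (cnj z / of_real r * cnj (cnj z / of_real r)) = 1 / 2 - d"
        by (simp only: Re_mult_cnj c2)
      moreover have "Re (of_real r * cnj (of_real r :: complex)) = 1 / 2 + d" using r(2) by (simp add: power2_eq_square)
      moreover have "of_real r * cnj (cnj z / of_real r) = z" using r(1) by simp
      ultimately show "spin (ket_bra ?\<nu>) = b" by (simp add: spin_def ket_bra_def b)
    qed
  qed
qed

subsection \<open>Energies of balls\<close>

abbreviation cbrt2 :: real where "cbrt2 \<equiv> 2 powr (1 / 3)"

lemma cbrt2: "cbrt2 > 1" "cbrt2 ^ 3 = 2"
  by (simp_all add: powr_third_power)

lemma one_plus_cbrt2_pos: "1 + cbrt2 > 0"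
  using cbrt2(1) by linarith

lemma DERIV_powr_third:
  assumes "x > 0"
  shows "((\<lambda>x. x powr (1 / 3)) has_real_derivative 1 / (3 * (x powr (1 / 3))\<^sup>2)) (at x)"
proof -
  have "((\<lambda>x. x powr (1 / 3)) has_real_derivative (1 / 3) * x powr (1 / 3 - 1)) (at x)"
    by (rule has_real_derivative_powr[OF assms])
  moreover have "x powr (1 / 3 - 1) = 1 / (x powr (1 / 3))\<^sup>2"
  proof -
    have "(x powr (1 / 3))\<^sup>2 = x powr (2 / 3)" using assms by (simp add: powr_third_power)
    moreover have "x powr (1 / 3 - 1) = x powr (- (2 / 3))" by (rule arg_cong[of _ _ "(powr) x"]) simp
    ultimately show ?thesis by (simp add: powr_minus_divide)
  qed
  ultimately show ?thesis by (simp add: field_simps)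
qed

lemma DERIV_powr_third':
  assumes "x < 1"
  shows "((\<lambda>x. (1 - x) powr (1 / 3)) has_real_derivative - 1 / (3 * ((1 - x) powr (1 / 3))\<^sup>2)) (at x)"
proof -
  have "((\<lambda>x. (1 - x) powr (1 / 3)) has_real_derivative 1 / (3 * ((1 - x) powr (1 / 3))\<^sup>2) * (- 1)) (at x)"
  proof (rule DERIV_chain2[where f = "\<lambda>x. x powr (1 / 3)" and g = "\<lambda>x. 1 - x"])
    show "((\<lambda>x. 1 - x) has_real_derivative - 1) (at x)" by (auto intro!: derivative_eq_intros)
  qed (use assms in \<open>intro DERIV_powr_third, simp\<close>)
  then show ?thesis by simp
qed

text \<open>With c = \<open>cbrt2\<close>, passing from x = 1/2 to x = 1 raises the exchange bracket
  by 1 - 1/c and the kinetic bracket by 1 - 1/c^2; the quotient is c / (1 + c).\<close>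

definition chord_slope :: real where "chord_slope = cbrt2 / (1 + cbrt2)"

text \<open>Height of the chord above the curve: the chord value at the kinetic bracket of x minus
  the exchange bracket of x.\<close>

definition chord_gap :: "real \<Rightarrow> real" where
  "chord_gap x = (let p = x powr (1 / 3); q = (1 - x) powr (1 / 3) in
     1 - (p ^ 4 + q ^ 4) - chord_slope * (1 - (p ^ 5 + q ^ 5)))"

lemma chord_slope_pos: "chord_slope > 0"
  unfolding chord_slope_def using one_plus_cbrt2_pos by (intro divide_pos_pos) simp_all

lemma half_powr_third: "(1 / 2) powr (1 / 3) = 1 / cbrt2"
  by (simp add: powr_divide)

lemma powers_inverse_cbrt2: "(1 / cbrt2) ^ 4 = 1 / (2 * cbrt2)" "(1 / cbrt2) ^ 5 = 1 / (2 * cbrt2\<^sup>2)"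
proof -
  have "cbrt2 ^ 4 = 2 * cbrt2" using cbrt2(2) by (simp only: power4_eq_xxxx power3_eq_cube)
  moreover have "cbrt2 ^ 5 = cbrt2 ^ 3 * cbrt2\<^sup>2" by (simp only: power_add[symmetric]) simp
  ultimately show "(1 / cbrt2) ^ 4 = 1 / (2 * cbrt2)" "(1 / cbrt2) ^ 5 = 1 / (2 * cbrt2\<^sup>2)"
    unfolding cbrt2(2) by (simp_all only: power_divide power_one)
qed

lemma chord_gap_ends: "chord_gap 1 = 0" "chord_gap (1 / 2) = 0"
proof -
  define c where "c = cbrt2"
  have c: "c > 1" using cbrt2(1) by (simp add: c_def)
  have "chord_gap (1 / 2) = 1 - 1 / c - c / (1 + c) * (1 - 1 / c\<^sup>2)"
    by (simp add: chord_gap_def Let_def half_powr_third chord_slope_def c_def[symmetric] 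
       powers_inverse_cbrt2[folded c_def, simplified])
  also have "c / (1 + c) * (1 - 1 / c\<^sup>2) = 1 - 1 / c"
  proof -
    have "c * (1 - 1 / c\<^sup>2) = (1 - 1 / c) * (1 + c)" using c by (simp add: field_simps power2_eq_square)
    moreover have "1 + c \<noteq> 0" using c by simp
    ultimately show ?thesis by (simp add: nonzero_divide_eq_eq)
  qed
  finally show "chord_gap (1 / 2) = 0" by simp
qed (simp add: chord_gap_def)

text \<open>The chain rule for p = x^(1/3) and q = (1 - x)^(1/3). Factoring out p - q leaves a sign
  that depends on p + q only.\<close>

lemma chord_gap_derivative_eq:
  fixes p q r :: real
  assumes pq: "p > 0" "q > 0"
  shows "0 - (4 * p ^ 3 * (1 / (3 * p\<^sup>2)) + 4 * q ^ 3 * (- 1 / (3 * q\<^sup>2)))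
    - r * (0 - (5 * p ^ 4 * (1 / (3 * p\<^sup>2)) + 5 * q ^ 4 * (- 1 / (3 * q\<^sup>2))))
    = (p - q) * (5 * r * (p + q) - 4) / 3"
proof -
  have 1: "u ^ 3 * (1 / (3 * u\<^sup>2)) = u / 3" "u ^ 4 * (1 / (3 * u\<^sup>2)) = u * u / 3" if "u > 0" for u :: real
    using that by (simp_all add: power2_eq_square power3_eq_cube power4_eq_xxxx)
  have 2: "4 * u ^ 3 * (1 / (3 * u\<^sup>2)) = 4 * (u / 3)" "5 * u ^ 4 * (1 / (3 * u\<^sup>2)) = 5 * (u * u / 3)"
    "4 * u ^ 3 * (- 1 / (3 * u\<^sup>2)) = - 4 * (u / 3)" "5 * u ^ 4 * (- 1 / (3 * u\<^sup>2)) = - 5 * (u * u / 3)"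
    if "u > 0" for u :: real
    using 1[OF that] by simp_all
  have "(p - q) * (5 * r * (p + q) - 4) = 5 * (r * (p * p)) - 5 * (r * (q * q)) - 4 * p + 4 * q"
    by (simp add: algebra_simps)
  moreover have "r * (0 - (5 * (p * p / 3) + - 5 * (q * q / 3))) = - (5 / 3) * (r * (p * p)) + 5 / 3 * (r * (q * q))"
    by (simp add: algebra_simps)
  ultimately show ?thesis unfolding 2(1,2)[OF pq(1)] 2(3,4)[OF pq(2)] by linarith
qed

text \<open>On \<open>(1/2, 1)\<close> the derivative of the gap has the sign of a strictly decreasing function, and the gap
  vanishes at both ends.\<close>

lemma chord_gap_pos:
  assumes x: "1 / 2 < x" "x < 1"
  shows "0 < chord_gap x"
proof (rule ccontr)
  assume neg: "\<not> 0 < chord_gap x"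
  let ?p = "\<lambda>x :: real. x powr (1 / 3)" and ?q = "\<lambda>x :: real. (1 - x) powr (1 / 3)"
  define d where "d x = (?p x - ?q x) * (5 * chord_slope * (?p x + ?q x) - 4) / 3" for x
  have der: "(chord_gap has_real_derivative d t) (at t)" if "1 / 2 < t" "t < 1" for t
  proof -
    have pq: "?p t > 0" "?q t > 0" using that by auto
    have gen: "((\<lambda>x. 1 - (P x ^ 4 + Q x ^ 4) - r * (1 - (P x ^ 5 + Q x ^ 5))) has_real_derivative
        0 - (4 * P t ^ 3 * P' + 4 * Q t ^ 3 * Q') - r * (0 - (5 * P t ^ 4 * P' + 5 * Q t ^ 4 * Q'))) (at t)"
      if "(P has_real_derivative P') (at t)" "(Q has_real_derivative Q') (at t)" for P Q P' Q' and r :: real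
      using that by (auto intro!: derivative_eq_intros)
    have "((\<lambda>x. 1 - (?p x ^ 4 + ?q x ^ 4) - chord_slope * (1 - (?p x ^ 5 + ?q x ^ 5))) has_real_derivative
        0 - (4 * ?p t ^ 3 * (1 / (3 * (?p t)\<^sup>2)) + 4 * ?q t ^ 3 * (- 1 / (3 * (?q t)\<^sup>2)))
        - chord_slope * (0 - (5 * ?p t ^ 4 * (1 / (3 * (?p t)\<^sup>2)) + 5 * ?q t ^ 4 * (- 1 / (3 * (?q t)\<^sup>2))))) (at t)"
      using that by (intro gen DERIV_powr_third DERIV_powr_third') auto
    also have "0 - (4 * ?p t ^ 3 * (1 / (3 * (?p t)\<^sup>2)) + 4 * ?q t ^ 3 * (- 1 / (3 * (?q t)\<^sup>2)))
        - chord_slope * (0 - (5 * ?p t ^ 4 * (1 / (3 * (?p t)\<^sup>2)) + 5 * ?q t ^ 4 * (- 1 / (3 * (?q t)\<^sup>2)))) = d t"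
    proof -
      show ?thesis unfolding d_def by (rule chord_gap_derivative_eq[OF pq])
    qed
    finally show ?thesis unfolding chord_gap_def Let_def .
  qed
  have cont: "continuous_on {1 / 2..1} chord_gap"
    unfolding chord_gap_def Let_def by (intro continuous_intros continuous_on_powr') auto
  have mvt: "\<exists>z. a < z \<and> z < b \<and> chord_gap b - chord_gap a = (b - a) * d z"
    if ab: "1 / 2 \<le> a" "a < b" "b \<le> 1" for a b
  proof -
    have "continuous_on {a..b} chord_gap" using ab by (intro continuous_on_subset[OF cont]) auto
    moreover have "chord_gap differentiable (at t)" if "a < t" "t < b" for t
      using der[of t] ab that by (auto simp: real_differentiable_def)
    ultimately obtain l z where z: "a < z" "z < b" "DERIV chord_gap z :> l" "chord_gap b - chord_gap a = (b - a) * l"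
      using MVT[OF ab(2)] by blast
    then have "l = d z" using ab der[of z] by (intro DERIV_unique[OF z(3)]) auto
    with z show ?thesis by blast
  qed
  have pq: "?p t > ?q t" if "1 / 2 < t" "t < 1" for t
    using that by (intro powr_less_mono2) auto
  \<comment> \<open>If the gap were nonpositive at x, the mean value theorem would give a
    nonpositive slope at some z1 before x and a nonnegative one at some z2 after it, contradicting
    the strict decrease of p + q.\<close>
  obtain z1 where z1: "1 / 2 < z1" "z1 < x" "chord_gap x - chord_gap (1 / 2) = (x - 1 / 2) * d z1"
    using mvt[of "1 / 2" x] x by auto
  obtain z2 where z2: "x < z2" "z2 < 1" "chord_gap 1 - chord_gap x = (1 - x) * d z2"
    using mvt[of x 1] x by auto
  have "(x - 1 / 2) * d z1 \<le> 0" using z1(3) neg by (simp add: chord_gap_ends)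
  then have "d z1 \<le> 0" using x by (simp add: mult_le_0_iff)
  then have 1: "5 * chord_slope * (?p z1 + ?q z1) - 4 \<le> 0"
    using pq[of z1] z1 x by (simp add: d_def mult_le_0_iff)
  have "(1 - x) * d z2 \<ge> 0" using z2(3) neg by (simp add: chord_gap_ends)
  then have "d z2 \<ge> 0" using x by (simp add: zero_le_mult_iff)
  then have 2: "5 * chord_slope * (?p z2 + ?q z2) - 4 \<ge> 0"
    using pq[of z2] z2 x by (simp add: d_def zero_le_mult_iff)
  have "?p z2 + ?q z2 < ?p z1 + ?q z1"
  proof (rule DERIV_neg_imp_decreasing[where f = "\<lambda>x. ?p x + ?q x"])
    show "z1 < z2" using z1 z2 by simp
    fix t assume t: "z1 \<le> t" "t \<le> z2"
    then have t': "1 / 2 < t" "t < 1" using z1 z2 by auto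
    have "((\<lambda>x. ?p x + ?q x) has_real_derivative 1 / (3 * (?p t)\<^sup>2) + - 1 / (3 * (?q t)\<^sup>2)) (at t)"
      using t' by (intro DERIV_add DERIV_powr_third DERIV_powr_third') auto
    moreover have "1 / (3 * (?p t)\<^sup>2) + - 1 / (3 * (?q t)\<^sup>2) < 0"
    proof -
      have "?q t > 0" using t' by simp
      then have "(?q t)\<^sup>2 < (?p t)\<^sup>2" "0 < (?q t)\<^sup>2" using pq[OF t'] by (auto intro!: power_strict_mono)
      then have "1 / (3 * (?p t)\<^sup>2) < 1 / (3 * (?q t)\<^sup>2)" by (intro divide_strict_left_mono mult_pos_pos) auto
      then show ?thesis by simp
    qed
    ultimately show "\<exists>y. ((\<lambda>x. ?p x + ?q x) has_real_derivative y) (at t) \<and> y < 0" by blast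
  qed
  moreover note chord_slope_pos
  ultimately have "5 * chord_slope * (?p z2 + ?q z2) < 5 * chord_slope * (?p z1 + ?q z1)"
    by (intro mult_strict_left_mono) auto
  with 1 2 show False by linarith
qed

text \<open>Radius of the ball of volume (2 pi)^3 m: the Fermi radius of a single spin component of
  density m.\<close>

definition fermi :: "real \<Rightarrow> real" where "fermi m = (6 * pi\<^sup>2 * m) powr (1 / 3)"

text \<open>Energy of one spin component filling its Fermi ball: the kinetic integral 4 pi F^5 / 5
  and the exchange integral 4 pi^2 F^4 with the prefactors of the functional inserted.\<close>

definition ball_energy :: "real \<Rightarrow> real" where
  "ball_energy m = fermi m ^ 5 / (20 * pi\<^sup>2) - fermi m ^ 4 / (8 * pi ^ 3)"

lemma fermi_nonneg [simp]: "0 \<le> fermi m"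
  by (simp add: fermi_def)

lemma fermi_pos: "m > 0 \<Longrightarrow> 0 < fermi m"
  by (simp add: fermi_def)

lemma fermi_0 [simp]: "fermi 0 = 0"
  by (simp add: fermi_def)

lemma fermi_power3: "m \<ge> 0 \<Longrightarrow> fermi m ^ 3 = 6 * pi\<^sup>2 * m"
  by (simp add: fermi_def powr_third_power)

lemma fermi_mult: "x \<ge> 0 \<Longrightarrow> m \<ge> 0 \<Longrightarrow> fermi (x * m) = x powr (1 / 3) * fermi m"
  by (simp add: fermi_def powr_mult ac_simps)

lemma fermi_half: "m \<ge> 0 \<Longrightarrow> fermi (m / 2) = fermi m / cbrt2"
  using fermi_mult[of "1 / 2" m] by (simp add: half_powr_third)

lemma fermi_eqI:
  assumes "m \<ge> 0" "a \<ge> 0" "a ^ 3 = 6 * pi\<^sup>2 * m" shows "fermi m = a"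
proof (rule power_eq_imp_eq_base)
  show "fermi m ^ 3 = a ^ 3" unfolding fermi_power3[OF assms(1)] assms(3) ..
qed (use assms(2) in simp_all)

lemma fermi_less_iff: "0 \<le> m \<Longrightarrow> 0 \<le> m' \<Longrightarrow> fermi m < fermi m' \<longleftrightarrow> m < m'"
proof -
  assume "0 \<le> m" "0 \<le> m'"
  then have "m < m' \<longleftrightarrow> fermi m ^ 3 < fermi m' ^ 3" by (simp add: fermi_power3)
  also have "\<dots> \<longleftrightarrow> fermi m < fermi m'" by (meson fermi_nonneg power_less_imp_less_base power_strict_mono zero_less_numeral)
  finally show ?thesis ..
qed

lemma rho_c_pos: "0 < rho_c"
  unfolding rho_c_def using one_plus_cbrt2_pos by (intro mult_pos_pos divide_pos_pos zero_less_power) simp_all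

text \<open>The radius at which F^5 / (20 pi^2) is \<open>chord_slope\<close> times F^4 / (8 pi^3),
  so that energy is constant along the chord.\<close>

lemma fermi_rho_c: "fermi rho_c = 5 * chord_slope / (2 * pi)"
proof (rule fermi_eqI)
  define c where "c = cbrt2"
  have c: "c > 1" "c ^ 3 = 2" using cbrt2 by (simp_all add: c_def)
  show "0 \<le> 5 * chord_slope / (2 * pi)" using chord_slope_pos by simp
  show "(5 * chord_slope / (2 * pi)) ^ 3 = 6 * pi\<^sup>2 * rho_c"
  proof -
    have "(5 * chord_slope / (2 * pi)) ^ 3 = 125 * c ^ 3 / (8 * pi ^ 3 * (1 + c) ^ 3)"
      by (simp add: chord_slope_def c_def[symmetric] power_divide power_mult_distrib)
    also have "\<dots> = 6 * pi\<^sup>2 * rho_c"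
    proof -
      define D where "D = (1 + c) ^ 3"
      have D: "D > 0" using c(1) by (simp add: D_def)
      have p5: "pi ^ 5 = pi ^ 3 * pi\<^sup>2" by (simp add: eval_nat_numeral)
      show ?thesis
        unfolding rho_c_def c_def[symmetric] c(2) power_one_over D_def[symmetric] p5 using D by (simp add: field_simps)
    qed
    finally show ?thesis .
  qed
  show "0 \<le> rho_c" using rho_c_pos by (rule less_imp_le)
qed

text \<open>Replace the exchange bracket by its chord value minus the gap. The chord is affine in
  the kinetic bracket, so the latter gets a coefficient with the sign of m - \<open>rho_c\<close>;
  the second term is independent of x, and the gap enters as a penalty.\<close>

lemma ball_energy_split:
  fixes x m :: real
  assumes x: "0 \<le> x" "x \<le> 1" and m: "m \<ge> 0"
  shows "ball_energy (x * m) + ball_energy ((1 - x) * m)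
    = fermi m ^ 4 / (20 * pi\<^sup>2) * (fermi m - fermi rho_c) * ((x powr (1 / 3)) ^ 5 + ((1 - x) powr (1 / 3)) ^ 5)
      - fermi m ^ 4 / (8 * pi ^ 3) * (1 - chord_slope) + fermi m ^ 4 / (8 * pi ^ 3) * chord_gap x"
proof -
  define p where "p = x powr (1 / 3)"
  define q where "q = (1 - x) powr (1 / 3)"
  define F where "F = fermi m"
  define s where "s = chord_slope"
  define a where "a = 1 / (20 * pi\<^sup>2)"
  define b where "b = 1 / (8 * pi ^ 3)"
  have f1: "fermi (x * m) = p * F"
    unfolding p_def F_def using x(1) m by (rule fermi_mult)
  have "0 \<le> 1 - x" using x(2) by simp
  then have f2: "fermi ((1 - x) * m) = q * F"
    unfolding q_def F_def using m by (rule fermi_mult)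
  have k: "F ^ 4 * a * (F - 5 * s / (2 * pi)) = F ^ 5 * a - F ^ 4 * b * s"
  proof -
    have ab: "a * (5 / (2 * pi)) = b" by (simp add: a_def b_def power2_eq_square power3_eq_cube)
    have "F ^ 4 * F = F ^ 5" by (simp add: eval_nat_numeral)
    moreover have "F ^ 4 * a * (F - 5 * s / (2 * pi)) = F ^ 4 * F * a - F ^ 4 * (a * (5 / (2 * pi))) * s"
      by (simp add: right_diff_distrib mult_ac)
    ultimately show ?thesis unfolding ab by simp
  qed
  have d: "y / (20 * pi\<^sup>2) = y * a" "y / (8 * pi ^ 3) = y * b" for y by (simp_all add: a_def b_def)
  show ?thesis
    unfolding ball_energy_def f1 f2 fermi_rho_c chord_gap_def Let_def p_def[symmetric] q_def[symmetric]
      F_def[symmetric] s_def[symmetric] d k power_mult_distrib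
    by (simp add: algebra_simps)
qed

lemma fifth_powers_strict:
  fixes x :: real
  assumes x: "1 / 2 \<le> x" "x < 1"
  shows "(x powr (1 / 3)) ^ 5 + ((1 - x) powr (1 / 3)) ^ 5 < 1"
proof -
  have e: "(y powr (1 / 3)) ^ 5 = y powr (5 / 3)" if "y > 0" for y :: real using that by (simp add: powr_third_power)
  have l: "y powr (5 / 3) < y" if "0 < y" "y < 1" for y :: real
    using powr_less_mono'[of y 1 "5 / 3"] that by simp
  show ?thesis using l[of x] l[of "1 - x"] x by (simp add: e)
qed

text \<open>Convexity of y^(5/3) at the midpoint of x and 1 - x. The case x = 1 is separate because
  convexity is applied on the open half-line.\<close>

lemma fifth_powers_ge:
  fixes x :: real
  assumes x: "1 / 2 \<le> x" "x \<le> 1"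
  shows "1 / cbrt2\<^sup>2 \<le> (x powr (1 / 3)) ^ 5 + ((1 - x) powr (1 / 3)) ^ 5"
proof (cases "x = 1")
  case True
  have "1 \<le> cbrt2\<^sup>2" by (rule one_le_power) (use cbrt2(1) in linarith)
  with True show ?thesis by simp
next
  case False
  have e: "(y powr (1 / 3)) ^ 5 = y powr (5 / 3)" if "y \<ge> 0" for y :: real using that by (simp add: powr_third_power)
  have c: "convex_on {0<..} (\<lambda>y::real. y powr (5 / 3))"
    by (rule powr_convex) simp
  have mid: "(1 - 1 / 2) *\<^sub>R x + (1 / 2) *\<^sub>R (1 - x) = (1 / 2 :: real)" by (simp add: field_simps)
  have "((1 - 1 / 2) *\<^sub>R x + (1 / 2) *\<^sub>R (1 - x)) powr (5 / 3) \<le> (1 - 1 / 2) * x powr (5 / 3) + 1 / 2 * (1 - x) powr (5 / 3)"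
    using x False by (intro convex_onD[OF c]) auto
  moreover have "(1 / 2 :: real) powr (5 / 3) = 1 / (2 * cbrt2\<^sup>2)"
    using e[of "1 / 2"] powers_inverse_cbrt2(2) unfolding half_powr_third by simp
  ultimately have "1 / (2 * cbrt2\<^sup>2) \<le> x powr (5 / 3) / 2 + (1 - x) powr (5 / 3) / 2" unfolding mid by simp
  moreover have "1 / (2 * cbrt2\<^sup>2) = 1 / cbrt2\<^sup>2 / 2" by simp
  ultimately show ?thesis using x e[of x] e[of "1 - x"] by linarith
qed

lemma split_coordinates:
  fixes m1 m2 :: real
  assumes "0 \<le> m2" "m2 \<le> m1" "0 < m1 + m2"
  obtains x where "1 / 2 \<le> x" "x \<le> 1" "m1 = x * (m1 + m2)" "m2 = (1 - x) * (m1 + m2)"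
    "x = 1 \<longleftrightarrow> m2 = 0" "x = 1 / 2 \<longleftrightarrow> m1 = m2"
proof -
  have "m1 = m1 / (m1 + m2) * (m1 + m2) \<and> m2 = (1 - m1 / (m1 + m2)) * (m1 + m2) \<and>
    1 / 2 \<le> m1 / (m1 + m2) \<and> m1 / (m1 + m2) \<le> 1 \<and> (m1 / (m1 + m2) = 1 \<longleftrightarrow> m2 = 0) \<and>
    (m1 / (m1 + m2) = 1 / 2 \<longleftrightarrow> m1 = m2)"
    using assms by (auto simp: field_simps)
  then show ?thesis by (intro that[of "m1 / (m1 + m2)"]) blast+
qed

lemma ball_energy_0 [simp]: "ball_energy 0 = 0"
  by (simp add: ball_energy_def)

lemma ball_energy_ferro:
  assumes "0 < m"
  shows "ball_energy m = fermi m ^ 4 / (20 * pi\<^sup>2) * (fermi m - fermi rho_c)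
      - fermi m ^ 4 / (8 * pi ^ 3) * (1 - chord_slope)"
  using ball_energy_split[of 1 m] assms by (simp add: chord_gap_ends)

lemma ball_energy_para:
  assumes "0 < m"
  shows "2 * ball_energy (m / 2) = fermi m ^ 4 / (20 * pi\<^sup>2) * (fermi m - fermi rho_c) * (1 / cbrt2\<^sup>2)
      - fermi m ^ 4 / (8 * pi ^ 3) * (1 - chord_slope)"
  using ball_energy_split[of "1 / 2" m] assms
  by (simp add: chord_gap_ends half_powr_third powers_inverse_cbrt2[simplified])

text \<open>Below \<open>rho_c\<close> the kinetic bracket has a negative coefficient, so its
  maximum, attained only at x = 1, is favourable; the gap can only add energy.\<close>

lemma ball_energy_ferro_less:
  assumes m: "0 \<le> m2" "m2 \<le> m1" "0 < m1 + m2" and rho: "m1 + m2 < rho_c" and ne: "m2 \<noteq> 0"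
  shows "ball_energy (m1 + m2) < ball_energy m1 + ball_energy m2"
proof -
  obtain x where x: "1 / 2 \<le> x" "x \<le> 1" "m1 = x * (m1 + m2)" "m2 = (1 - x) * (m1 + m2)"
    "x = 1 \<longleftrightarrow> m2 = 0" "x = 1 / 2 \<longleftrightarrow> m1 = m2" using split_coordinates[OF m] .
  let ?m = "m1 + m2"
  let ?A = "(x powr (1 / 3)) ^ 5 + ((1 - x) powr (1 / 3)) ^ 5"
  let ?P = "fermi ?m ^ 4 / (20 * pi\<^sup>2) * (fermi ?m - fermi rho_c)" and ?Q = "fermi ?m ^ 4 / (8 * pi ^ 3)"
  have s: "ball_energy m1 + ball_energy m2 = ?P * ?A
      - ?Q * (1 - chord_slope) + ?Q * chord_gap x"
    using ball_energy_split[of x ?m] x(1,2) m unfolding x(3)[symmetric] x(4)[symmetric] by auto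
  have x1: "x < 1" using x(2,5) ne by auto
  have g: "chord_gap x \<ge> 0"
  proof (cases "x = 1 / 2")
    case True
    then show ?thesis by (simp only: chord_gap_ends)
  next
    case False
    then show ?thesis using chord_gap_pos[of x] x(1) x1 by simp
  qed
  have "fermi ?m < fermi rho_c" using rho m rho_c_pos by (simp add: fermi_less_iff)
  then have n: "?P < 0"
    using fermi_pos[OF m(3)] by (intro mult_pos_neg) auto
  have "?P * 1 < ?P * ?A"
    using n fifth_powers_strict[OF x(1) x1] by (rule mult_strict_left_mono_neg[rotated])
  moreover have "0 \<le> ?Q * chord_gap x" using g by simp
  ultimately show ?thesis unfolding s ball_energy_ferro[OF m(3)] by simp
qed

text \<open>Above \<open>rho_c\<close> the minimum of the kinetic bracket, at x = 1/2, is
  favourable. Strictness comes from the gap when x < 1 and from the kinetic bracket when x = 1,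
  where the gap vanishes.\<close>

lemma ball_energy_para_less:
  assumes m: "0 \<le> m2" "m2 \<le> m1" "0 < m1 + m2" and rho: "rho_c < m1 + m2" and ne: "m1 \<noteq> m2"
  shows "2 * ball_energy ((m1 + m2) / 2) < ball_energy m1 + ball_energy m2"
proof -
  obtain x where x: "1 / 2 \<le> x" "x \<le> 1" "m1 = x * (m1 + m2)" "m2 = (1 - x) * (m1 + m2)"
    "x = 1 \<longleftrightarrow> m2 = 0" "x = 1 / 2 \<longleftrightarrow> m1 = m2" using split_coordinates[OF m] .
  let ?m = "m1 + m2"
  let ?A = "(x powr (1 / 3)) ^ 5 + ((1 - x) powr (1 / 3)) ^ 5"
  let ?P = "fermi ?m ^ 4 / (20 * pi\<^sup>2) * (fermi ?m - fermi rho_c)" and ?Q = "fermi ?m ^ 4 / (8 * pi ^ 3)"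
  have s: "ball_energy m1 + ball_energy m2 = ?P * ?A
      - ?Q * (1 - chord_slope) + ?Q * chord_gap x"
    using ball_energy_split[of x ?m] x(1,2) m unfolding x(3)[symmetric] x(4)[symmetric] by auto
  have x1: "1 / 2 < x" using x(1,6) ne by auto
  have f: "0 < fermi ?m" using fermi_pos[OF m(3)] .
  have "fermi rho_c < fermi ?m" using rho m rho_c_pos by (simp add: fermi_less_iff)
  then have n: "?P > 0" using f by (intro mult_pos_pos) auto
  show ?thesis
  proof (cases "x = 1")
    case True
    have "1 / cbrt2\<^sup>2 < 1" using cbrt2(1) by (simp add: one_less_power)
    then have "?P * (1 / cbrt2\<^sup>2)
        < ?P * 1"
      using n by (rule mult_strict_left_mono)
    then show ?thesis unfolding s ball_energy_para[OF m(3)] by (simp add: True chord_gap_ends)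
  next
    case False
    then have "0 < chord_gap x" using x1 x(2) by (intro chord_gap_pos) auto
    then have "0 < ?Q * chord_gap x" using f by simp
    moreover have "?P * (1 / cbrt2\<^sup>2)
        \<le> ?P * ?A"
      using n fifth_powers_ge[OF x(1,2)] by (intro mult_left_mono) auto
    ultimately show ?thesis unfolding s ball_energy_para[OF m(3)] by simp
  qed
qed

text \<open>At \<open>rho_c\<close> the kinetic coefficient vanishes, and only the gap separates the
  splittings.\<close>

lemma ball_energy_critical_less:
  assumes m: "0 \<le> m2" "m2 \<le> m1" and rho: "m1 + m2 = rho_c" and ne: "m1 \<noteq> m2" "m2 \<noteq> 0"
  shows "ball_energy rho_c < ball_energy m1 + ball_energy m2"
proof -
  have pos: "0 < m1 + m2" using rho rho_c_pos by simp
  obtain x where x: "1 / 2 \<le> x" "x \<le> 1" "m1 = x * (m1 + m2)" "m2 = (1 - x) * (m1 + m2)"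
    "x = 1 \<longleftrightarrow> m2 = 0" "x = 1 / 2 \<longleftrightarrow> m1 = m2" using split_coordinates[OF m pos] .
  have "0 < chord_gap x" using x(1,2,5,6) ne by (intro chord_gap_pos) auto
  then have "0 < fermi rho_c ^ 4 / (8 * pi ^ 3) * chord_gap x" using fermi_pos[OF rho_c_pos] by simp
  moreover have "ball_energy m1 + ball_energy m2 = - (fermi rho_c ^ 4 / (8 * pi ^ 3) * (1 - chord_slope))
      + fermi rho_c ^ 4 / (8 * pi ^ 3) * chord_gap x"
  proof -
    have "m1 = x * rho_c" "m2 = (1 - x) * rho_c" using x(3,4) unfolding rho by simp_all
    then show ?thesis using ball_energy_split[of x rho_c] x(1,2) rho_c_pos by simp
  qed
  ultimately show ?thesis using ball_energy_ferro[OF rho_c_pos] by simp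
qed

lemma ball_energy_critical: "2 * ball_energy (rho_c / 2) = ball_energy rho_c"
  unfolding ball_energy_ferro[OF rho_c_pos] ball_energy_para[OF rho_c_pos] by simp

section \<open>One-sided slopes of the energy at the critical density\<close>

lemma DERIV_fermi:
  assumes "m > 0"
  shows "(fermi has_real_derivative 2 * pi\<^sup>2 / (fermi m)\<^sup>2) (at m)"
proof -
  have "((\<lambda>m. (6 * pi\<^sup>2 * m) powr (1 / 3)) has_real_derivative 1 / (3 * (fermi m)\<^sup>2) * (6 * pi\<^sup>2)) (at m)"
    unfolding fermi_def using assms
    by (intro DERIV_chain2[OF DERIV_powr_third]) (auto intro!: derivative_eq_intros)
  then show ?thesis unfolding fermi_def by simp
qed

text \<open>The chemical potential: a particle added at the Fermi surface has kinetic energy F^2 / 2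
  and exchange energy -F / pi, the boundary potential 2 pi F times 1 / (2 pi^2).\<close>

lemma DERIV_ball_energy:
  assumes "m > 0"
  shows "(ball_energy has_real_derivative (fermi m)\<^sup>2 / 2 - fermi m / pi) (at m)"
proof -
  have f: "fermi m > 0" using assms by (rule fermi_pos)
  let ?f = "2 * pi\<^sup>2 / (fermi m)\<^sup>2"
  have "((\<lambda>m. fermi m ^ 5) has_real_derivative 5 * fermi m ^ 4 * ?f) (at m)"
    using DERIV_power[OF DERIV_fermi[OF assms], of 5] by (simp add: ac_simps)
  moreover have "((\<lambda>m. fermi m ^ 4) has_real_derivative 4 * fermi m ^ 3 * ?f) (at m)"
    using DERIV_power[OF DERIV_fermi[OF assms], of 4] by (simp add: ac_simps)
  ultimately have "(ball_energy has_real_derivative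
      5 * fermi m ^ 4 * ?f / (20 * pi\<^sup>2) - 4 * fermi m ^ 3 * ?f / (8 * pi ^ 3)) (at m)"
    unfolding ball_energy_def[abs_def] by (intro DERIV_diff DERIV_cdivide)
  also have "5 * fermi m ^ 4 * (2 * pi\<^sup>2 / (fermi m)\<^sup>2) / (20 * pi\<^sup>2) - 4 * fermi m ^ 3 * (2 * pi\<^sup>2 / (fermi m)\<^sup>2) / (8 * pi ^ 3)
     = (fermi m)\<^sup>2 / 2 - fermi m / pi"
    using f by (simp add: power2_eq_square power3_eq_cube power4_eq_xxxx)
  finally show ?thesis .
qed

lemma DERIV_ball_energy_half:
  assumes "m > 0"
  shows "((\<lambda>m. 2 * ball_energy (m / 2)) has_real_derivative (fermi (m / 2))\<^sup>2 / 2 - fermi (m / 2) / pi) (at m)"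
proof -
  have h: "((\<lambda>m. ball_energy (m / 2)) has_real_derivative ((fermi (m / 2))\<^sup>2 / 2 - fermi (m / 2) / pi) * (1 / 2)) (at m)"
    using assms by (intro DERIV_chain2[OF DERIV_ball_energy]) (auto intro!: derivative_eq_intros)
  show ?thesis by (rule DERIV_cong[OF DERIV_cmult[OF h, of 2]]) simp
qed

lemma derivative_jump:
  assumes left: "\<And>m. 0 < m \<Longrightarrow> m < rho_c \<Longrightarrow> f m = ball_energy m"
    and right: "\<And>m. rho_c < m \<Longrightarrow> f m = 2 * ball_energy (m / 2)"
    and at: "f rho_c = ball_energy rho_c"
  shows "derivative_jumps_at f rho_c"
proof -
  let ?l = "\<lambda>m. (fermi m)\<^sup>2 / 2 - fermi m / pi"
  have l: "(f has_real_derivative ?l m) (at m)" if "0 < m" "m < rho_c" for m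
  proof (rule has_field_derivative_transform_within_open[OF DERIV_ball_energy[OF that(1)]])
    show "open {0<..<rho_c}" by simp
  qed (use that left in auto)
  have r: "(f has_real_derivative ?l (m / 2)) (at m)" if "rho_c < m" for m
  proof (rule has_field_derivative_transform_within_open[OF DERIV_ball_energy_half])
    show "open {rho_c<..}" by simp
    show "0 < m" using that rho_c_pos by simp
  qed (use that right in auto)
  have evl: "\<forall>\<^sub>F m in at_left rho_c. 0 < m \<and> m < rho_c"
    using rho_c_pos by (auto simp: eventually_at_left)
  have evr: "\<forall>\<^sub>F m in at_right rho_c. rho_c < m"
    by (simp add: eventually_at_right_less)
  have ce: "isCont ball_energy rho_c" by (rule DERIV_isCont[OF DERIV_ball_energy[OF rho_c_pos]])
  have ce2: "isCont (\<lambda>m. 2 * ball_energy (m / 2)) rho_c" by (rule DERIV_isCont[OF DERIV_ball_energy_half[OF rho_c_pos]])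
  have cf: "isCont fermi m" if "m > 0" for m by (rule DERIV_isCont[OF DERIV_fermi[OF that]])
  have "isCont f rho_c"
    unfolding continuous_at filterlim_at_split
  proof
    have "(ball_energy \<longlongrightarrow> f rho_c) (at_left rho_c)"
      using ce unfolding continuous_at filterlim_at_split at by simp
    then show "(f \<longlongrightarrow> f rho_c) (at_left rho_c)"
      by (rule Lim_transform_eventually) (use evl in eventually_elim, simp add: left)
    have "((\<lambda>m. 2 * ball_energy (m / 2)) \<longlongrightarrow> f rho_c) (at_right rho_c)"
      using ce2 unfolding continuous_at filterlim_at_split at ball_energy_critical by simp
    then show "(f \<longlongrightarrow> f rho_c) (at_right rho_c)"
      by (rule Lim_transform_eventually) (use evr in eventually_elim, simp add: right)
  qed
  moreover have "\<forall>\<^sub>F m in at rho_c. f differentiable at m"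
    unfolding eventually_at_split
    using eventually_mono[OF evl, of "\<lambda>m. f differentiable at m"] eventually_mono[OF evr, of "\<lambda>m. f differentiable at m"]
      l r by (auto simp: real_differentiable_def)
  moreover have "(deriv f \<longlongrightarrow> ?l rho_c) (at_left rho_c)"
  proof (rule Lim_transform_eventually)
    have "isCont ?l rho_c" by (auto intro!: continuous_intros cf rho_c_pos)
    then show "(?l \<longlongrightarrow> ?l rho_c) (at_left rho_c)"
      unfolding continuous_at filterlim_at_split by simp
    show "\<forall>\<^sub>F m in at_left rho_c. ?l m = deriv f m"
      using evl by eventually_elim (metis DERIV_imp_deriv l)
  qed
  moreover have "(deriv f \<longlongrightarrow> ?l (rho_c / 2)) (at_right rho_c)"
  proof (rule Lim_transform_eventually)
    have "isCont (\<lambda>m. ?l (m / 2)) rho_c"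
      using rho_c_pos by (auto intro!: continuous_intros isCont_o2[OF _ cf])
    then show "((\<lambda>m. ?l (m / 2)) \<longlongrightarrow> ?l (rho_c / 2)) (at_right rho_c)"
      unfolding continuous_at filterlim_at_split by simp
    show "\<forall>\<^sub>F m in at_right rho_c. ?l (m / 2) = deriv f m"
      using evr by eventually_elim (metis DERIV_imp_deriv r)
  qed
  moreover have "?l rho_c \<noteq> ?l (rho_c / 2)"
  proof -
    define c where "c = cbrt2"
    have c: "c > 1" using cbrt2(1) by (simp add: c_def)
    define R where "R = fermi rho_c"
    have R: "R > 0" using fermi_pos[OF rho_c_pos] by (simp add: R_def)
    have R2: "fermi (rho_c / 2) = R / c" using rho_c_pos by (simp add: fermi_half R_def c_def)
    \<comment> \<open>The two slopes differ by R (1 - 1/c) (R (1 + 1/c) / 2 - 1/pi). The critical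
      radius makes the last factor 5 / (4 pi) - 1/pi = 1 / (4 pi), hence positive.\<close>
    have Rc: "R * (1 + 1 / c) = 5 / (2 * pi)"
    proof -
      have "1 + 1 / c = (1 + c) / c" "1 + c \<noteq> 0" using c by (simp_all add: field_simps)
      then show ?thesis using c by (simp add: R_def fermi_rho_c chord_slope_def c_def[symmetric])
    qed
    have "?l rho_c - ?l (rho_c / 2) = R * (1 - 1 / c) * (R * (1 + 1 / c) / 2 - 1 / pi)"
      unfolding R2 R_def[symmetric] using c by (simp add: field_simps power2_eq_square)
    also have "\<dots> = R * (1 - 1 / c) * (1 / (4 * pi))" unfolding Rc by (simp add: field_simps)
    also have "\<dots> > 0" using R c by simp
    finally show ?thesis by simp
  qed
  ultimately show ?thesis unfolding derivative_jumps_at_def by blast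
qed

subsection \<open>Minimisers\<close>

lemma AE_lebesgue_iff: "(AE x in lebesgue. P x) \<longleftrightarrow> (AE x in lborel. P x)"
  by (rule AE_completion_iff)

text \<open>As g and the ball have equal mass, subtracting R^2 from |x|^2 does not affect the
  difference of kinetic energies, which is the integral of the nonnegative d. Off the null sphere
  |x| = R, d vanishes only where g agrees with the indicator; this supplies all strictness in the
  minimisation.\<close>

lemma ball_kinetic_bathtub:
  fixes g :: "real ^ 3 \<Rightarrow> real"
  assumes g [measurable]: "g \<in> borel_measurable borel" and g01: "\<And>x. 0 \<le> g x" "\<And>x. g x \<le> 1"
    and R: "R \<ge> 0" and mass: "(\<integral>\<^sup>+x. ennreal (g x) \<partial>lborel) = ennreal (4 * pi / 3 * R ^ 3)"
  shows "ennreal (4 * pi * R ^ 5 / 5) \<le> (\<integral>\<^sup>+x. ennreal ((norm x)\<^sup>2 * g x) \<partial>lborel)"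
    and "(\<integral>\<^sup>+x. ennreal ((norm x)\<^sup>2 * g x) \<partial>lborel) = ennreal (4 * pi * R ^ 5 / 5) \<Longrightarrow>
      AE x in lborel. g x = indicator (cball 0 R) x"
proof -
  let ?B = "cball (0 :: real ^ 3) R"
  define d where "d x = ((norm x)\<^sup>2 - R\<^sup>2) * (g x - indicator ?B x)" for x
  have [measurable]: "d \<in> borel_measurable borel" unfolding d_def by measurable
  have d0: "0 \<le> d x" for x
  proof (cases "norm x \<le> R")
    case True
    then have "(norm x)\<^sup>2 \<le> R\<^sup>2" by (intro power_mono) auto
    then show ?thesis unfolding d_def using True g01(2)[of x] by (intro mult_nonpos_nonpos) auto
  next
    case False
    then have "R\<^sup>2 \<le> (norm x)\<^sup>2" using R by (intro power_mono) auto
    then show ?thesis unfolding d_def using False g01(1)[of x] by (intro mult_nonneg_nonneg) auto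
  qed
  have KB: "(\<integral>\<^sup>+x. ennreal ((norm x)\<^sup>2 * indicator ?B x) \<partial>lborel) = ennreal (4 * pi * R ^ 5 / 5)"
  proof -
    have "(\<integral>\<^sup>+x. ennreal ((norm x)\<^sup>2 * indicator ?B x) \<partial>lborel)
        = (\<integral>\<^sup>+x. indicator ?B x * ennreal (norm x ^ Suc 1) \<partial>lborel)"
      by (intro nn_integral_cong) (auto simp: indicator_def power2_eq_square)
    also have "\<dots> = ennreal (4 * pi * R ^ 5 / 5)"
      by (subst nn_integral_norm_power_ball[OF R]) simp
    finally show ?thesis .
  qed
  have RB: "(\<integral>\<^sup>+x. ennreal (R\<^sup>2 * indicator ?B x) \<partial>lborel) = ennreal (R\<^sup>2) * ennreal (4 * pi / 3 * R ^ 3)"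
  proof -
    have "(\<integral>\<^sup>+x. ennreal (R\<^sup>2 * indicator ?B x) \<partial>lborel) = (\<integral>\<^sup>+x. ennreal (R\<^sup>2) * indicator ?B x \<partial>lborel)"
      by (intro nn_integral_cong) (auto simp: indicator_def)
    also have "\<dots> = ennreal (R\<^sup>2) * emeasure lborel ?B" by (rule nn_integral_cmult_indicator) simp
    finally show ?thesis by (simp only: emeasure_cball_3[OF R])
  qed
  have Rg: "(\<integral>\<^sup>+x. ennreal (R\<^sup>2 * g x) \<partial>lborel) = ennreal (R\<^sup>2) * ennreal (4 * pi / 3 * R ^ 3)"
    unfolding mass[symmetric] by (subst nn_integral_cmult[symmetric]) (auto simp: ennreal_mult g01)
  have "(\<integral>\<^sup>+x. ennreal ((norm x)\<^sup>2 * g x) \<partial>lborel) + (\<integral>\<^sup>+x. ennreal (R\<^sup>2 * indicator ?B x) \<partial>lborel)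
      = (\<integral>\<^sup>+x. ennreal ((norm x)\<^sup>2 * g x) + ennreal (R\<^sup>2 * indicator ?B x) \<partial>lborel)"
    by (rule nn_integral_add[symmetric]) measurable
  also have "\<dots> = (\<integral>\<^sup>+x. (ennreal ((norm x)\<^sup>2 * indicator ?B x) + ennreal (d x)) + ennreal (R\<^sup>2 * g x) \<partial>lborel)"
  proof (rule nn_integral_cong)
    fix x :: "real ^ 3"
    have "(norm x)\<^sup>2 * g x + R\<^sup>2 * indicator ?B x = ((norm x)\<^sup>2 * indicator ?B x + d x) + R\<^sup>2 * g x"
      unfolding d_def by (simp add: algebra_simps)
    then show "ennreal ((norm x)\<^sup>2 * g x) + ennreal (R\<^sup>2 * indicator ?B x)
        = (ennreal ((norm x)\<^sup>2 * indicator ?B x) + ennreal (d x)) + ennreal (R\<^sup>2 * g x)"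
      using d0[of x] g01(1)[of x] by (simp flip: ennreal_plus)
  qed
  also have "\<dots> = ((\<integral>\<^sup>+x. ennreal ((norm x)\<^sup>2 * indicator ?B x) \<partial>lborel) + (\<integral>\<^sup>+x. ennreal (d x) \<partial>lborel))
      + (\<integral>\<^sup>+x. ennreal (R\<^sup>2 * g x) \<partial>lborel)"
    by (simp add: nn_integral_add)
  finally have "(ennreal (R\<^sup>2) * ennreal (4 * pi / 3 * R ^ 3)) + (\<integral>\<^sup>+x. ennreal ((norm x)\<^sup>2 * g x) \<partial>lborel)
      = (ennreal (R\<^sup>2) * ennreal (4 * pi / 3 * R ^ 3)) + (ennreal (4 * pi * R ^ 5 / 5) + (\<integral>\<^sup>+x. ennreal (d x) \<partial>lborel))"
    unfolding RB Rg KB by (simp only: ac_simps)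
  moreover have "ennreal (R\<^sup>2) * ennreal (4 * pi / 3 * R ^ 3) \<noteq> top" by (simp add: ennreal_mult_eq_top_iff)
  ultimately have eq: "(\<integral>\<^sup>+x. ennreal ((norm x)\<^sup>2 * g x) \<partial>lborel) = ennreal (4 * pi * R ^ 5 / 5) + (\<integral>\<^sup>+x. ennreal (d x) \<partial>lborel)"
    by (simp add: ennreal_add_left_cancel)
  then show "ennreal (4 * pi * R ^ 5 / 5) \<le> (\<integral>\<^sup>+x. ennreal ((norm x)\<^sup>2 * g x) \<partial>lborel)" by simp
  assume "(\<integral>\<^sup>+x. ennreal ((norm x)\<^sup>2 * g x) \<partial>lborel) = ennreal (4 * pi * R ^ 5 / 5)"
  with eq have "ennreal (4 * pi * R ^ 5 / 5) + (\<integral>\<^sup>+x. ennreal (d x) \<partial>lborel) = ennreal (4 * pi * R ^ 5 / 5) + 0"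
    by simp
  then have "(\<integral>\<^sup>+x. ennreal (d x) \<partial>lborel) = 0" by (simp add: ennreal_add_left_cancel)
  then have "AE x in lborel. d x = 0" using d0 by (auto simp: nn_integral_0_iff_AE antisym)
  then show "AE x in lborel. g x = indicator ?B x"
    using AE_lborel_norm_neq[of R]
  proof eventually_elim
    case (elim x)
    then have "(norm x)\<^sup>2 \<noteq> R\<^sup>2" using R by (simp add: power2_eq_iff_nonneg)
    with elim(1) show ?case by (simp add: d_def)
  qed
qed

section \<open>From matrix-valued states to scalar densities\<close>

lemma borel_measurable_state_component:
  fixes \<gamma> :: state and f :: "spin_matrix \<Rightarrow> real"
  assumes "\<gamma> \<in> borel_measurable lebesgue" "continuous_on UNIV f"
  shows "(\<lambda>k. f (\<gamma> k)) \<in> borel_measurable lebesgue"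
  using assms(1) borel_measurable_continuous_onI[OF assms(2)] by (rule measurable_compose)

text \<open>States are only Lebesgue measurable and constrained almost everywhere. Borel
  representatives are needed for the product integrals; setting them to 0 where the bounds fail
  makes the bounds hold at every point.\<close>

lemma borel_spin_fields:
  assumes adm: "admissible \<rho> \<gamma>"
  obtains a :: "real ^ 3 \<Rightarrow> real" and b :: "real ^ 3 \<Rightarrow> real \<times> complex"
  where "a \<in> borel_measurable borel" "b \<in> borel_measurable borel"
    "\<And>x. norm (b x) \<le> a x" "\<And>x. norm (b x) \<le> 1 - a x"
    "AE x in lborel. hermitian (\<gamma> x) \<and> occupation (\<gamma> x) = a x \<and> spin (\<gamma> x) = b x"
proof -
  have \<gamma>: "\<gamma> \<in> borel_measurable lebesgue" using adm by (simp add: admissible_def)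
  have ex: "\<exists>g\<in>borel_measurable lborel. AE x in lborel. f (\<gamma> x) = g x" if "continuous_on UNIV f" for f :: "spin_matrix \<Rightarrow> real"
    by (rule completion_ex_borel_measurable_real[OF borel_measurable_state_component[OF \<gamma> that]])
  have cont: "continuous_on UNIV (\<lambda>A :: spin_matrix. (Re (A $ 1 $ 1) + Re (A $ 2 $ 2)) / 2)"
    "continuous_on UNIV (\<lambda>A :: spin_matrix. (Re (A $ 1 $ 1) - Re (A $ 2 $ 2)) / 2)"
    "continuous_on UNIV (\<lambda>A :: spin_matrix. Re (A $ 1 $ 2))"
    "continuous_on UNIV (\<lambda>A :: spin_matrix. Im (A $ 1 $ 2))"
    by (intro continuous_intros; simp)+
  obtain a0 where a0: "a0 \<in> borel_measurable lborel" "AE x in lborel. occupation (\<gamma> x) = a0 x"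
    using ex[OF cont(1)] unfolding occupation_def by blast
  obtain d0 where d0: "d0 \<in> borel_measurable lborel" "AE x in lborel. (Re (\<gamma> x $ 1 $ 1) - Re (\<gamma> x $ 2 $ 2)) / 2 = d0 x"
    using ex[OF cont(2)] by blast
  obtain u0 where u0: "u0 \<in> borel_measurable lborel" "AE x in lborel. Re (\<gamma> x $ 1 $ 2) = u0 x"
    using ex[OF cont(3)] by blast
  obtain v0 where v0: "v0 \<in> borel_measurable lborel" "AE x in lborel. Im (\<gamma> x $ 1 $ 2) = v0 x"
    using ex[OF cont(4)] by blast
  define b0 where "b0 x = (d0 x, complex_of_real (u0 x) + \<i> * complex_of_real (v0 x))" for x
  have [measurable]: "a0 \<in> borel_measurable borel" "d0 \<in> borel_measurable borel"
     "u0 \<in> borel_measurable borel" "v0 \<in> borel_measurable borel"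
    using a0 d0 u0 v0 by simp_all
  have [measurable]: "b0 \<in> borel_measurable borel" unfolding b0_def by measurable
  have sp: "AE x in lborel. spin (\<gamma> x) = b0 x"
    using d0(2) u0(2) v0(2)
    by eventually_elim (simp add: spin_def b0_def complex_eq_iff)
  define P where "P x \<longleftrightarrow> norm (b0 x) \<le> a0 x \<and> norm (b0 x) \<le> 1 - a0 x" for x
  have [measurable]: "Measurable.pred borel P" unfolding P_def by measurable
  have "AE k in lborel. hermitian (\<gamma> k) \<and> loewner_le 0 (\<gamma> k) \<and> loewner_le (\<gamma> k) (mat 1)"
    using adm unfolding admissible_def AE_lebesgue_iff by blast
  then have PA: "AE x in lborel. hermitian (\<gamma> x) \<and> P x \<and> occupation (\<gamma> x) = a0 x \<and> spin (\<gamma> x) = b0 x"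
    using a0(2) sp
  proof eventually_elim
    case (elim x)
    then show ?case using loewner_bounds_iff[of "\<gamma> x"] by (simp add: P_def)
  qed
  show ?thesis
  proof (rule that[of "\<lambda>x. if P x then a0 x else 0" "\<lambda>x. if P x then b0 x else 0"])
    show "AE x in lborel. hermitian (\<gamma> x) \<and> occupation (\<gamma> x) = (if P x then a0 x else 0)
        \<and> spin (\<gamma> x) = (if P x then b0 x else 0)"
      using PA by eventually_elim auto
  qed (measurable, auto simp: P_def)
qed

abbreviation hf_prefactor :: real where "hf_prefactor \<equiv> 1 / (2 * (2 * pi) ^ 3)"

lemma kinetic_energy_eq:
  assumes [measurable]: "g1 \<in> borel_measurable borel" "g2 \<in> borel_measurable borel"
    and g0: "\<And>x. 0 \<le> g1 x" "\<And>x. 0 \<le> g2 x"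
    and tr: "AE x in lborel. Re (trace (\<gamma> x)) = g1 x + g2 x"
  shows "kinetic_energy \<gamma> = ennreal hf_prefactor *
    ((\<integral>\<^sup>+x. ennreal ((norm x)\<^sup>2 * g1 x) \<partial>lborel) + (\<integral>\<^sup>+x. ennreal ((norm x)\<^sup>2 * g2 x) \<partial>lborel))"
proof -
  have "(\<integral>\<^sup>+k. ennreal ((norm k)\<^sup>2 * Re (trace (\<gamma> k))) \<partial>lebesgue)
      = (\<integral>\<^sup>+k. ennreal ((norm k)\<^sup>2 * Re (trace (\<gamma> k))) \<partial>lborel)"
    by (rule nn_integral_completion)
  also have "\<dots> = (\<integral>\<^sup>+x. ennreal ((norm x)\<^sup>2 * g1 x) + ennreal ((norm x)\<^sup>2 * g2 x) \<partial>lborel)"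
    by (rule nn_integral_cong_AE, use tr in eventually_elim)
      (simp add: g0 distrib_left flip: ennreal_plus)
  also have "\<dots> = (\<integral>\<^sup>+x. ennreal ((norm x)\<^sup>2 * g1 x) \<partial>lborel) + (\<integral>\<^sup>+x. ennreal ((norm x)\<^sup>2 * g2 x) \<partial>lborel)"
    by (rule nn_integral_add) measurable
  finally show ?thesis unfolding kinetic_energy_def by simp
qed

lemma exchange_energy_eq:
  assumes [measurable]: "(\<lambda>p. t (fst p) (snd p)) \<in> borel_measurable (borel \<Otimes>\<^sub>M borel)"
    and tr: "AE p in lborel \<Otimes>\<^sub>M lborel. Re (trace (\<gamma> (fst p) ** \<gamma> (snd p))) = t (fst p) (snd p)"
    and t0: "\<And>x y. 0 \<le> t x y"
  shows "exchange_energy \<gamma> = ennreal hf_prefactor * (ennreal (1 / (2 * pi\<^sup>2)) *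
    (\<integral>\<^sup>+p. ennreal (t (fst p) (snd p)) * kern (fst p - snd p) \<partial>(lborel \<Otimes>\<^sub>M lborel)))"
proof -
  have "(\<integral>\<^sup>+(k, k'). ennreal (coulomb_w (k - k') * Re (trace (\<gamma> k ** \<gamma> k'))) \<partial>(lebesgue :: ((real ^ 3) \<times> (real ^ 3)) measure))
      = (\<integral>\<^sup>+(k, k'). ennreal (coulomb_w (k - k') * Re (trace (\<gamma> k ** \<gamma> k'))) \<partial>(lborel \<Otimes>\<^sub>M lborel))"
    unfolding lborel_prod by (rule nn_integral_completion)
  also have "\<dots> = (\<integral>\<^sup>+p. ennreal (1 / (2 * pi\<^sup>2)) * (ennreal (t (fst p) (snd p)) * kern (fst p - snd p)) \<partial>(lborel \<Otimes>\<^sub>M lborel))"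
  \<comment> \<open>On the diagonal \<open>coulomb_w\<close> is 0 while \<open>kern\<close> is
    infinite; elsewhere they differ by the factor 1 / (2 pi^2).\<close>
  proof (rule nn_integral_cong_AE, use tr AE_pair_neq in eventually_elim)
    case (elim p)
    have "ennreal (coulomb_w (fst p - snd p) * t (fst p) (snd p))
        = ennreal (1 / (2 * pi\<^sup>2)) * (ennreal (t (fst p) (snd p)) * kern (fst p - snd p))"
      using elim(2) t0[of "fst p" "snd p"]
      by (simp add: kern_eq coulomb_w_def field_simps flip: ennreal_mult)
    then show ?case using elim(1) by (simp add: case_prod_unfold)
  qed
  also have "\<dots> = ennreal (1 / (2 * pi\<^sup>2)) * (\<integral>\<^sup>+p. ennreal (t (fst p) (snd p)) * kern (fst p - snd p) \<partial>(lborel \<Otimes>\<^sub>M lborel))"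
    by (rule nn_integral_cmult) measurable
  finally show ?thesis unfolding exchange_energy_def by simp
qed

lemma ball_energy_eq:
  "hf_prefactor * (4 * pi * fermi m ^ 5 / 5) - hf_prefactor * (1 / (2 * pi\<^sup>2) * (4 * pi\<^sup>2 * fermi m ^ 4)) = ball_energy m"
  by (simp add: ball_energy_def power_mult_distrib field_simps eval_nat_numeral)

lemma fermi_volume: "m \<ge> 0 \<Longrightarrow> 4 * pi / 3 * fermi m ^ 3 = (2 * pi) ^ 3 * m"
  by (subst fermi_power3) (simp_all add: power2_eq_square power3_eq_cube)

lemma c_TF_fermi: 
  assumes "m > 0" shows "c_TF * m powr (2 / 3) = (fermi m)\<^sup>2"
proof -
  have "4 * pi\<^sup>2 = ((2 * pi) ^ 3) powr (2 / 3)"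
  proof -
    have "((2 * pi) ^ 3) powr (2 / 3) = ((2 * pi) powr 3) powr (2 / 3)" by simp
    also have "\<dots> = (2 * pi) powr 2" unfolding powr_powr by simp
    finally show ?thesis by (simp add: power_mult_distrib)
  qed
  then have "c_TF * m powr (2 / 3) = ((2 * pi) ^ 3) powr (2 / 3) * (3 / (4 * pi)) powr (2 / 3) * m powr (2 / 3)"
    by (simp only: c_TF_def)
  also have "\<dots> = ((2 * pi) ^ 3 * (3 / (4 * pi))) powr (2 / 3) * m powr (2 / 3)"
    by (subst powr_mult[symmetric]) simp_all
  also have "\<dots> = ((2 * pi) ^ 3 * (3 / (4 * pi)) * m) powr (2 / 3)"
    using assms by (subst powr_mult[symmetric]) simp_all
  also have "(2 * pi) ^ 3 * (3 / (4 * pi)) * m = 6 * pi\<^sup>2 * m" by (simp add: power2_eq_square power3_eq_cube)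
  also have "(6 * pi\<^sup>2 * m) powr (2 / 3) = (fermi m)\<^sup>2"
    unfolding fermi_def using assms by (subst powr_third_power) auto
  finally show ?thesis .
qed

lemma c_TF_ball:
  assumes "m > 0" shows "(norm k)\<^sup>2 \<le> c_TF * m powr (2 / 3) \<longleftrightarrow> k \<in> cball 0 (fermi m)"
  unfolding c_TF_fermi[OF assms] by (simp add: power_mono_iff)

section \<open>Energies of the ferromagnetic and paramagnetic states\<close>

lemma ereal_diff_ennreal:
  assumes "0 \<le> k" "0 \<le> e"
  shows "enn2ereal (ennreal k) - enn2ereal (ennreal e) = ereal (k - e)"
  using assms by simp

lemma ennreal_mult_mult:
  "0 \<le> a \<Longrightarrow> 0 \<le> b \<Longrightarrow> 0 \<le> c \<Longrightarrow> ennreal a * (ennreal b * ennreal c) = ennreal (a * (b * c))"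
  by (simp add: ennreal_mult)

text \<open>The weight w counts filled spin components: 1 for a rank-one projection, 2 for the
  identity. It multiplies both traces, and m is the density per component.\<close>

lemma HF_energy_ball_state:
  assumes m: "m > 0" and w: "w > 0"
    and tr: "AE x in lborel. Re (trace (\<gamma> x)) = w * indicator (cball 0 (fermi m)) x"
    and tr2: "AE p in lborel \<Otimes>\<^sub>M lborel. Re (trace (\<gamma> (fst p) ** \<gamma> (snd p)))
      = w * (indicator (cball 0 (fermi m)) (fst p) * indicator (cball 0 (fermi m)) (snd p))"
  shows "HF_energy \<gamma> = ereal (w * ball_energy m)"
proof -
  let ?B = "cball (0 :: real ^ 3) (fermi m)"
  have K: "(\<integral>\<^sup>+x. ennreal ((norm x)\<^sup>2 * (w * indicator ?B x)) \<partial>lborel) = ennreal (w * (4 * pi * fermi m ^ 5 / 5))"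
  proof -
    have "(\<integral>\<^sup>+x. ennreal ((norm x)\<^sup>2 * (w * indicator ?B x)) \<partial>lborel)
        = (\<integral>\<^sup>+x. ennreal w * (indicator ?B x * ennreal (norm x ^ Suc 1)) \<partial>lborel)"
      using w by (intro nn_integral_cong) (auto simp: indicator_def power2_eq_square mult_ac simp flip: ennreal_mult)
    also have "\<dots> = ennreal w * ennreal (4 * pi * fermi m ^ (1 + 4) / (real 1 + 4))"
      by (subst nn_integral_cmult, measurable, subst nn_integral_norm_power_ball) simp_all
    also have "\<dots> = ennreal (w * (4 * pi * fermi m ^ 5 / 5))"
      using w by (simp flip: ennreal_mult)
    finally show ?thesis .
  qed
  have "kinetic_energy \<gamma> = ennreal hf_prefactor * (ennreal (w * (4 * pi * fermi m ^ 5 / 5)) + 0)"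
    using w tr by (subst kinetic_energy_eq[of "\<lambda>x. w * indicator ?B x" "\<lambda>_. 0"]) (simp_all add: K)
  also have "\<dots> = ennreal (hf_prefactor * (w * (4 * pi * fermi m ^ 5 / 5)))"
    using w unfolding add_0_right by (intro ennreal_mult[symmetric]) simp_all
  finally have kin: "kinetic_energy \<gamma> = ennreal (hf_prefactor * (w * (4 * pi * fermi m ^ 5 / 5)))" .
  have X: "(\<integral>\<^sup>+p. ennreal (w * (indicator ?B (fst p) * indicator ?B (snd p))) * kern (fst p - snd p) \<partial>(lborel \<Otimes>\<^sub>M lborel))
      = ennreal (w * (4 * pi\<^sup>2 * fermi m ^ 4))"
  proof -
    have "(\<integral>\<^sup>+p. ennreal (w * (indicator ?B (fst p) * indicator ?B (snd p))) * kern (fst p - snd p) \<partial>(lborel \<Otimes>\<^sub>M lborel))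
      = (\<integral>\<^sup>+p. ennreal w * (indicator ?B (fst p) * indicator ?B (snd p) * kern (fst p - snd p)) \<partial>(lborel \<Otimes>\<^sub>M lborel))"
      using w by (intro nn_integral_cong) (auto simp: indicator_def)
    also have "\<dots> = ennreal w * interact (indicator ?B) (indicator ?B)"
      by (subst nn_integral_cmult, measurable, subst interact_pair) simp_all
    also have "\<dots> = ennreal w * ennreal (4 * pi\<^sup>2 * fermi m ^ 4)" by (simp only: interact_ball[OF fermi_nonneg])
    also have "\<dots> = ennreal (w * (4 * pi\<^sup>2 * fermi m ^ 4))" using w by (simp flip: ennreal_mult)
    finally show ?thesis .
  qed
  have "exchange_energy \<gamma> = ennreal hf_prefactor * (ennreal (1 / (2 * pi\<^sup>2)) * ennreal (w * (4 * pi\<^sup>2 * fermi m ^ 4)))"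
  proof -
    have "(\<lambda>p :: (real ^ 3) \<times> (real ^ 3). w * (indicator ?B (fst p) * indicator ?B (snd p)))
        \<in> borel_measurable (borel \<Otimes>\<^sub>M borel)" by measurable
    from exchange_energy_eq[where t = "\<lambda>x y. w * (indicator ?B x * indicator ?B y)", OF this tr2]
    show ?thesis unfolding X using w by simp
  qed
  also have "\<dots> = ennreal (hf_prefactor * (1 / (2 * pi\<^sup>2) * (w * (4 * pi\<^sup>2 * fermi m ^ 4))))"
    using w by (intro ennreal_mult_mult) simp_all
  finally have ex: "exchange_energy \<gamma> = ennreal (hf_prefactor * (1 / (2 * pi\<^sup>2) * (w * (4 * pi\<^sup>2 * fermi m ^ 4))))" .
  have "HF_energy \<gamma> = ereal (hf_prefactor * (w * (4 * pi * fermi m ^ 5 / 5)) - hf_prefactor * (1 / (2 * pi\<^sup>2) * (w * (4 * pi\<^sup>2 * fermi m ^ 4))))"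
    unfolding HF_energy_def kin ex using w by (intro ereal_diff_ennreal) simp_all
  also have "hf_prefactor * (w * (4 * pi * fermi m ^ 5 / 5)) - hf_prefactor * (1 / (2 * pi\<^sup>2) * (w * (4 * pi\<^sup>2 * fermi m ^ 4)))
     = w * (hf_prefactor * (4 * pi * fermi m ^ 5 / 5) - hf_prefactor * (1 / (2 * pi\<^sup>2) * (4 * pi\<^sup>2 * fermi m ^ 4)))"
    by (simp only: right_diff_distrib mult_ac)
  finally show ?thesis unfolding ball_energy_eq .
qed

lemma admissible_ball_state:
  assumes m: "m > 0" and w: "w > 0"
    and meas: "\<gamma> \<in> borel_measurable lebesgue"
    and bnd: "AE x in lborel. hermitian (\<gamma> x) \<and> loewner_le 0 (\<gamma> x) \<and> loewner_le (\<gamma> x) (mat 1)"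
    and tr: "AE x in lborel. Re (trace (\<gamma> x)) = w * indicator (cball 0 (fermi m)) x"
  shows "admissible (w * m) \<gamma>"
proof -
  let ?B = "cball (0 :: real ^ 3) (fermi m)"
  have c: "measure lborel ?B = (2 * pi) ^ 3 * m"
    unfolding measure_def emeasure_cball_3[OF fermi_nonneg] fermi_volume[OF less_imp_le[OF m]] using m by simp
  have i: "integrable lborel (\<lambda>x. w * indicator ?B x)" "(\<integral>x. w * indicator ?B x \<partial>lborel) = w * ((2 * pi) ^ 3 * m)"
    using emeasure_lborel_cball_finite[of "0 :: real ^ 3" "fermi m"] by (simp_all add: c)
  have [measurable]: "(\<lambda>x. Re (trace (\<gamma> x))) \<in> borel_measurable lebesgue"
    unfolding trace_def by (rule borel_measurable_state_component[OF meas]) (intro continuous_intros)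
  have tr': "AE x in lebesgue. w * indicator ?B x = Re (trace (\<gamma> x))"
    using tr unfolding AE_lebesgue_iff by eventually_elim simp
  have m1: "(\<lambda>x. w * indicator ?B x) \<in> borel_measurable lborel" by measurable
  have m2: "(\<lambda>x. w * indicator ?B x) \<in> borel_measurable lebesgue" using m1 by (rule measurable_completion)
  have "integrable lebesgue (\<lambda>x. w * indicator ?B x)" using i(1) m1 by (simp add: integrable_completion)
  then have I1: "integrable lebesgue (\<lambda>x. Re (trace (\<gamma> x)))"
    by (rule integrable_cong_AE_imp) (use tr' in auto)
  have "(\<integral>x. Re (trace (\<gamma> x)) \<partial>lebesgue) = (\<integral>x. w * indicator ?B x \<partial>lebesgue)"
    by (rule integral_cong_AE) (use tr' m2 in auto)
  also have "\<dots> = w * ((2 * pi) ^ 3 * m)" unfolding integral_completion[OF m1] by (rule i(2))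
  finally have I2: "(\<integral>x. Re (trace (\<gamma> x)) \<partial>lebesgue) = w * ((2 * pi) ^ 3 * m)" .
  show ?thesis
    unfolding admissible_def AE_lebesgue_iff I2 using meas bnd I1 by simp
qed

lemma ferromagnetic_energy:
  assumes m: "m > 0" and f: "ferromagnetic m \<gamma>"
  shows "admissible m \<gamma>" "HF_energy \<gamma> = ereal (ball_energy m)"
proof -
  let ?B = "cball (0 :: real ^ 3) (fermi m)"
  obtain \<nu> where \<nu>: "norm \<nu> = 1" "AE k in lebesgue. \<gamma> k = gamma_ferro m \<nu> k"
    using f by (auto simp: ferromagnetic_def)
  have g: "gamma_ferro m \<nu> k = (if k \<in> ?B then ket_bra \<nu> else 0)" for k
    unfolding gamma_ferro_def c_TF_ball[OF m] ..
  have "gamma_ferro m \<nu> \<in> borel_measurable lborel" unfolding g[abs_def] by measurable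
  then have "gamma_ferro m \<nu> \<in> borel_measurable lebesgue" by (rule measurable_completion)
  then have meas: "\<gamma> \<in> borel_measurable lebesgue"
    by (rule borel_measurable_AE) (use \<nu>(2) in \<open>auto elim: eventually_mono\<close>)
  have AE: "AE k in lborel. \<gamma> k = (if k \<in> ?B then ket_bra \<nu> else 0)"
    using \<nu>(2) unfolding AE_lebesgue_iff g .
  have t: "Re (trace (\<gamma> k)) = 1 * indicator ?B k" if "\<gamma> k = (if k \<in> ?B then ket_bra \<nu> else 0)" for k
    unfolding that Re_trace using \<nu>(1) by (auto simp: indicator_def)
  have tr: "AE x in lborel. Re (trace (\<gamma> x)) = 1 * indicator ?B x"
    using AE by eventually_elim (rule t)
  have bnd: "AE x in lborel. hermitian (\<gamma> x) \<and> loewner_le 0 (\<gamma> x) \<and> loewner_le (\<gamma> x) (mat 1)"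
    using AE
  proof eventually_elim
    case (elim k)
    then have h: "hermitian (\<gamma> k)" by auto
    show ?case unfolding loewner_bounds_iff[OF h] using h \<nu>(1) by (auto simp: elim norm_spin_ket_bra)
  qed
  show "admissible m \<gamma>" using admissible_ball_state[OF m zero_less_one meas bnd tr] by simp
  have tr2: "AE p in lborel \<Otimes>\<^sub>M lborel. Re (trace (\<gamma> (fst p) ** \<gamma> (snd p)))
      = 1 * (indicator ?B (fst p) * indicator ?B (snd p))"
    using AE_pair_both[OF AE]
  proof eventually_elim
    case (elim p)
    have n: "spin (ket_bra \<nu>) \<bullet> spin (ket_bra \<nu>) = 1 / 4"
      unfolding dot_square_norm norm_spin_ket_bra[OF \<nu>(1)] by (simp add: power2_eq_square)
    show ?case using elim \<nu>(1) by (subst Re_trace_mult) (auto simp: n)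
  qed
  show "HF_energy \<gamma> = ereal (ball_energy m)" using HF_energy_ball_state[OF m zero_less_one tr tr2] by simp
qed

lemma paramagnetic_energy:
  assumes m: "m > 0" and f: "paramagnetic m \<gamma>"
  shows "admissible m \<gamma>" "HF_energy \<gamma> = ereal (2 * ball_energy (m / 2))"
proof -
  let ?B = "cball (0 :: real ^ 3) (fermi (m / 2))"
  have m2: "m / 2 > 0" using m by simp
  have g: "gamma_para m k = (if k \<in> ?B then mat 1 else 0)" for k
    unfolding gamma_para_def c_TF_ball[OF m2] ..
  have "gamma_para m \<in> borel_measurable lborel" unfolding g[abs_def] by measurable
  then have "gamma_para m \<in> borel_measurable lebesgue" by (rule measurable_completion)
  then have meas: "\<gamma> \<in> borel_measurable lebesgue"
    by (rule borel_measurable_AE) (use f in \<open>auto simp: paramagnetic_def elim: eventually_mono\<close>)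
  have AE: "AE k in lborel. \<gamma> k = (if k \<in> ?B then mat 1 else 0)"
    using f unfolding paramagnetic_def AE_lebesgue_iff g .
  have t: "Re (trace (\<gamma> k)) = 2 * indicator ?B k" if "\<gamma> k = (if k \<in> ?B then mat 1 else 0)" for k
    unfolding that Re_trace by (auto simp: indicator_def)
  have tr: "AE x in lborel. Re (trace (\<gamma> x)) = 2 * indicator ?B x"
    using AE by eventually_elim (rule t)
  have bnd: "AE x in lborel. hermitian (\<gamma> x) \<and> loewner_le 0 (\<gamma> x) \<and> loewner_le (\<gamma> x) (mat 1)"
    using AE
  proof eventually_elim
    case (elim k)
    then have h: "hermitian (\<gamma> k)" by auto
    show ?case unfolding loewner_bounds_iff[OF h] using h by (auto simp: elim)
  qed
  show "admissible m \<gamma>" using admissible_ball_state[OF m2 zero_less_numeral meas bnd tr] by simp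
  have tr2: "AE p in lborel \<Otimes>\<^sub>M lborel. Re (trace (\<gamma> (fst p) ** \<gamma> (snd p)))
      = 2 * (indicator ?B (fst p) * indicator ?B (snd p))"
    using AE_pair_both[OF AE]
  proof eventually_elim
    case (elim p)
    show ?case using elim by (subst Re_trace_mult) auto
  qed
  show "HF_energy \<gamma> = ereal (2 * ball_energy (m / 2))" using HF_energy_ball_state[OF m2 zero_less_numeral tr tr2] .
qed

text \<open>Here \<open>m1\<close> and \<open>m2\<close> are the densities carried by the larger and
  the smaller eigenvalue. Equality is analysed only for equal masses and for \<open>m2 = 0\<close>,
  the two splittings that can be optimal.\<close>

lemma HF_energy_lower_bound:
  assumes adm: "admissible \<rho> \<gamma>" and rho: "\<rho> > 0"
  obtains m1 m2 where "0 \<le> m2" "m2 \<le> m1" "m1 + m2 = \<rho>"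
    "ereal (ball_energy m1 + ball_energy m2) \<le> HF_energy \<gamma>"
    "HF_energy \<gamma> = ereal (ball_energy m1 + ball_energy m2) \<Longrightarrow> m1 = m2 \<Longrightarrow> paramagnetic \<rho> \<gamma>"
    "HF_energy \<gamma> = ereal (ball_energy m1 + ball_energy m2) \<Longrightarrow> m2 = 0 \<Longrightarrow> ferromagnetic \<rho> \<gamma>"
proof -
  obtain a :: "real ^ 3 \<Rightarrow> real" and b :: "real ^ 3 \<Rightarrow> real \<times> complex"
    where [measurable]: "a \<in> borel_measurable borel" "b \<in> borel_measurable borel"
      and ab: "\<And>x. norm (b x) \<le> a x" "\<And>x. norm (b x) \<le> 1 - a x"
      and st: "AE x in lborel. hermitian (\<gamma> x) \<and> occupation (\<gamma> x) = a x \<and> spin (\<gamma> x) = b x"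
    using borel_spin_fields[OF adm] by blast
  define g1 g2 where "g1 x = a x + norm (b x)" and "g2 x = a x - norm (b x)" for x
  have [measurable]: "g1 \<in> borel_measurable borel" "g2 \<in> borel_measurable borel"
    unfolding g1_def g2_def by measurable
  have g0: "0 \<le> g1 x" "0 \<le> g2 x" "g1 x \<le> 1" "g2 x \<le> 1" "g2 x \<le> g1 x" for x
    using ab[of x] norm_ge_zero[of "b x"] unfolding g1_def g2_def by linarith+
  have tr: "AE x in lborel. Re (trace (\<gamma> x)) = g1 x + g2 x"
    using st by eventually_elim (simp add: Re_trace g1_def g2_def)
  have mass: "(\<integral>\<^sup>+x. ennreal (g1 x) \<partial>lborel) + (\<integral>\<^sup>+x. ennreal (g2 x) \<partial>lborel) = ennreal ((2 * pi) ^ 3 * \<rho>)"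
  proof -
    have "(\<integral>\<^sup>+x. ennreal (g1 x) \<partial>lborel) + (\<integral>\<^sup>+x. ennreal (g2 x) \<partial>lborel) = (\<integral>\<^sup>+x. ennreal (g1 x) + ennreal (g2 x) \<partial>lborel)"
      by (rule nn_integral_add[symmetric]) measurable
    also have "\<dots> = (\<integral>\<^sup>+x. ennreal (Re (trace (\<gamma> x))) \<partial>lborel)"
      by (rule nn_integral_cong_AE, use tr in eventually_elim) (simp add: g0 flip: ennreal_plus)
    also have "\<dots> = (\<integral>\<^sup>+x. ennreal (Re (trace (\<gamma> x))) \<partial>lebesgue)" by (rule nn_integral_completion[symmetric])
    also have "\<dots> = ennreal (\<integral>x. Re (trace (\<gamma> x)) \<partial>lebesgue)"
    proof (rule nn_integral_eq_integral)
      show "integrable lebesgue (\<lambda>x. Re (trace (\<gamma> x)))" using adm by (simp add: admissible_def)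
      show "AE x in lebesgue. 0 \<le> Re (trace (\<gamma> x))"
        unfolding AE_lebesgue_iff using tr by eventually_elim (simp add: g0)
    qed
    also have "(\<integral>x. Re (trace (\<gamma> x)) \<partial>lebesgue) = (2 * pi) ^ 3 * \<rho>"
    proof -
      have "1 / (2 * pi) ^ 3 * (\<integral>x. Re (trace (\<gamma> x)) \<partial>lebesgue) = \<rho>" using adm by (simp only: admissible_def)
      then show ?thesis by (simp add: field_simps)
    qed
    finally show ?thesis .
  qed
  define m1 where "m1 = enn2real (\<integral>\<^sup>+x. ennreal (g1 x) \<partial>lborel) / (2 * pi) ^ 3"
  define m2 where "m2 = enn2real (\<integral>\<^sup>+x. ennreal (g2 x) \<partial>lborel) / (2 * pi) ^ 3"
  have fin: "(\<integral>\<^sup>+x. ennreal (g1 x) \<partial>lborel) < top" "(\<integral>\<^sup>+x. ennreal (g2 x) \<partial>lborel) < top"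
    using mass by (metis ennreal_add_eq_top ennreal_neq_top less_top)+
  have m0: "0 \<le> m1" "0 \<le> m2" by (simp_all add: m1_def m2_def)
  let ?x1 = "4 * pi\<^sup>2 * fermi m1 ^ 4" and ?x2 = "4 * pi\<^sup>2 * fermi m2 ^ 4"
  let ?q1 = "4 * pi * fermi m1 ^ 5 / 5" and ?q2 = "4 * pi * fermi m2 ^ 5 / 5"
  let ?c = hf_prefactor and ?L = "lborel \<Otimes>\<^sub>M (lborel :: (real ^ 3) measure)"
  let ?k = "\<lambda>p :: (real ^ 3) \<times> (real ^ 3). kern (fst p - snd p)"
  have M: "(\<integral>\<^sup>+x. ennreal (g1 x) \<partial>lborel) = ennreal ((2 * pi) ^ 3 * m1)" "(\<integral>\<^sup>+x. ennreal (g2 x) \<partial>lborel) = ennreal ((2 * pi) ^ 3 * m2)"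
    using fin by (simp_all add: m1_def m2_def)
  have sum: "m1 + m2 = \<rho>"
  proof -
    have "ennreal ((2 * pi) ^ 3 * m1 + (2 * pi) ^ 3 * m2) = ennreal ((2 * pi) ^ 3 * \<rho>)"
      using mass m0 unfolding M by (simp add: ennreal_plus)
    then have "(2 * pi) ^ 3 * m1 + (2 * pi) ^ 3 * m2 = (2 * pi) ^ 3 * \<rho>"
      using m0 rho by (subst (asm) ennreal_inj) auto
    then have "(2 * pi) ^ 3 * (m1 + m2) = (2 * pi) ^ 3 * \<rho>" by (simp only: distrib_left)
    then show ?thesis by simp
  qed
  have le: "m2 \<le> m1"
  proof -
    have "(\<integral>\<^sup>+x. ennreal (g2 x) \<partial>lborel) \<le> (\<integral>\<^sup>+x. ennreal (g1 x) \<partial>lborel)"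
      by (intro nn_integral_mono ennreal_leI g0)
    then have "(2 * pi) ^ 3 * m2 \<le> (2 * pi) ^ 3 * m1" unfolding M using m0 by (subst (asm) ennreal_le_iff) auto
    then show ?thesis by simp
  qed
  let ?K = "\<lambda>g. \<integral>\<^sup>+x. ennreal ((norm x)\<^sup>2 * g x) \<partial>(lborel :: (real ^ 3) measure)"
  let ?I = "\<lambda>g :: real ^ 3 \<Rightarrow> real. interact (\<lambda>x. ennreal (g x)) (\<lambda>x. ennreal (g x))"
  have vol: "(\<integral>\<^sup>+x. ennreal (g1 x) \<partial>lborel) = ennreal (4 * pi / 3 * fermi m1 ^ 3)"
     "(\<integral>\<^sup>+x. ennreal (g2 x) \<partial>lborel) = ennreal (4 * pi / 3 * fermi m2 ^ 3)"
    unfolding M fermi_volume[OF m0(1)] fermi_volume[OF m0(2)] by simp_all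
  have K1: "ennreal (?q1) \<le> ?K g1" "?K g1 = ennreal (?q1) \<Longrightarrow> AE x in lborel. g1 x = indicator (cball 0 (fermi m1)) x"
    using ball_kinetic_bathtub[of g1 "fermi m1"] g0 vol by auto
  have K2: "ennreal (?q2) \<le> ?K g2" "?K g2 = ennreal (?q2) \<Longrightarrow> AE x in lborel. g2 x = indicator (cball 0 (fermi m2)) x"
    using ball_kinetic_bathtub[of g2 "fermi m2"] g0 vol by auto
  have ball4: "(3 * ((2 * pi) ^ 3 * m) / (4 * pi)) powr (4 / 3) = fermi m ^ 4" if "m \<ge> 0" for m
  proof -
    have "3 * ((2 * pi) ^ 3 * m) / (4 * pi) = 6 * pi\<^sup>2 * m" by (simp add: power2_eq_square power3_eq_cube)
    then show ?thesis using that by (simp add: fermi_def powr_third_power)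
  qed
  have I1: "?I g1 \<le> ennreal (?x1)"
    using interact_le_ball[of g1 "(2 * pi) ^ 3 * m1"] g0 M m0 unfolding ball4[OF m0(1)] by simp
  have I2: "?I g2 \<le> ennreal (?x2)"
    using interact_le_ball[of g2 "(2 * pi) ^ 3 * m2"] g0 M m0 unfolding ball4[OF m0(2)] by simp
  define t where "t x y = 2 * (a x * a y + b x \<bullet> b y)" for x y
  \<comment> \<open>The Cauchy-Schwarz deficit of the two spin vectors. It is added to the trace
    \<open>t\<close> instead of being subtracted from the eigenvalue products, so every integral
    stays in \<open>ennreal\<close>; equality in the exchange bound will mean that its integral is
    0.\<close>
  define s where "s x y = 2 * (norm (b x) * norm (b y) - b x \<bullet> b y)" for x y
  have s0: "0 \<le> s x y" for x y using norm_cauchy_schwarz[of "b x" "b y"] by (simp add: s_def)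
  have t0: "0 \<le> t x y" for x y
  proof -
    have "- (b x \<bullet> b y) \<le> norm (b x) * norm (b y)" using norm_cauchy_schwarz[of "- b x" "b y"] by simp
    also have "\<dots> \<le> a x * a y" using ab order_trans[OF norm_ge_zero ab(1)] by (intro mult_mono) auto
    finally show ?thesis by (simp add: t_def)
  qed
  have [measurable]: "(\<lambda>p. t (fst p) (snd p)) \<in> borel_measurable (borel \<Otimes>\<^sub>M borel)"
     "(\<lambda>p. s (fst p) (snd p)) \<in> borel_measurable (borel \<Otimes>\<^sub>M borel)"
    unfolding t_def s_def by measurable
  let ?X = "\<integral>\<^sup>+p. ennreal (t (fst p) (snd p)) * ?k p \<partial>?L"
  let ?S = "\<integral>\<^sup>+p. ennreal (s (fst p) (snd p)) * ?k p \<partial>?L"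
  have XS: "?X + ?S = ?I g1 + ?I g2"
  proof -
    have "?X + ?S = (\<integral>\<^sup>+p. ennreal (t (fst p) (snd p)) * ?k p + ennreal (s (fst p) (snd p)) * ?k p \<partial>?L)"
      by (rule nn_integral_add[symmetric]) measurable
    also have "\<dots> = (\<integral>\<^sup>+p. ennreal (g1 (fst p)) * ennreal (g1 (snd p)) * ?k p
        + ennreal (g2 (fst p)) * ennreal (g2 (snd p)) * ?k p \<partial>?L)"
    proof (rule nn_integral_cong)
      fix p :: "(real ^ 3) \<times> (real ^ 3)"
      have "t (fst p) (snd p) + s (fst p) (snd p) = g1 (fst p) * g1 (snd p) + g2 (fst p) * g2 (snd p)"
        unfolding t_def s_def g1_def g2_def by (simp add: algebra_simps)
      then have "ennreal (t (fst p) (snd p)) + ennreal (s (fst p) (snd p))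
          = ennreal (g1 (fst p)) * ennreal (g1 (snd p)) + ennreal (g2 (fst p)) * ennreal (g2 (snd p))"
        using s0[of "fst p" "snd p"] t0[of "fst p" "snd p"] g0 by (simp flip: ennreal_plus ennreal_mult)
      then show "ennreal (t (fst p) (snd p)) * ?k p + ennreal (s (fst p) (snd p)) * ?k p
          = ennreal (g1 (fst p)) * ennreal (g1 (snd p)) * ?k p
        + ennreal (g2 (fst p)) * ennreal (g2 (snd p)) * ?k p"
        by (simp only: distrib_right[symmetric])
    qed
    also have "\<dots> = ?I g1 + ?I g2"
      by (subst (1 2) interact_pair, measurable, subst nn_integral_add) simp_all
    finally show ?thesis .
  qed
  have "?I g1 + ?I g2 \<le> ennreal (?x1) + ennreal (?x2)"
    using I1 I2 by (rule add_mono)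
  also have "\<dots> = ennreal (?x1 + ?x2)" by (simp flip: ennreal_plus)
  finally have I12: "?I g1 + ?I g2 \<le> ennreal (?x1 + ?x2)" .
  then have "?X \<le> ennreal (?x1 + ?x2)"
    unfolding XS[symmetric] by (rule order_trans[rotated]) simp
  then obtain xe where xe: "?X = ennreal xe" "0 \<le> xe" "xe \<le> ?x1 + ?x2"
    by (subst (asm) le_ennreal_iff) auto
  have kin: "kinetic_energy \<gamma> = ennreal ?c * (?K g1 + ?K g2)"
    by (rule kinetic_energy_eq[OF _ _ g0(1,2) tr]) measurable
  have ex: "exchange_energy \<gamma> = ennreal (?c * (1 / (2 * pi\<^sup>2) * xe))"
  proof -
    have tr2: "AE p in ?L. Re (trace (\<gamma> (fst p) ** \<gamma> (snd p))) = t (fst p) (snd p)"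
      using AE_pair_both[OF st] by eventually_elim (simp add: Re_trace_mult t_def)
    have "exchange_energy \<gamma> = ennreal ?c * (ennreal (1 / (2 * pi\<^sup>2)) * ennreal xe)"
      unfolding xe(1)[symmetric] by (rule exchange_energy_eq[OF _ tr2 t0]) measurable
    also have "\<dots> = ennreal (?c * (1 / (2 * pi\<^sup>2) * xe))"
      using xe(2) by (intro ennreal_mult_mult) simp_all
    finally show ?thesis .
  qed
  have hp: "?c > 0" by simp
  let ?e = "ball_energy m1 + ball_energy m2"
  have be: "?e = ?c * (?q1 + ?q2)
      - ?c * (1 / (2 * pi\<^sup>2) * (?x1 + ?x2))"
    unfolding ball_energy_eq[symmetric] by (simp only: distrib_left)
  show ?thesis
  \<comment> \<open>The exchange energy is already known to be finite, so infinite kinetic energy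
    makes the total infinite and the equality cases vacuous.\<close>
  proof (cases "?K g1 = top \<or> ?K g2 = top")
    case True
    then have "kinetic_energy \<gamma> = top" unfolding kin using hp by (auto simp: ennreal_mult_top)
    then have H: "HF_energy \<gamma> = \<infinity>" unfolding HF_energy_def ex by (simp add: xe(2))
    show ?thesis by (rule that[OF m0(2) le sum]) (simp_all add: H)
  next
    case False
    obtain k1 where k1: "?K g1 = ennreal k1" "0 \<le> k1" using False by (cases "?K g1") auto
    obtain k2 where k2: "?K g2 = ennreal k2" "0 \<le> k2" using False by (cases "?K g2") auto
    note k = k1(1) k2(1) k1(2) k2(2)
    have kin': "kinetic_energy \<gamma> = ennreal (?c * (k1 + k2))"
      unfolding kin k(1,2) ennreal_plus[OF k(3,4), symmetric] using k(3,4)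
      by (intro ennreal_mult[symmetric]) simp_all
    have kl: "?q1 \<le> k1" "?q2 \<le> k2"
      using K1(1) K2(1) k by simp_all
    have H: "HF_energy \<gamma> = ereal (?c * (k1 + k2) - ?c * (1 / (2 * pi\<^sup>2) * xe))"
      unfolding HF_energy_def kin' ex using k(3,4) xe(2) by (intro ereal_diff_ennreal) simp_all
    have a1: "?c * (?q1 + ?q2) \<le> ?c * (k1 + k2)"
      using hp kl by (intro mult_left_mono add_mono) simp_all
    have a2: "?c * (1 / (2 * pi\<^sup>2) * xe) \<le> ?c * (1 / (2 * pi\<^sup>2) * (?x1 + ?x2))"
      using hp xe(3) by (intro mult_left_mono) simp_all
    have lower: "ereal ?e \<le> HF_energy \<gamma>" unfolding H be using a1 a2 by simp
    \<comment> \<open>The bound is a sum of separate inequalities for the two kinetic terms and the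
      exchange term, so equality in the sum forces each of them.\<close>
    have eqs: "k1 = ?q1 \<and> k2 = ?q2
        \<and> xe = ?x1 + ?x2" if "HF_energy \<gamma> = ereal ?e"
    proof -
      have e: "?c * (k1 + k2) - ?c * (1 / (2 * pi\<^sup>2) * xe) = ?e" using that unfolding H by simp
      have "?c * (k1 + k2) = ?c * (?q1 + ?q2)"
        using e a1 a2 unfolding be by linarith
      then have 1: "k1 + k2 = ?q1 + ?q2"
        using hp by (simp only: mult_cancel_left) simp
      have "?c * (1 / (2 * pi\<^sup>2) * xe) = ?c * (1 / (2 * pi\<^sup>2) * (?x1 + ?x2))"
        using e a1 a2 unfolding be by linarith
      then have 2: "xe = ?x1 + ?x2"
        using hp by (simp only: mult_cancel_left) simp
      show ?thesis using 1 2 kl by linarith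
    qed
    \<comment> \<open>Both eigenvalues are now the indicator of one ball; their difference is twice
      the length of the spin vector, which therefore vanishes.\<close>
    have para: "paramagnetic \<rho> \<gamma>" if H: "HF_energy \<gamma> = ereal ?e" and mm: "m1 = m2"
    proof -
      have m: "m1 = \<rho> / 2" "m2 = \<rho> / 2" using mm sum by simp_all
      have r2: "\<rho> / 2 > 0" using rho by simp
      have "AE x in lborel. g1 x = indicator (cball 0 (fermi (\<rho> / 2))) x" "AE x in lborel. g2 x = indicator (cball 0 (fermi (\<rho> / 2))) x"
        using K1(2) K2(2) eqs[OF H] k unfolding m by simp_all
      then have "AE x in lborel. \<gamma> x = gamma_para \<rho> x"
        using st
      proof eventually_elim
        case (elim x)
        then have "norm (b x) = 0" "a x = indicator (cball 0 (fermi (\<rho> / 2))) x"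
          unfolding g1_def g2_def by linarith+
        then have n: "b x = 0" "a x = indicator (cball 0 (fermi (\<rho> / 2))) x" by simp_all
        show ?case
          unfolding gamma_para_def c_TF_ball[OF r2]
          by (rule spin_matrix_eqI) (use elim n in \<open>auto simp: indicator_def\<close>)
      qed
      then show ?thesis unfolding paramagnetic_def AE_lebesgue_iff .
    qed
    have ferro: "ferromagnetic \<rho> \<gamma>" if H: "HF_energy \<gamma> = ereal ?e" and mm: "m2 = 0"
    proof -
      have m: "m1 = \<rho>" "m2 = 0" using mm sum by simp_all
      let ?B = "cball (0 :: real ^ 3) (fermi \<rho>)"
      \<comment> \<open>Since \<open>fermi 0 = 0\<close>, the second ball is the single point 0, a
        null set.\<close>
      have "AE x in lborel. g1 x = indicator ?B x" "AE x in lborel. g2 x = indicator (cball 0 0) x"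
        using K1(2) K2(2) eqs[OF H] k unfolding m by simp_all
      then have half: "AE x in lborel. a x = indicator ?B x / 2 \<and> norm (b x) = indicator ?B x / 2"
        using AE_lborel_neq[of 0]
        by eventually_elim (auto simp: g1_def g2_def)
      have "?X + ?S \<le> ?X + 0"
        using I12 eqs[OF H] unfolding XS[symmetric] xe(1) by simp
      then have "?S = 0" unfolding xe(1) by (simp add: ennreal_add_left_cancel_le)
      then have "AE p in ?L. ennreal (s (fst p) (snd p)) * ?k p = 0"
        by (subst (asm) nn_integral_0_iff_AE) simp_all
      then have "AE p in ?L. s (fst p) (snd p) = 0"
      proof eventually_elim
        case (elim p)
        have "?k p \<noteq> 0" by (simp add: kern_def)
        with elim show ?case using s0[of "fst p" "snd p"] by simp
      qed
      \<comment> \<open>The kernel vanishes nowhere, so the deficit is 0 for almost every pair. By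
        Fubini almost every x has its spin vector aligned with that of almost every y; the ball has
        positive measure, so such an x exists in it, and its spin vector of length 1/2 determines
        \<nu>.\<close>
      then have "AE x in lborel. AE y in lborel. s x y = 0"
        using lborel_pair.AE_pair[of "\<lambda>p. s (fst p) (snd p) = 0"] by simp
      then have P: "AE x in lborel. (AE y in lborel. s x y = 0) \<and> norm (b x) = indicator ?B x / 2"
        using half by eventually_elim simp
      have nB: "\<not> (AE x in lborel. x \<notin> ?B)"
      proof
        assume "AE x in lborel. x \<notin> ?B"
        then have "?B \<in> null_sets lborel" by (subst AE_iff_null_sets) auto
        then have "emeasure lborel ?B = 0" by auto
        moreover have "0 < 4 * pi / 3 * fermi \<rho> ^ 3" using fermi_pos[OF rho] by simp
        ultimately show False by (simp only: emeasure_cball_3[OF fermi_nonneg] ennreal_eq_0_iff not_less)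
      qed
      have "\<exists>y0. y0 \<in> ?B \<and> (AE y in lborel. s y0 y = 0) \<and> norm (b y0) = indicator ?B y0 / 2"
      proof (rule ccontr)
        assume none: "\<not> (\<exists>y0. y0 \<in> ?B \<and> (AE y in lborel. s y0 y = 0) \<and> norm (b y0) = indicator ?B y0 / 2)"
        have "AE x in lborel. x \<notin> ?B"
          using P by (rule eventually_mono) (use none in blast)
        with nB show False ..
      qed
      then obtain y0 where y0: "y0 \<in> ?B" "AE y in lborel. s y0 y = 0" "norm (b y0) = indicator ?B y0 / 2"
        by blast
      have n0: "norm (b y0) = 1 / 2" using y0 by simp
      obtain \<nu> where \<nu>: "norm \<nu> = 1" "spin (ket_bra \<nu>) = b y0" using ket_bra_of_spin[OF n0] .
      have "AE x in lborel. \<gamma> x = gamma_ferro \<rho> \<nu> x"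
        using y0(2) half st
      proof eventually_elim
        case (elim x)
        have bx: "b x = (if x \<in> ?B then b y0 else 0)"
        proof (cases "x \<in> ?B")
          case True
          then have n: "norm (b x) = 1 / 2" using elim(2) by simp
          have i: "b y0 \<bullet> b x = 1 / 4" using elim(1) n n0 by (simp add: s_def)
          have "(norm (b x - b y0))\<^sup>2 = (norm (b x))\<^sup>2 + (norm (b y0))\<^sup>2 - 2 * (b y0 \<bullet> b x)"
            by (simp only: power2_norm_eq_inner inner_diff_left inner_diff_right inner_commute[of "b x" "b y0"])
          also have "\<dots> = 0" unfolding n n0 i by (simp add: power2_eq_square)
          finally have "(norm (b x - b y0))\<^sup>2 = 0" .
          then show ?thesis using True by simp
        qed (use elim(2) in auto)
        show ?case
          unfolding gamma_ferro_def c_TF_ball[OF rho]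
          by (rule spin_matrix_eqI) (use elim bx \<nu> in \<open>auto simp: indicator_def\<close>)
      qed
      then show ?thesis unfolding ferromagnetic_def AE_lebesgue_iff using \<nu>(1) by blast
    qed
    show ?thesis by (rule that[OF m0(2) le sum lower para ferro])
  qed
qed

section \<open>Ground state energy and minimisers at each density\<close>

lemma ferromagnetic_exists: "\<exists>\<gamma>. ferromagnetic \<rho> \<gamma>"
proof -
  have "norm (axis 1 1 :: complex ^ 2) = 1" by simp
  then show ?thesis unfolding ferromagnetic_def by (intro exI[of _ "gamma_ferro \<rho> (axis 1 1)"] exI[of _ "axis 1 1"]) simp
qed

lemma paramagnetic_exists: "\<exists>\<gamma>. paramagnetic \<rho> \<gamma>"
  unfolding paramagnetic_def by (intro exI[of _ "gamma_para \<rho>"]) simp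

lemma E_HF_eqI:
  assumes "admissible \<rho> \<gamma>" "HF_energy \<gamma> = ereal e" "\<And>\<gamma>. admissible \<rho> \<gamma> \<Longrightarrow> ereal e \<le> HF_energy \<gamma>"
  shows "E_HF \<rho> = ereal e"
  unfolding E_HF_def
proof (rule antisym)
  show "(INF \<gamma> \<in> {\<gamma>. admissible \<rho> \<gamma>}. HF_energy \<gamma>) \<le> ereal e"
    using assms(1) unfolding assms(2)[symmetric] by (intro INF_lower) simp
qed (use assms(3) in \<open>auto intro: INF_greatest\<close>)

text \<open>The energy is bounded below by \<open>ball_energy m1 + ball_energy m2\<close>, which
  exceeds \<open>ball_energy \<rho>\<close> strictly unless \<open>m2 = 0\<close>. A minimiser
  therefore has \<open>m2 = 0\<close> and equality in the first bound, which makes it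
  ferromagnetic.\<close>

lemma E_HF_low_density:
  assumes rho: "0 < \<rho>" "\<rho> < rho_c"
  shows "E_HF \<rho> = ereal (ball_energy \<rho>)" "is_minimiser \<rho> \<gamma> \<longleftrightarrow> ferromagnetic \<rho> \<gamma>"
proof -
  have lower: "ereal (ball_energy \<rho>) \<le> HF_energy \<gamma> \<and> (HF_energy \<gamma> = ereal (ball_energy \<rho>) \<longrightarrow> ferromagnetic \<rho> \<gamma>)"
    if adm: "admissible \<rho> \<gamma>" for \<gamma>
  proof -
    obtain m1 m2 where m: "0 \<le> m2" "m2 \<le> m1" "m1 + m2 = \<rho>" "ereal (ball_energy m1 + ball_energy m2) \<le> HF_energy \<gamma>"
      "HF_energy \<gamma> = ereal (ball_energy m1 + ball_energy m2) \<Longrightarrow> m2 = 0 \<Longrightarrow> ferromagnetic \<rho> \<gamma>"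
      using HF_energy_lower_bound[OF adm rho(1)] by metis
    show ?thesis
    proof (cases "m2 = 0")
      case True
      then show ?thesis using m by simp
    next
      case False
      then have "ball_energy \<rho> < ball_energy m1 + ball_energy m2"
        using ball_energy_ferro_less[of m2 m1] m rho by simp
      then have "ereal (ball_energy \<rho>) < ereal (ball_energy m1 + ball_energy m2)" by simp
      then have "ereal (ball_energy \<rho>) < HF_energy \<gamma>" using m(4) by (rule less_le_trans)
      then show ?thesis by auto
    qed
  qed
  obtain \<gamma>0 where "ferromagnetic \<rho> \<gamma>0" using ferromagnetic_exists by blast
  then show E: "E_HF \<rho> = ereal (ball_energy \<rho>)"
    using ferromagnetic_energy[OF rho(1)] lower by (intro E_HF_eqI) auto
  show "is_minimiser \<rho> \<gamma> \<longleftrightarrow> ferromagnetic \<rho> \<gamma>"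
    unfolding is_minimiser_def E using lower ferromagnetic_energy[OF rho(1)] by blast
qed

lemma E_HF_high_density:
  assumes rho: "rho_c < \<rho>"
  shows "E_HF \<rho> = ereal (2 * ball_energy (\<rho> / 2))" "is_minimiser \<rho> \<gamma> \<longleftrightarrow> paramagnetic \<rho> \<gamma>"
proof -
  have rho0: "0 < \<rho>" using rho rho_c_pos by simp
  have lower: "ereal (2 * ball_energy (\<rho> / 2)) \<le> HF_energy \<gamma> \<and> (HF_energy \<gamma> = ereal (2 * ball_energy (\<rho> / 2)) \<longrightarrow> paramagnetic \<rho> \<gamma>)"
    if adm: "admissible \<rho> \<gamma>" for \<gamma>
  proof -
    obtain m1 m2 where m: "0 \<le> m2" "m2 \<le> m1" "m1 + m2 = \<rho>" "ereal (ball_energy m1 + ball_energy m2) \<le> HF_energy \<gamma>"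
      "HF_energy \<gamma> = ereal (ball_energy m1 + ball_energy m2) \<Longrightarrow> m1 = m2 \<Longrightarrow> paramagnetic \<rho> \<gamma>"
      using HF_energy_lower_bound[OF adm rho0] by metis
    show ?thesis
    proof (cases "m1 = m2")
      case True
      then have "m1 = \<rho> / 2" "m2 = \<rho> / 2" using m(3) by simp_all
      then have "ball_energy m1 + ball_energy m2 = 2 * ball_energy (\<rho> / 2)" by (simp only: mult_2)
      then show ?thesis using m(4,5) True by simp
    next
      case False
      then have "2 * ball_energy (\<rho> / 2) < ball_energy m1 + ball_energy m2"
        using ball_energy_para_less[of m2 m1] m rho rho0 by simp
      then have "ereal (2 * ball_energy (\<rho> / 2)) < ereal (ball_energy m1 + ball_energy m2)" by simp
      then have "ereal (2 * ball_energy (\<rho> / 2)) < HF_energy \<gamma>" using m(4) by (rule less_le_trans)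
      then show ?thesis by auto
    qed
  qed
  obtain \<gamma>0 where "paramagnetic \<rho> \<gamma>0" using paramagnetic_exists by blast
  then show E: "E_HF \<rho> = ereal (2 * ball_energy (\<rho> / 2))"
    using paramagnetic_energy[OF rho0] lower by (intro E_HF_eqI) auto
  show "is_minimiser \<rho> \<gamma> \<longleftrightarrow> paramagnetic \<rho> \<gamma>"
    unfolding is_minimiser_def E using lower paramagnetic_energy[OF rho0] by blast
qed

text \<open>Both optimal splittings occur here, and \<open>ball_energy_critical\<close> gives them
  the same energy, so both families attain the infimum.\<close>

lemma E_HF_critical_density:
  shows "E_HF rho_c = ereal (ball_energy rho_c)"
    "is_minimiser rho_c \<gamma> \<longleftrightarrow> ferromagnetic rho_c \<gamma> \<or> paramagnetic rho_c \<gamma>"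
proof -
  have lower: "ereal (ball_energy rho_c) \<le> HF_energy \<gamma>
      \<and> (HF_energy \<gamma> = ereal (ball_energy rho_c) \<longrightarrow> ferromagnetic rho_c \<gamma> \<or> paramagnetic rho_c \<gamma>)"
    if adm: "admissible rho_c \<gamma>" for \<gamma>
  proof -
    obtain m1 m2 where m: "0 \<le> m2" "m2 \<le> m1" "m1 + m2 = rho_c" "ereal (ball_energy m1 + ball_energy m2) \<le> HF_energy \<gamma>"
      "HF_energy \<gamma> = ereal (ball_energy m1 + ball_energy m2) \<Longrightarrow> m1 = m2 \<Longrightarrow> paramagnetic rho_c \<gamma>"
      "HF_energy \<gamma> = ereal (ball_energy m1 + ball_energy m2) \<Longrightarrow> m2 = 0 \<Longrightarrow> ferromagnetic rho_c \<gamma>"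
      using HF_energy_lower_bound[OF adm rho_c_pos] by metis
    consider "m2 = 0" | "m1 = m2" | "m2 \<noteq> 0" "m1 \<noteq> m2" by blast
    then show ?thesis
    proof cases
      case 1
      then show ?thesis using m by simp
    next
      case 2
      then have "m1 = rho_c / 2" "m2 = rho_c / 2" using m(3) by simp_all
      then have "ball_energy m1 + ball_energy m2 = ball_energy rho_c"
        unfolding ball_energy_critical[symmetric] by (simp only: mult_2)
      then show ?thesis using m(4,5) 2 by simp
    next
      case 3
      then have "ball_energy rho_c < ball_energy m1 + ball_energy m2"
        using ball_energy_critical_less[of m2 m1] m by simp
      then have "ereal (ball_energy rho_c) < ereal (ball_energy m1 + ball_energy m2)" by simp
      then have "ereal (ball_energy rho_c) < HF_energy \<gamma>" using m(4) by (rule less_le_trans)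
      then show ?thesis by auto
    qed
  qed
  obtain \<gamma>0 where "ferromagnetic rho_c \<gamma>0" using ferromagnetic_exists by blast
  then show E: "E_HF rho_c = ereal (ball_energy rho_c)"
    using ferromagnetic_energy[OF rho_c_pos] lower by (intro E_HF_eqI) auto
  show "is_minimiser rho_c \<gamma> \<longleftrightarrow> ferromagnetic rho_c \<gamma> \<or> paramagnetic rho_c \<gamma>"
    unfolding is_minimiser_def E
    using lower ferromagnetic_energy[OF rho_c_pos] paramagnetic_energy[OF rho_c_pos] ball_energy_critical by metis
qed

text \<open>Finiteness of the energy keeps \<open>real_of_ereal\<close> away from its default value
  0 at infinity, so the jump concerns the ground state energy itself.\<close>

theorem corollary7:
  shows "(\<forall>\<rho> \<gamma>. 0 < \<rho> \<and> \<rho> < rho_c \<longrightarrow> (is_minimiser \<rho> \<gamma> \<longleftrightarrow> ferromagnetic \<rho> \<gamma>))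
       \<and> (\<forall>\<rho> \<gamma>. rho_c < \<rho> \<longrightarrow> (is_minimiser \<rho> \<gamma> \<longleftrightarrow> paramagnetic \<rho> \<gamma>))
       \<and> (\<forall>\<gamma>. is_minimiser rho_c \<gamma> \<longleftrightarrow> ferromagnetic rho_c \<gamma> \<or> paramagnetic rho_c \<gamma>)
       \<and> (\<forall>\<rho>>0. \<bar>E_HF \<rho>\<bar> \<noteq> \<infinity>)
       \<and> derivative_jumps_at (\<lambda>\<rho>. real_of_ereal (E_HF \<rho>)) rho_c"
proof (intro conjI allI impI)
  show "derivative_jumps_at (\<lambda>\<rho>. real_of_ereal (E_HF \<rho>)) rho_c"
    by (rule derivative_jump) (simp_all add: E_HF_low_density E_HF_high_density E_HF_critical_density)
  show "\<bar>E_HF \<rho>\<bar> \<noteq> \<infinity>" if "0 < \<rho>" for \<rho>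
    using that by (cases \<rho> rho_c rule: linorder_cases)
      (simp_all add: E_HF_low_density E_HF_high_density E_HF_critical_density)
qed (simp_all add: E_HF_low_density E_HF_high_density E_HF_critical_density)

end
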